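(* With $\Gamma_R$, its cyclic angular enumeration $\lambda_1,\dots,\lambda_{K(R)}$, and $\mathcal A_R$ as in the context, let for each integer $k\ge1$ $$\mathcal C_k=\lim_{R\to\infty}\frac{1}{K(R)}\sum_{j=1}^{K(R)}\Big(\mathcal A_R(\lambda_j)\mathcal A_R(\lambda_{j+k})-\frac14\Big)$$ (this limit exists). Then $$\lim_{L\to\infty}\frac1L\sum_{k=1}^{L}\mathcal C_k=0.$$
   Context: For $R>0$: $\Gamma_R=\mathbb Z^2\cap\{z: R-\tfrac1{\sqrt2}<\|z\|<R+\tfrac1{\sqrt2}\}$, $K(R)=\#\Gamma_R$; $\Gamma_R=\{\lambda_1,\dots,\lambda_{K}\}$ is ordered by nondecreasing polar argument in $[0,2\pi)$ (ties broken arbitrarily), indices taken cyclically mod $K$; $\mathcal A_R(\lambda)=\operatorname{Area}((\lambda+[-\tfrac12,\tfrac12]^2)\cap B(R))$ with $B(R)$ the open disc of radius $R$ centred at $0$. *)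

theory Defs
  imports "HOL-Analysis.Analysis"
begin

text \<open>The plane is identified with the complex numbers, so that \<open>Arg2pi\<close> is the polar
  argument in \<open>[0, 2\<pi>)\<close>.  Its value at the origin, \<open>Arg2pi 0 = 0\<close>, only plays a role for
  \<open>R < 1 / sqrt 2\<close>.\<close>

definition Gamma_R :: "real \<Rightarrow> complex set" where
  "Gamma_R R = {z. Re z \<in> \<int> \<and> Im z \<in> \<int> \<and>
     R - 1 / sqrt 2 < norm z \<and> norm z < R + 1 / sqrt 2}"

definition K_R :: "real \<Rightarrow> nat" where
  "K_R R = card (Gamma_R R)"

definition unit_square :: "complex set" where
  "unit_square = {z. Re z \<in> {-1/2..1/2} \<and> Im z \<in> {-1/2..1/2}}"

definition area_R :: "real \<Rightarrow> complex \<Rightarrow> real" where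
  "area_R R z = measure lborel (((+) z ` unit_square) \<inter> ball 0 R)"

text \<open>The points are listed as \<open>e 1, \<dots>, e (K_R R)\<close>; ties of the argument may be resolved
  in any way, and the last clause makes the indices cyclic modulo \<open>K_R R\<close>.\<close>

definition angular_enumeration :: "real \<Rightarrow> (nat \<Rightarrow> complex) \<Rightarrow> bool" where
  "angular_enumeration R e \<longleftrightarrow>
     bij_betw e {1..K_R R} (Gamma_R R) \<and>
     mono_on {1..K_R R} (\<lambda>j. Arg2pi (e j)) \<and>
     (\<forall>j. e (j + K_R R) = e j)"

definition corr_avg :: "(real \<Rightarrow> nat \<Rightarrow> complex) \<Rightarrow> nat \<Rightarrow> real \<Rightarrow> real" where
  "corr_avg lam k R =
     1 / real (K_R R) *
       (\<Sum>j = 1..K_R R. area_R R (lam R j) * area_R R (lam R (j + k)) - 1 / 4)"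

definition corr_limit :: "(real \<Rightarrow> nat \<Rightarrow> complex) \<Rightarrow> nat \<Rightarrow> real" where
  "corr_limit lam k = Lim at_top (corr_avg lam k)"

end

theory Submission
  imports Defs
begin

text \<open>
  Near a boundary point of direction \<open>\<theta>\<close> the circle is flat, so \<open>Gamma_R\<close> looks like the lattice
  points of a strip of width \<open>sqrt 2\<close> orthogonal to \<open>\<theta>\<close>, listed along the strip, and \<open>area_R\<close> depends
  only on the distance to the boundary line.  If no nonzero lattice vector is orthogonal to \<open>\<theta>\<close>, the
  projections of lattice vectors to the direction \<open>\<theta>\<close> are dense, and translating by them shows that the
  distance to the boundary is equidistributed over every long arc near \<open>\<theta>\<close>.

  For such \<open>\<theta>\<close> and all but countably many distances, the \<open>k\<close>-th successor of a point is its translate by a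
  locally constant lattice vector, so the summands of \<open>corr_avg\<close> are locally almost constant and their
  averages over short arcs settle down.  Only countably many directions are exceptional, and any additive
  quantity that is Lipschitz in the arc and has small local defect off a countable set has no defect at all;
  hence the limits exist.

  By equidistribution and the symmetry of the square, the average of \<open>area_R\<close> over \<open>L\<close> consecutive points
  is close to \<open>1/2\<close> for large \<open>L\<close>, outside a set of points of small proportion.  Averaging over \<open>k\<close> thus
  replaces the second factor by \<open>1/2\<close>, and the mean of the first is \<open>1/2\<close> as well.
\<close>

subsection \<open>Additive interval functions with small local defect\<close>

text \<open>The local mean in direction \<theta> is not shown to be continuous, or even measurable,
  in \<theta>, so the sums cannot simply be turned into integrals over the circle. Instead a
  predicate \<open>P a b c\<close> says that the quantity on \<open>[a, b)\<close> is known up to an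
  error \<open>c\<close>, often with an unspecified value. Errors add when intervals are joined, so
  bisection bounds the total error; a strictly increasing function that jumps at each exceptional
  point serves as the error budget. The principle is applied twice: to the distance from the
  boundary in a fixed direction, and then to the angle.

  The second obstacle is the order of limits: the block length \<open>L\<close> has to be fixed
  before \<open>R\<close> grows. Estimates are therefore proved for all arcs near \<theta> whose
  length \<open>(b - a) * R\<close> exceeds a constant, not only for arcs of fixed angle.

  The constant \<open>1 / sqrt 2\<close> is half the diagonal of the unit square. It makes the strip
  wide enough to contain a lattice point near every boundary point, and the width
  \<open>sqrt 2\<close> of the strip is the number of its points per unit of boundary
  length.\<close>

lemma null_defect_principle:
  fixes P :: "real \<Rightarrow> real \<Rightarrow> real \<Rightarrow> bool"
  assumes ab: "a0 < b0" and cnt: "countable S" and C: "C \<ge> 0" and eps: "\<epsilon> > 0"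
    and add: "\<And>a b c x y. \<lbrakk>a < b; b < c; P a b x; P b c y\<rbrakk> \<Longrightarrow> P a c (x + y)"
    and mono: "\<And>a b x y. \<lbrakk>P a b x; x \<le> y\<rbrakk> \<Longrightarrow> P a b y"
    and triv: "\<And>a b. a < b \<Longrightarrow> P a b (C * (b - a))"
    and loc: "\<And>x e. \<lbrakk>a0 \<le> x; x \<le> b0; x \<notin> S; e > 0\<rbrakk> \<Longrightarrow>
      \<exists>d>0. \<forall>a b. a < b \<and> a \<le> x \<and> x \<le> b \<and> b - a < d \<longrightarrow> P a b (e * (b - a))"
  shows "P a0 b0 \<epsilon>"
proof -
  define N where "N = (to_nat_on S :: real \<Rightarrow> nat)"
  \<comment> \<open>The middle value at \<open>s\<close> gives a jump of 1 on each side, so an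
    interval that has \<open>s\<close> only as an endpoint still sees it.\<close>
  define \<psi> where "\<psi> s x = (if x < s then 0 else if x = s then 1 else (2::real))" for s x :: real
  define w where "w i x = (if i \<in> N ` S then (1/2)^i * \<psi> (inv_into S N i) x else 0)" for i x
  have inj: "inj_on N S" unfolding N_def using cnt by (rule inj_on_to_nat_on)
  have wle: "\<bar>w i x\<bar> \<le> 2 * (1/2)^i" for i x by (auto simp: w_def \<psi>_def)
  have geo: "summable (\<lambda>i. 2 * (1/2::real)^i)" by (intro summable_mult summable_geometric) auto
  have summ: "summable (\<lambda>i. w i x)" for x
    by (rule summable_comparison_test'[OF geo, of 0]) (use wle in auto)
  \<comment> \<open>\<open>W\<close> jumps at every exceptional point, which pays for the trivial bound there.\<close>
  define W where "W x = (\<Sum>i. w i x)" for x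
  have w0: "0 \<le> w i x" for i x by (auto simp: w_def \<psi>_def)
  have wmono: "w i x \<le> w i y" if "x \<le> y" for i x y using that by (auto simp: w_def \<psi>_def)
  have Wmono: "W x \<le> W y" if "x \<le> y" for x y
    unfolding W_def by (intro suminf_le summ wmono that)
  have W0: "0 \<le> W x" for x unfolding W_def by (intro suminf_nonneg summ w0)
  have W4: "W x \<le> 4" for x
  proof -
    have "W x \<le> (\<Sum>i. 2 * (1/2::real)^i)"
      unfolding W_def by (intro suminf_le summ geo) (use wle in \<open>auto simp: abs_le_iff\<close>)
    also have "\<dots> = 4" by (subst suminf_mult) (auto intro: summable_geometric simp: suminf_geometric)
    finally show ?thesis .
  qed
  have Wjump: "W y - W x \<ge> (1/2)^(N s)" if "s \<in> S" "x \<le> s" "s \<le> y" "x < y" for s x y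
  proof -
    have *: "w (N s) y - w (N s) x \<ge> (1/2)^(N s)"
      using that inj by (auto simp: w_def \<psi>_def)
    have "W y - W x = (\<Sum>i. w i y - w i x)"
      unfolding W_def by (rule suminf_diff[OF summ summ])
    also have "\<dots> \<ge> (\<Sum>i\<in>{N s}. w i y - w i x)"
      using wmono[of x y] that by (intro sum_le_suminf summable_diff summ) auto
    finally show ?thesis using * by simp
  qed
  \<comment> \<open>\<open>x + W x\<close> grows by at most \<open>b0 - a0 + 4\<close> over the
    whole interval, so this factor scales the budget to \<epsilon>.\<close>
  define c where "c = \<epsilon> / (b0 - a0 + 4)"
  have cpos: "c > 0" using ab eps by (simp add: c_def)
  define \<phi> where "\<phi> x = c * (x + W x)" for x
  \<comment> \<open>Bolzano bisection also produces degenerate intervals; these are declared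
    good.\<close>
  define Q where "Q x y \<longleftrightarrow> (x < y \<longrightarrow> P x y (\<phi> y - \<phi> x))" for x y
  have "Q a0 b0"
  proof (rule Bolzano)
    show "a0 \<le> b0" using ab by simp
  next
    fix a b d assume trans: "Q a b" "Q b d" "a \<le> b" "b \<le> d"
    consider "a = b" | "b = d" | "a < b" "b < d" using trans by linarith
    then show "Q a d"
    proof cases
      case 3
      then show ?thesis using add[of a b d "\<phi> b - \<phi> a" "\<phi> d - \<phi> b"] trans by (simp add: Q_def)
    qed (use trans in auto)
  next
    fix x assume x: "a0 \<le> x" "x \<le> b0"
    show "\<exists>d>0. \<forall>a b. a \<le> x \<and> x \<le> b \<and> b - a < d \<longrightarrow> Q a b"
    proof (cases "x \<in> S")
      case False
      obtain d where d: "d > 0" "\<And>a b. a < b \<Longrightarrow> a \<le> x \<Longrightarrow> x \<le> b \<Longrightarrow> b - a < d \<Longrightarrow> P a b (c * (b - a))"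
        using loc[OF x False cpos] by blast
      have "Q a b" if "a \<le> x" "x \<le> b" "b - a < d" for a b
        unfolding Q_def
      proof
        assume "a < b"
        from d(2)[OF this that] show "P a b (\<phi> b - \<phi> a)"
          by (rule mono) (use \<open>a < b\<close> Wmono[of a b] cpos in \<open>simp add: \<phi>_def algebra_simps\<close>)
      qed
      then show ?thesis using d(1) by blast
    next
      case True
      \<comment> \<open>On intervals this short the trivial error \<open>C * (b - a)\<close> is
        below the jump of \<open>c * W\<close> at \<open>x\<close>.\<close>
      define d where "d = c * (1/2)^(N x) / (C + 1)"
      have d: "d > 0" using cpos C by (simp add: d_def)
      have "Q a b" if ab: "a \<le> x" "x \<le> b" "b - a < d" for a b
        unfolding Q_def
      proof
        assume lt: "a < b"
        have "C * (b - a) \<le> (C + 1) * d" using ab C lt by (intro mult_mono) auto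
        also have "\<dots> = c * (1/2)^(N x)" using C by (simp add: d_def)
        also have "\<dots> \<le> c * (W b - W a)"
          using Wjump[OF True ab(1,2) lt] cpos by (intro mult_left_mono) auto
        also have "\<dots> \<le> \<phi> b - \<phi> a" using lt cpos by (simp add: \<phi>_def algebra_simps)
        finally show "P a b (\<phi> b - \<phi> a)" by (rule mono[OF triv[OF lt]])
      qed
      then show ?thesis using d by blast
    qed
  qed
  then have "P a0 b0 (\<phi> b0 - \<phi> a0)" using ab by (simp add: Q_def)
  moreover have "\<phi> b0 - \<phi> a0 \<le> c * (b0 - a0 + 4)"
    using cpos W4[of b0] W0[of a0] by (auto simp: \<phi>_def right_diff_distrib[symmetric])
  moreover have "c * (b0 - a0 + 4) = \<epsilon>" using ab by (simp add: c_def)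
  ultimately show ?thesis using mono by metis
qed

subsection \<open>Rotation invariance of area\<close>

text \<open>The isometry through which the invariance of measure under orthogonal maps of
  \<open>real ^ 2\<close> reaches the complex plane.\<close>

definition vec2 :: "complex \<Rightarrow> real ^ 2" where
  "vec2 z = (\<chi> i. if i = 1 then Re z else Im z)"

lemma borel_vec2 [measurable]: "vec2 \<in> borel_measurable borel"
proof -
  have "continuous_on UNIV vec2"
    unfolding vec2_def
  proof (intro continuous_on_vec_lambda)
    fix i :: 2 show "continuous_on UNIV (\<lambda>x. if i = 1 then Re x else Im x)"
      by (cases "i = 1") (auto intro!: continuous_intros)
  qed
  then show ?thesis by (rule borel_measurable_continuous_onI)
qed

lemma distr_vec2: "distr lborel borel vec2 = lborel"
proof (rule sym, rule lborel_eqI)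
  fix l u :: "real^2"
  assume lu: "\<And>b. b \<in> Basis \<Longrightarrow> l \<bullet> b \<le> u \<bullet> b"
  have lu': "l $ i \<le> u $ i" for i
    using lu[of "axis i 1"] by (simp add: inner_axis axis_in_Basis_iff)
  have "vec2 -` box l u = box (Complex (l$1) (l$2)) (Complex (u$1) (u$2))"
    by (auto simp: mem_box_cart vec2_def forall_2 in_box_complex_iff)
  then have "emeasure (distr lborel borel vec2) (box l u) = emeasure lborel (box (Complex (l$1) (l$2)) (Complex (u$1) (u$2)))"
    by (simp add: emeasure_distr)
  also have "\<dots> = ennreal ((u$1 - l$1) * (u$2 - l$2))"
    using lu' by (subst emeasure_lborel_box) (auto simp: Basis_complex_def)
  also have "(u$1 - l$1) * (u$2 - l$2) = (\<Prod>b\<in>Basis. (u - l) \<bullet> b)"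
    by (simp add: Basis_vec_def UNIV_2 inner_axis axis_eq_axis)
  finally show "emeasure (distr lborel borel vec2) (box l u) = ennreal (\<Prod>b\<in>Basis. (u - l) \<bullet> b)" by simp
qed auto

lemma rotate_borel:
  assumes "S \<in> sets borel" "c \<noteq> (0::complex)"
  shows "(*) c ` S \<in> sets borel"
proof -
  have "(*) c ` S = (\<lambda>z. z / c) -` S"
    using assms(2) by (auto simp: image_iff intro!: bexI[of _ "_ / c"])
  moreover have "(\<lambda>z. z / c) \<in> borel_measurable borel" by measurable
  ultimately show ?thesis using measurable_sets[OF _ assms(1), of "\<lambda>z. z / c" borel] by simp
qed

lemma measure_rotate:
  fixes S :: "complex set"
  assumes S: "S \<in> sets borel" and fin: "emeasure lborel S < \<infinity>" and c: "norm c = 1"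
  shows "measure lborel ((*) c ` S) = measure lborel S"
proof -
  define g where "g x = Complex (x$1) (x$2)" for x :: "real^2"
  have gv: "g (vec2 z) = z" and vg: "vec2 (g x) = x" for z x
    by (auto simp: g_def vec2_def vec_eq_iff complex_eq_iff forall_2)
  have gb [measurable]: "g \<in> borel_measurable borel"
  proof -
    have "continuous_on UNIV g" unfolding g_def Complex_eq by (intro continuous_intros)
    then show ?thesis by (rule borel_measurable_continuous_onI)
  qed
  have img: "vec2 ` T = g -` T" for T
    by (auto simp: gv) (metis vg image_eqI)
  have meas: "vec2 ` T \<in> sets borel" if "T \<in> sets borel" for T
    unfolding img using measurable_sets[OF gb that] by simp
  have inj: "vec2 -` (vec2 ` T) = T" for T by (metis gv inj_vimage_image_eq injI)
  have em: "emeasure lborel (vec2 ` T) = emeasure lborel T" if "T \<in> sets borel" for T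
    by (subst distr_vec2[symmetric], subst emeasure_distr) (use meas[OF that] in \<open>auto simp: inj\<close>)
  have c0: "c \<noteq> 0" using c by auto
  have mulb: "(*) c ` S \<in> sets borel" by (rule rotate_borel[OF S c0])
  define f where "f x = vec2 (c * g x)" for x
  have nv: "norm (vec2 z) = norm z" for z
    by (simp add: norm_vec_def L2_set_def UNIV_2 vec2_def cmod_def)
  have lin: "linear f"
    by (rule linearI) (auto simp: f_def vec2_def g_def vec_eq_iff forall_2 algebra_simps)
  have orth: "orthogonal_transformation f"
    unfolding orthogonal_transformation using lin
    by (auto simp: f_def nv norm_mult c) (metis nv vg)
  have fi: "f ` (vec2 ` S) = vec2 ` ((*) c ` S)" by (auto simp: f_def gv image_iff)
  have lm: "vec2 ` S \<in> lmeasurable"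
    using meas[OF S] em[OF S] fin by (auto simp: fmeasurable_def)
  have "measure lborel ((*) c ` S) = measure lborel (vec2 ` ((*) c ` S))"
    using em[OF mulb] by (simp add: measure_def)
  also have "\<dots> = measure lebesgue (f ` (vec2 ` S))"
    unfolding fi using meas[OF mulb] by (simp add: measure_completion)
  also have "\<dots> = measure lebesgue (vec2 ` S)" by (rule measure_orthogonal_image[OF orth lm])
  also have "\<dots> = measure lborel S"
    using em[OF S] meas[OF S] by (simp add: measure_def)
  finally show ?thesis .
qed

subsection \<open>Areas of polar sectors\<close>

text \<open>\<open>Arg2pi\<close> is continuous off the nonnegative real axis and vanishes on it, so
  multiplying by the indicator of the complement changes nothing.\<close>

lemma borel_measurable_Arg2pi [measurable]: "Arg2pi \<in> borel_measurable borel"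
proof -
  have op: "open (- \<real>\<^sub>\<ge>\<^sub>0 :: complex set)" by (simp add: closed_nonneg_Reals_complex open_Compl)
  have "(\<lambda>z. indicator (- \<real>\<^sub>\<ge>\<^sub>0) z *\<^sub>R Arg2pi z) \<in> borel_measurable borel"
    by (rule borel_measurable_continuous_on_indicator)
       (use op in \<open>auto intro!: continuous_at_imp_continuous_on continuous_at_Arg2pi\<close>)
  also have "(\<lambda>z. indicator (- \<real>\<^sub>\<ge>\<^sub>0) z *\<^sub>R Arg2pi z) = Arg2pi"
    by (auto simp: fun_eq_iff indicator_def Arg2pi_eq_0 complex_nonneg_Reals_iff complex_is_Real_iff)
  finally show ?thesis .
qed

lemma Arg2pi_cis_mult:
  assumes "r > 0" "0 \<le> a" "a < 2 * pi"
  shows "Arg2pi (of_real r * cis a) = a"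
  by (rule Arg2pi_unique[OF _ assms]) (simp add: cis_conv_exp)

lemma polar_Arg2pi: "z = of_real (norm z) * cis (Arg2pi z)"
  using Arg2pi_eq[of z] by (simp add: cis_conv_exp)

text \<open>Cauchy's functional equation on an interval: additivity fixes \<open>f\<close> at the
  multiples of \<open>T / n\<close>, and monotonicity traps the values in between up to
  \<open>f T / n\<close>.\<close>

lemma additive_mono_linear:
  fixes f :: "real \<Rightarrow> real"
  assumes T: "T > 0" and add: "\<And>x y. \<lbrakk>0 \<le> x; 0 \<le> y; x + y \<le> T\<rbrakk> \<Longrightarrow> f (x + y) = f x + f y"
    and mono: "\<And>x y. \<lbrakk>0 \<le> x; x \<le> y; y \<le> T\<rbrakk> \<Longrightarrow> f x \<le> f y"
    and x: "0 \<le> x" "x \<le> T"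
  shows "f x = x * f T / T"
proof -
  have f0: "f 0 = 0" using add[of 0 0] T by simp
  have fT: "f T \<ge> 0" using mono[of 0 T] T f0 by simp
  have mult: "f (real k * y) = real k * f y" if "0 \<le> y" "real k * y \<le> T" for k y
    using that
  proof (induction k)
    case (Suc k)
    have "real k * y \<le> T" using Suc.prems by (simp add: algebra_simps)
    then show ?case using Suc add[of "real k * y" y] by (simp add: algebra_simps)
  qed (simp add: f0)
  have bound: "\<bar>f x - x * f T / T\<bar> \<le> f T / real n" if n: "n > 0" for n :: nat
  proof (cases "x = T")
    case False
    \<comment> \<open>\<open>x\<close> lies between \<open>k * T / n\<close> and
      \<open>(k + 1) * T / n\<close>. The case \<open>x = T\<close> is set apart because there the
      upper grid point would leave the interval.\<close>
    define k where "k = nat \<lfloor>x * n / T\<rfloor>"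
    have k1: "real k \<le> x * n / T" using x T by (simp add: k_def)
    have k2: "x * n / T < real k + 1" using x T by (simp add: k_def) 
    have "x * n / T < n" using x False T n by (simp add: field_simps)
    then have "real k < real n" using k1 by linarith
    then have "k < n" by simp
    then have kn: "real k + 1 \<le> n" by linarith
    have kk: "f (real j * (T / n)) = real j * f T / n" if "real j \<le> n" for j
    proof -
      have "f (real n * (T / n)) = real n * f (T / n)" using n T by (intro mult) auto
      then have "f (T / n) = f T / n" using n by (simp add: field_simps)
      moreover have "f (real j * (T / n)) = real j * f (T / n)"
        using n T that by (intro mult) (auto simp: field_simps)
      ultimately show ?thesis by simp
    qed
    have "f (real k * (T / n)) \<le> f x"
      using k1 n T x by (intro mono) (auto simp: field_simps)
    then have lo: "real k * f T / n \<le> f x" using kk[of k] kn by simp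
    have "f x \<le> f (real (k + 1) * (T / n))"
      using k2 n T x mult_left_mono[OF kn, of T] by (intro mono) (auto simp: field_simps)
    then have hi: "f x \<le> (real k + 1) * f T / n" using kk[of "k+1"] kn by (simp add: add.commute)
    have "real k * (f T / n) \<le> (x * n / T) * (f T / n)" using k1 fT by (intro mult_right_mono) auto
    then have a: "real k * f T / n \<le> x * f T / T" using n by simp
    have "(x * n / T) * (f T / n) \<le> (real k + 1) * (f T / n)" using k2 fT by (intro mult_right_mono) auto
    then have b: "x * f T / T \<le> (real k + 1) * f T / n" using n by simp
    have "(real k + 1) * f T / n = real k * f T / n + f T / n" by (simp add: algebra_simps add_divide_distrib)
    then show ?thesis using lo hi a b by linarith
  qed (use T fT in simp)
  have "\<bar>f x - x * f T / T\<bar> \<le> 0"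
  proof (rule tendsto_lowerbound[of "\<lambda>n. f T / real n" _ sequentially])
    show "(\<lambda>n. f T / real n) \<longlonglongrightarrow> 0" by (rule lim_const_over_n)
    show "\<forall>\<^sub>F n in sequentially. \<bar>f x - x * f T / T\<bar> \<le> f T / real n"
      using eventually_gt_at_top[of 0] by eventually_elim (rule bound)
  qed simp
  then show ?thesis by simp
qed

text \<open>All sectors start at angle 0; others are obtained by rotation, which avoids sectors that
  straddle the cut of \<open>Arg2pi\<close>.\<close>

definition polar_sector :: "real \<Rightarrow> real \<Rightarrow> real \<Rightarrow> complex set" where
  "polar_sector x r1 r2 = {z. Arg2pi z < x \<and> r1 \<le> norm z \<and> norm z < r2}"

lemma polar_sector_borel [measurable]: "polar_sector x r1 r2 \<in> sets borel"
  unfolding polar_sector_def by measurable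

lemma polar_sector_fin: "emeasure lborel (polar_sector x r1 r2) < \<infinity>"
proof -
  have "emeasure lborel (polar_sector x r1 r2) \<le> emeasure lborel (ball (0::complex) r2)"
    by (intro emeasure_mono) (auto simp: polar_sector_def)
  also have "\<dots> < \<infinity>" by (rule emeasure_bounded_finite) simp
  finally show ?thesis .
qed

lemma Arg2pi_rotate:
  assumes "z \<noteq> 0" "0 \<le> Arg2pi z + a" "Arg2pi z + a < 2 * pi"
  shows "Arg2pi (cis a * z) = Arg2pi z + a"
proof -
  have "cis a * z = of_real (norm z) * cis (Arg2pi z + a)"
    by (subst (1) polar_Arg2pi[of z]) (simp add: cis_mult[symmetric] mult_ac)
  then show ?thesis using Arg2pi_cis_mult[of "norm z" "Arg2pi z + a"] assms by simp
qed

text \<open>The sector of angle \<open>x + y\<close> is the disjoint union of the one of angle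
  \<open>x\<close> and the one of angle \<open>y\<close> turned by \<open>x\<close>; nothing wraps
  round because \<open>x + y\<close> is at most a full turn.\<close>

lemma measure_polar_sector_add:
  assumes "0 \<le> x" "0 \<le> y" "x + y \<le> 2 * pi" "r1 > 0"
  shows "measure lborel (polar_sector (x + y) r1 r2) = measure lborel (polar_sector x r1 r2) + measure lborel (polar_sector y r1 r2)"
proof -
  have split: "polar_sector (x + y) r1 r2 = polar_sector x r1 r2 \<union> (*) (cis x) ` polar_sector y r1 r2"
  proof (intro set_eqI iffI)
    fix z assume z: "z \<in> polar_sector (x + y) r1 r2"
    then have z0: "z \<noteq> 0" using assms(4) by (auto simp: polar_sector_def)
    show "z \<in> polar_sector x r1 r2 \<union> (*) (cis x) ` polar_sector y r1 r2"
    proof (cases "Arg2pi z < x")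
      case False
      have "Arg2pi (cis (-x) * z) = Arg2pi z - x"
        using Arg2pi_rotate[OF z0, of "-x"] False z Arg2pi_lt_2pi[of z] assms by simp
      then have "cis (-x) * z \<in> polar_sector y r1 r2" using z by (auto simp: polar_sector_def norm_mult)
      moreover have "z = cis x * (cis (-x) * z)" by (simp add: mult.assoc[symmetric] cis_mult)
      ultimately show ?thesis by blast
    qed (use z in \<open>auto simp: polar_sector_def\<close>)
  next
    fix z assume "z \<in> polar_sector x r1 r2 \<union> (*) (cis x) ` polar_sector y r1 r2"
    then show "z \<in> polar_sector (x + y) r1 r2"
    proof
      assume "z \<in> (*) (cis x) ` polar_sector y r1 r2"
      then obtain v where v: "v \<in> polar_sector y r1 r2" "z = cis x * v" by auto
      have v0: "v \<noteq> 0" using v assms(4) by (auto simp: polar_sector_def)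
      have "Arg2pi z = Arg2pi v + x" unfolding v
        by (rule Arg2pi_rotate[OF v0]) (use v assms Arg2pi_ge_0[of v] in \<open>auto simp: polar_sector_def\<close>)
      then show ?thesis using v by (auto simp: polar_sector_def norm_mult)
    qed (use assms in \<open>auto simp: polar_sector_def\<close>)
  qed
  have disj: "polar_sector x r1 r2 \<inter> (*) (cis x) ` polar_sector y r1 r2 = {}"
  proof -
    have "Arg2pi (cis x * v) \<ge> x" if v: "v \<in> polar_sector y r1 r2" for v
    proof -
      have v0: "v \<noteq> 0" using v assms(4) by (auto simp: polar_sector_def)
      have "Arg2pi (cis x * v) = Arg2pi v + x"
        by (rule Arg2pi_rotate[OF v0]) (use v assms Arg2pi_ge_0[of v] in \<open>auto simp: polar_sector_def\<close>)
      then show ?thesis using Arg2pi_ge_0[of v] by simp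
    qed
    then show ?thesis by (force simp: polar_sector_def)
  qed
  have rb: "(*) (cis x) ` polar_sector y r1 r2 \<in> sets borel" by (intro rotate_borel) auto
  have rf: "emeasure lborel ((*) (cis x) ` polar_sector y r1 r2) < \<infinity>"
  proof -
    have "emeasure lborel ((*) (cis x) ` polar_sector y r1 r2) \<le> emeasure lborel (ball (0::complex) r2)"
      by (intro emeasure_mono) (auto simp: polar_sector_def norm_mult)
    also have "\<dots> < \<infinity>" by (rule emeasure_bounded_finite) simp
    finally show ?thesis .
  qed
  have "measure lborel (polar_sector (x + y) r1 r2) = measure lborel (polar_sector x r1 r2) + measure lborel ((*) (cis x) ` polar_sector y r1 r2)"
    unfolding split by (rule measure_Union) (use disj rb rf polar_sector_fin[of x r1 r2] in auto)
  also have "measure lborel ((*) (cis x) ` polar_sector y r1 r2) = measure lborel (polar_sector y r1 r2)"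
    by (rule measure_rotate) (use polar_sector_fin in auto)
  finally show ?thesis .
qed

text \<open>Additivity and monotonicity in the angle force linearity, and the full annulus gives the
  constant.\<close>

lemma measure_polar_sector:
  assumes "0 \<le> x" "x \<le> 2 * pi" "0 < r1" "r1 \<le> r2"
  shows "measure lborel (polar_sector x r1 r2) = x * (r2\<^sup>2 - r1\<^sup>2) / 2"
proof -
  have "measure lborel (polar_sector x r1 r2) = x * measure lborel (polar_sector (2*pi) r1 r2) / (2*pi)"
  proof (rule additive_mono_linear[where f = "\<lambda>x. measure lborel (polar_sector x r1 r2)" and T = "2*pi"])
    fix x y assume "0 \<le> x" "x \<le> y" "y \<le> 2*pi"
    then show "measure lborel (polar_sector x r1 r2) \<le> measure lborel (polar_sector y r1 r2)"
      using polar_sector_fin[of y r1 r2]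
      by (intro measure_mono_fmeasurable) (auto simp: fmeasurable_def polar_sector_def)
  qed (use assms measure_polar_sector_add in auto)
  also have "polar_sector (2*pi) r1 r2 = ball 0 r2 - ball 0 r1"
    using Arg2pi_lt_2pi by (auto simp: polar_sector_def)
  also have "measure lborel (ball 0 r2 - ball (0::complex) r1) = measure lborel (ball (0::complex) r2) - measure lborel (ball (0::complex) r1)"
    using assms emeasure_bounded_finite[of "ball (0::complex) r2"] by (intro measure_Diff) (auto simp: subset_ball)
  also have "\<dots> = pi * r2\<^sup>2 - pi * r1\<^sup>2"
    using assms content_ball[of r1 "0::complex"] content_ball[of r2 "0::complex"] by (simp add: unit_ball_vol_2 eval_unit_ball_vol)
  finally show ?thesis by (simp add: right_diff_distrib[symmetric])
qed

text \<open>Beyond a full turn the sector is the whole annulus and stops growing. This covers arcs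
  whose angle, once enlarged by a margin, may exceed \<open>2 * pi\<close>.\<close>

lemma measure_polar_sector_le:
  assumes "0 \<le> x" "0 < r1" "r1 \<le> r2"
  shows "measure lborel (polar_sector x r1 r2) \<le> x * (r2\<^sup>2 - r1\<^sup>2) / 2"
proof (cases "x \<le> 2*pi")
  case False
  have "polar_sector x r1 r2 = polar_sector (2*pi) r1 r2"
  proof -
    have "Arg2pi z < x" "Arg2pi z < 2*pi" for z using False Arg2pi_lt_2pi[of z] by linarith+
    then show ?thesis by (simp add: polar_sector_def)
  qed
  also have "measure lborel \<dots> = (2*pi) * (r2\<^sup>2 - r1\<^sup>2) / 2" using assms by (intro measure_polar_sector) auto
  also have "\<dots> \<le> x * (r2\<^sup>2 - r1\<^sup>2) / 2"
    using False assms by (intro divide_right_mono mult_right_mono) (auto intro: power_mono)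
  finally show ?thesis .
qed (use measure_polar_sector[OF assms(1) _ assms(2,3)] in simp)

text \<open>Factor \<open>z + q\<close> as \<open>z * (1 + q / z)\<close> and let \<beta> be the
  imaginary part of \<open>Ln (1 + q / z)\<close>. It is small with \<open>q / z\<close>, and its
  sign is that of \<open>sin \<beta>\<close>, hence of the component of \<open>q\<close>
  perpendicular to \<open>z\<close>.\<close>

lemma perturb_polar:
  assumes z: "z \<noteq> 0" "z = of_real (norm z) * cis \<phi>" and q: "norm q < norm z / 2"
  obtains \<beta> where "\<bar>\<beta>\<bar> \<le> 2 * norm q / norm z" "z + q = of_real (norm (z + q)) * cis (\<phi> + \<beta>)"
    "sgn \<beta> = sgn (Im (q * cnj (cis \<phi>)))" "z + q \<noteq> 0"
proof
  let ?e = "q / z"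
  have e: "norm ?e < 1/2" using q z by (simp add: norm_divide field_simps)
  have ne: "1 + ?e \<noteq> 0"
  proof
    assume "1 + ?e = 0"
    then have "?e = -1" by (simp add: eq_neg_iff_add_eq_0 add.commute)
    then show False using e by simp
  qed
  define \<beta> where "\<beta> = Im (Ln (1 + ?e))"
  have "\<bar>\<beta>\<bar> \<le> norm (Ln (1 + ?e))" unfolding \<beta>_def by (rule abs_Im_le_cmod)
  also have "\<dots> \<le> 2 * norm ?e" by (rule norm_Ln_le[OF e])
  finally show b: "\<bar>\<beta>\<bar> \<le> 2 * norm q / norm z" by (simp add: norm_divide)
  have b1: "\<bar>\<beta>\<bar> < 1" using b e by (simp add: norm_divide mult.commute)
  have pol: "1 + ?e = of_real (norm (1 + ?e)) * cis \<beta>"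
    using exp_Ln[OF ne] exp_eq_polar[of "Ln (1 + ?e)"] norm_exp_eq_Re[of "Ln (1 + ?e)"]
    unfolding \<beta>_def by simp
  have zq: "z + q = z * (1 + ?e)" using z by (simp add: field_simps)
  have nzq: "norm (z + q) = norm z * norm (1 + ?e)" unfolding zq norm_mult ..
  show "z + q \<noteq> 0" unfolding zq using ne z by simp
  have "z + q = (of_real (norm z) * cis \<phi>) * (of_real (norm (1 + ?e)) * cis \<beta>)"
    using zq pol z by metis
  then show "z + q = of_real (norm (z + q)) * cis (\<phi> + \<beta>)"
    unfolding nzq by (simp add: cis_mult[symmetric] mult_ac)
  have i1: "Im ?e = norm (1 + ?e) * sin \<beta>"
    using arg_cong[OF pol, of Im] by simp
  have i2: "Im ?e = Im (q * cnj (cis \<phi>)) / norm z"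
  proof -
    have "?e = q / (of_real (norm z) * cis \<phi>)" by (rule arg_cong[OF z(2)])
    also have "\<dots> = (q * cnj (cis \<phi>)) / of_real (norm z)"
      by (simp add: cis_cnj divide_inverse)
    finally have "?e = (q * cnj (cis \<phi>)) / of_real (norm z)" .
    then show ?thesis by simp
  qed
  have i3: "sgn (sin \<beta>) = sgn \<beta>"
    using b1 sin_gt_zero[of \<beta>] sin_gt_zero[of "-\<beta>"] pi_gt3 by (cases \<beta> "0::real" rule: linorder_cases) auto
  have pos: "norm z > 0" "norm (1 + ?e) > 0" using z ne by auto
  have "sgn \<beta> = sgn (Im ?e)" unfolding i1 sgn_mult i3 using pos(2) by (simp only: sgn_pos mult_1)
  also have "\<dots> = sgn (Im (q * cnj (cis \<phi>)))" unfolding i2 sgn_divide using pos(1) by (simp only: sgn_pos div_by_1)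
  finally show "sgn \<beta> = sgn (Im (q * cnj (cis \<phi>)))" .
qed

subsection \<open>Lattice points in sectors\<close>

definition int_lattice :: "complex set" where "int_lattice = {z. Re z \<in> \<int> \<and> Im z \<in> \<int>}"

lemma int_lattice_add: "z \<in> int_lattice \<Longrightarrow> w \<in> int_lattice \<Longrightarrow> z + w \<in> int_lattice"
  and int_lattice_diff: "z \<in> int_lattice \<Longrightarrow> w \<in> int_lattice \<Longrightarrow> z - w \<in> int_lattice"
  and int_lattice_uminus: "z \<in> int_lattice \<Longrightarrow> - z \<in> int_lattice"
  by (auto simp: int_lattice_def)

lemma int_lattice_eq_range: "int_lattice = range (\<lambda>(m, n). Complex (of_int m) (of_int n))"
proof (intro set_eqI iffI)
  fix z assume "z \<in> int_lattice"
  then obtain m n where "Re z = of_int m" "Im z = of_int n" by (auto simp: int_lattice_def elim!: Ints_cases)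
  then have "z = (\<lambda>(m, n). Complex (of_int m) (of_int n)) (m, n)" by (simp add: complex_eq_iff)
  then show "z \<in> range (\<lambda>(m, n). Complex (of_int m) (of_int n))" by blast
qed (auto simp: int_lattice_def)

lemma countable_int_lattice: "countable int_lattice"
  unfolding int_lattice_eq_range by simp

lemma finite_int_lattice_ball: "finite {z \<in> int_lattice. norm z \<le> r}"
proof -
  let ?I = "{-\<lceil>r\<rceil>..\<lceil>r\<rceil>}"
  have "{z \<in> int_lattice. norm z \<le> r} \<subseteq> (\<lambda>(m, n). Complex (of_int m) (of_int n)) ` (?I \<times> ?I)"
  proof
    fix z assume "z \<in> {z \<in> int_lattice. norm z \<le> r}"
    then obtain m n where z: "z = Complex (of_int m) (of_int n)" "norm z \<le> r"
      unfolding int_lattice_eq_range by auto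
    have "\<bar>Re z\<bar> \<le> r" "\<bar>Im z\<bar> \<le> r" using z abs_Re_le_cmod[of z] abs_Im_le_cmod[of z] by linarith+
    then have "m \<in> ?I" "n \<in> ?I" using z by (auto, linarith+)
    then show "z \<in> (\<lambda>(m, n). Complex (of_int m) (of_int n)) ` (?I \<times> ?I)" using z by force
  qed
  then show ?thesis by (rule finite_subset) auto
qed

definition lattice_sector :: "real \<Rightarrow> real \<Rightarrow> real \<Rightarrow> real \<Rightarrow> real \<Rightarrow> complex set" where
  "lattice_sector R a b s t = {z \<in> int_lattice. a \<le> Arg2pi z \<and> Arg2pi z < b \<and> R + s \<le> norm z \<and> norm z < R + t}"

lemma finite_lattice_sector: "finite (lattice_sector R a b s t)"
  by (rule finite_subset[OF _ finite_int_lattice_ball[of "R + t"]]) (auto simp: lattice_sector_def)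

lemma lattice_sector_split:
  assumes "s \<le> m" "m \<le> t"
  shows "lattice_sector R a b s t = lattice_sector R a b s m \<union> lattice_sector R a b m t"
    and "lattice_sector R a b s m \<inter> lattice_sector R a b m t = {}"
  using assms by (auto simp: lattice_sector_def)

lemma card_lattice_sector_split:
  assumes "s \<le> m" "m \<le> t"
  shows "card (lattice_sector R a b s t) = card (lattice_sector R a b s m) + card (lattice_sector R a b m t)"
  using lattice_sector_split[OF assms, of R a b] by (simp add: card_Un_disjoint finite_lattice_sector)

definition half_diag :: complex where "half_diag = Complex (1/2) (1/2)"

lemma half_diag_sel [simp]: "Re half_diag = 1/2" "Im half_diag = 1/2" by (auto simp: half_diag_def)

lemma norm_lt_1_if_le_half:
  assumes "\<bar>Re q\<bar> \<le> 1/2" "\<bar>Im q\<bar> \<le> 1/2"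
  shows "norm q < 1"
proof -
  have "(Re q)\<^sup>2 \<le> (1/2)\<^sup>2" "(Im q)\<^sup>2 \<le> (1/2)\<^sup>2"
    using assms abs_le_square_iff[of "Re q" "1/2"] abs_le_square_iff[of "Im q" "1/2"] by auto
  then have "(norm q)\<^sup>2 < 1" unfolding cmod_power2 by (simp add: power_divide)
  then show ?thesis by (metis abs_norm_cancel abs_square_less_1)
qed

lemma measure_square_box: "measure lborel (box (z - half_diag) (z + half_diag)) = 1"
  and measure_square_cbox: "measure lborel (cbox (z - half_diag) (z + half_diag)) = 1"
  by (auto simp: measure_lborel_box_eq measure_lborel_cbox_eq Basis_complex_def)

lemma squares_disjoint:
  assumes "z \<in> int_lattice" "w \<in> int_lattice" "p \<in> box (z - half_diag) (z + half_diag)" "p \<in> box (w - half_diag) (w + half_diag)"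
  shows "z = w"
proof -
  obtain a b c d where zw: "z = Complex (of_int a) (of_int b)" "w = Complex (of_int c) (of_int d)"
    using assms(1,2) unfolding int_lattice_eq_range by auto
  have "\<bar>of_int (a - c)\<bar> < (1::real)" "\<bar>of_int (b - d)\<bar> < (1::real)"
    using assms(3,4) unfolding zw by (auto simp: in_box_complex_iff)
  then have "a = c" "b = d" by linarith+
  then show ?thesis using zw by simp
qed

lemma measure_rotated_polar_sector:
  "measure lborel ((*) (cis a) ` polar_sector x r1 r2) = measure lborel (polar_sector x r1 r2)"
  by (rule measure_rotate) (use polar_sector_fin in auto)

lemma rotated_polar_sector_fmeasurable: "(*) (cis a) ` polar_sector x r1 r2 \<in> fmeasurable lborel"
proof (rule fmeasurableI)
  show "(*) (cis a) ` polar_sector x r1 r2 \<in> sets lborel" using rotate_borel[of "polar_sector x r1 r2" "cis a"] by auto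
  have "emeasure lborel ((*) (cis a) ` polar_sector x r1 r2) \<le> emeasure lborel (ball (0::complex) r2)"
    by (intro emeasure_mono) (auto simp: polar_sector_def norm_mult)
  also have "\<dots> < \<infinity>" by (rule emeasure_bounded_finite) simp
  finally show "emeasure lborel ((*) (cis a) ` polar_sector x r1 r2) < \<infinity>" .
qed

lemma mem_rotated_polar_sector:
  assumes "p = of_real (norm p) * cis \<phi>" "p \<noteq> 0" "a \<le> \<phi>" "\<phi> < a + x" "r1 \<le> norm p" "norm p < r2"
  shows "p \<in> (*) (cis a) ` polar_sector x r1 r2"
proof
  let ?v = "cis (-a) * p"
  show "p = cis a * ?v" by (simp add: mult.assoc[symmetric] cis_mult)
  have v: "?v = of_real (norm p) * cis (\<phi> - a)"
    by (subst (1) assms(1)) (simp add: cis_mult mult_ac)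
  have "Arg2pi ?v < x"
  proof (cases "x > 2 * pi")
    case True then show ?thesis using Arg2pi_lt_2pi[of ?v] by linarith
  next
    case False
    then have "Arg2pi ?v = \<phi> - a" unfolding v using assms by (intro Arg2pi_cis_mult) auto
    then show ?thesis using assms by simp
  qed
  then show "?v \<in> polar_sector x r1 r2" using assms by (simp add: polar_sector_def norm_mult)
qed

text \<open>Area comparison: the open unit squares around the points are disjoint and lie in the
  sector enlarged by 1 at each radius and by the angle \<open>2 / (R + s)\<close> at each
  end.\<close>

lemma card_lattice_sector_le:
  assumes ab: "a \<le> b" and st: "s \<le> t" and R: "R + s \<ge> 4"
  shows "real (card (lattice_sector R a b s t)) \<le> (b - a + 4 / (R + s)) * (t - s + 2) * (2 * R + s + t) / 2"
proof -
  let ?X = "lattice_sector R a b s t" and ?r1 = "R + s" and ?r2 = "R + t"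
  let ?sq = "\<lambda>z. box (z - half_diag) (z + half_diag)"
  let ?G = "(*) (cis (a - 2 / ?r1)) ` polar_sector (b - a + 4 / ?r1) (?r1 - 1) (?r2 + 1)"
  have sub: "(\<Union>z\<in>?X. ?sq z) \<subseteq> ?G"
  proof
    fix p assume "p \<in> (\<Union>z\<in>?X. ?sq z)"
    then obtain z where z: "z \<in> ?X" "p \<in> ?sq z" by auto
    define q where "q = p - z"
    have q: "norm q < 1" by (rule norm_lt_1_if_le_half) (use z in \<open>auto simp: q_def in_box_complex_iff abs_if\<close>)
    have nz: "norm z \<ge> 4" "norm z \<ge> ?r1" "norm z < ?r2" using z R by (auto simp: lattice_sector_def)
    have z0: "z \<noteq> 0" and qz: "norm q < norm z / 2" using nz q by auto
    obtain \<beta> where b: "\<bar>\<beta>\<bar> \<le> 2 * norm q / norm z" "z + q = of_real (norm (z + q)) * cis (Arg2pi z + \<beta>)" "z + q \<noteq> 0"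
      using perturb_polar[OF z0 polar_Arg2pi qz] by metis
    have "2 * norm q / norm z < 2 / ?r1"
    proof -
      have "2 * norm q / norm z < 2 / norm z" using q nz by (intro divide_strict_right_mono) auto
      also have "\<dots> \<le> 2 / ?r1" using nz R by (intro divide_left_mono mult_pos_pos) auto
      finally show ?thesis .
    qed
    then have bb: "\<bar>\<beta>\<bar> < 2 / ?r1" using b by linarith
    have pz: "p = z + q" by (simp add: q_def)
    have np: "?r1 - 1 \<le> norm p" "norm p < ?r2 + 1"
      using q nz norm_triangle_ineq[of z q] norm_diff_ineq[of z q] unfolding pz by linarith+
    show "p \<in> ?G"
    proof (rule mem_rotated_polar_sector)
      show "p = of_real (norm p) * cis (Arg2pi z + \<beta>)" using b(2) pz by simp
      show "p \<noteq> 0" using b pz by simp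
      have "4 / ?r1 = 2 / ?r1 + 2 / ?r1" by simp
      then show "a - 2 / ?r1 \<le> Arg2pi z + \<beta>" "Arg2pi z + \<beta> < a - 2 / ?r1 + (b - a + 4 / ?r1)"
        using bb z by (auto simp: lattice_sector_def)
    qed (use np in auto)
  qed
  have disj: "disjoint_family_on ?sq ?X"
    unfolding disjoint_family_on_def using squares_disjoint by (fastforce simp: lattice_sector_def)
  have "real (card ?X) = (\<Sum>z\<in>?X. measure lborel (?sq z))" by (simp add: measure_square_box)
  also have "\<dots> = measure lborel (\<Union>z\<in>?X. ?sq z)"
    by (rule measure_finite_Union[symmetric]) (use finite_lattice_sector disj emeasure_bounded_finite[OF bounded_box[where 'a=complex]] in \<open>auto simp: less_top[symmetric]\<close>)
  also have "\<dots> \<le> measure lborel ?G"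
    using sub by (rule measure_mono_fmeasurable)
      (use rotated_polar_sector_fmeasurable finite_lattice_sector in \<open>auto intro!: sets.finite_UN\<close>)
  also have "\<dots> \<le> (b - a + 4 / ?r1) * ((?r2 + 1)\<^sup>2 - (?r1 - 1)\<^sup>2) / 2"
    unfolding measure_rotated_polar_sector using ab st R by (intro measure_polar_sector_le) auto
  also have "(?r2 + 1)\<^sup>2 - (?r1 - 1)\<^sup>2 = (t - s + 2) * (2 * R + s + t)"
    by (simp add: power2_eq_square algebra_simps)
  finally show ?thesis by (simp add: mult.assoc)
qed

text \<open>Conversely, the closed unit squares around the points cover the sector shrunk by the
  same margins: round the coordinates of any point of it. The bounds on \<open>a\<close> and
  \<open>b\<close> keep the argument of the rounded point on the same branch.\<close>

lemma card_lattice_sector_ge: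
  assumes a: "0 \<le> a" and b: "b \<le> 2 * pi" and ab: "b - a \<ge> 4 / (R + s)" and st: "t - s \<ge> 2" and R: "R + s \<ge> 4"
  shows "real (card (lattice_sector R a b s t)) \<ge> (b - a - 4 / (R + s)) * (t - s - 2) * (2 * R + s + t) / 2"
proof -
  let ?X = "lattice_sector R a b s t" and ?r1 = "R + s" and ?r2 = "R + t"
  let ?sq = "\<lambda>z. cbox (z - half_diag) (z + half_diag)"
  let ?G = "(*) (cis (a + 2 / ?r1)) ` polar_sector (b - a - 4 / ?r1) (?r1 + 1) (?r2 - 1)"
  have r1: "?r1 > 0" using R by simp
  have sub: "?G \<subseteq> (\<Union>z\<in>?X. ?sq z)"
  proof
    fix p assume "p \<in> ?G"
    then obtain v where v: "p = cis (a + 2 / ?r1) * v" "v \<in> polar_sector (b - a - 4 / ?r1) (?r1 + 1) (?r2 - 1)" by auto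
    have np: "?r1 + 1 \<le> norm p" "norm p < ?r2 - 1" using v by (auto simp: polar_sector_def norm_mult)
    define \<phi> where "\<phi> = Arg2pi v + a + 2 / ?r1"
    have "v = of_real (norm p) * cis (Arg2pi v)" using polar_Arg2pi[of v] v by (simp add: norm_mult)
    then have "p = cis (a + 2 / ?r1) * (of_real (norm p) * cis (Arg2pi v))" using v(1) by simp
    also have "\<dots> = of_real (norm p) * (cis (a + 2 / ?r1) * cis (Arg2pi v))" by (simp only: mult_ac)
    also have "\<dots> = of_real (norm p) * cis \<phi>" by (simp only: cis_mult \<phi>_def add_ac)
    finally have pp: "p = of_real (norm p) * cis \<phi>" .
    have "4 / ?r1 = 2 / ?r1 + 2 / ?r1" by simp
    then have ph: "a + 2 / ?r1 \<le> \<phi>" "\<phi> < b - 2 / ?r1"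
      using v(2) Arg2pi_ge_0[of v] by (auto simp: \<phi>_def polar_sector_def)
    define z where "z = Complex (of_int (round (Re p))) (of_int (round (Im p)))"
    have zl: "z \<in> int_lattice" by (simp add: z_def int_lattice_def)
    define q where "q = z - p"
    have qq: "\<bar>Re q\<bar> \<le> 1/2" "\<bar>Im q\<bar> \<le> 1/2"
      using of_int_round_abs_le[of "Re p"] of_int_round_abs_le[of "Im p"] by (auto simp: q_def z_def)
    then have q: "norm q < 1" by (rule norm_lt_1_if_le_half)
    have "norm q < norm p / 2" "p \<noteq> 0" using q np R by auto
    then obtain \<beta> where be: "\<bar>\<beta>\<bar> \<le> 2 * norm q / norm p" "p + q = of_real (norm (p + q)) * cis (\<phi> + \<beta>)" "p + q \<noteq> 0"
      using perturb_polar[OF _ pp] by metis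
    have "2 * norm q / norm p < 2 / ?r1"
    proof -
      have "2 * norm q / norm p < 2 / norm p" using q np R by (intro divide_strict_right_mono) auto
      also have "\<dots> \<le> 2 / ?r1" using np R by (intro divide_left_mono mult_pos_pos) auto
      finally show ?thesis .
    qed
    then have bb: "\<bar>\<beta>\<bar> < 2 / ?r1" using be by linarith
    have pz: "p + q = z" by (simp add: q_def)
    have ar: "Arg2pi z = \<phi> + \<beta>"
      using be(2,3) unfolding pz using bb ph a b Arg2pi_cis_mult[of "norm z" "\<phi> + \<beta>"] by (auto simp: abs_less_iff)
    have nz: "?r1 \<le> norm z" "norm z < ?r2"
      using q np norm_triangle_ineq[of p q] norm_diff_ineq[of p q] unfolding pz by linarith+
    have "z \<in> ?X" using zl ar bb ph nz by (auto simp: lattice_sector_def)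
    moreover have "p \<in> ?sq z" using qq by (auto simp: q_def in_cbox_complex_iff abs_if split: if_splits)
    ultimately show "p \<in> (\<Union>z\<in>?X. ?sq z)" by blast
  qed
  have "(b - a - 4 / ?r1) * ((?r2 - 1)\<^sup>2 - (?r1 + 1)\<^sup>2) / 2 = measure lborel ?G"
    unfolding measure_rotated_polar_sector using a b ab st R r1 divide_pos_pos[OF _ r1, of 4]
    by (intro measure_polar_sector[symmetric]) linarith+
  also have "\<dots> \<le> measure lborel (\<Union>z\<in>?X. ?sq z)"
    by (rule measure_mono_fmeasurable[OF sub])
       (use rotated_polar_sector_fmeasurable[THEN fmeasurableD] finite_lattice_sector in \<open>auto intro!: fmeasurable.finite_UN\<close>)
  also have "\<dots> \<le> (\<Sum>z\<in>?X. measure lborel (?sq z))"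
    by (rule measure_UNION_le) (use finite_lattice_sector in auto)
  also have "\<dots> = real (card ?X)" by (simp add: measure_square_cbox)
  also have "(?r2 - 1)\<^sup>2 - (?r1 + 1)\<^sup>2 = (t - s - 2) * (2 * R + s + t)"
    by (simp add: power2_eq_square algebra_simps)
  finally show ?thesis by (simp add: mult.assoc)
qed

subsection \<open>Irrational directions\<close>

text \<open>\<open>radial\<close> and \<open>tangential\<close> are the coordinates in the frame of
  the outward normal \<open>cis \<theta>\<close> and the counterclockwise tangent.\<close>

definition radial :: "real \<Rightarrow> complex \<Rightarrow> real" where "radial \<theta> w = Re (w * cnj (cis \<theta>))"
definition tangential :: "real \<Rightarrow> complex \<Rightarrow> real" where "tangential \<theta> w = Im (w * cnj (cis \<theta>))"

text \<open>The open range for \<theta> stays away from the cut of \<open>Arg2pi\<close>, so that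
  arguments compare as real numbers nearby.\<close>

definition irrational_dir :: "real \<Rightarrow> bool" where
  "irrational_dir \<theta> \<longleftrightarrow> 0 < \<theta> \<and> \<theta> < 2 * pi \<and> (\<forall>w\<in>int_lattice. w \<noteq> 0 \<longrightarrow> radial \<theta> w \<noteq> 0)"

lemma radial_diff: "radial \<theta> (v - w) = radial \<theta> v - radial \<theta> w"
  and tangential_diff: "tangential \<theta> (v - w) = tangential \<theta> v - tangential \<theta> w"
  and tangential_0 [simp]: "tangential \<theta> 0 = 0"
  by (auto simp: radial_def tangential_def algebra_simps)

text \<open>Multiplication by the imaginary unit preserves the lattice and turns
  \<open>tangential\<close> into \<open>- radial\<close>. Consequently distinct lattice points never
  tie in the order along the strip.\<close>

lemma irrational_dir_tangential_nonzero:
  assumes "irrational_dir \<theta>" "w \<in> int_lattice" "w \<noteq> 0"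
  shows "tangential \<theta> w \<noteq> 0"
proof -
  have "\<i> * w \<in> int_lattice" using assms(2) by (auto simp: int_lattice_def)
  then have "radial \<theta> (\<i> * w) \<noteq> 0" using assms by (auto simp: irrational_dir_def)
  then show ?thesis by (simp add: radial_def tangential_def algebra_simps)
qed

text \<open>An exceptional direction is orthogonal to some lattice vector, hence a lattice vector
  turned by a right angle and normalised; there are countably many of these.\<close>

lemma countable_not_irrational_dir: "countable {\<theta>. 0 < \<theta> \<and> \<theta> < 2 * pi \<and> \<not> irrational_dir \<theta>}"
proof -
  let ?T = "{\<theta>. 0 < \<theta> \<and> \<theta> < 2 * pi \<and> \<not> irrational_dir \<theta>}"
  let ?U = "(\<lambda>w. \<i> * w / of_real (norm w)) ` int_lattice"
  have "cis ` ?T \<subseteq> ?U"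
  proof clarify
    fix \<theta> assume "0 < \<theta>" "\<theta> < 2 * pi" "\<not> irrational_dir \<theta>"
    then obtain w where w: "w \<in> int_lattice" "w \<noteq> 0" "radial \<theta> w = 0" by (auto simp: irrational_dir_def)
    let ?x = "w * cnj (cis \<theta>)"
    have re: "Re ?x = 0" using w by (simp add: radial_def)
    have nx: "norm ?x = norm w" by (simp add: norm_mult)
    have "\<bar>Im ?x\<bar> = norm w" using re nx by (simp add: cmod_eq_Im)
    then have "?x = \<i> * of_real (norm w) \<or> ?x = - \<i> * of_real (norm w)"
      using re by (auto simp: complex_eq_iff abs_if split: if_splits)
    moreover have xc: "?x * cis \<theta> = w"
      by (simp add: mult.assoc cis_cnj cis_mult)
    moreover define n :: complex where "n = of_real (norm w)"
    ultimately have "w = \<i> * n * cis \<theta> \<or> w = - \<i> * n * cis \<theta>" by metis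
    moreover have "n \<noteq> 0" using w by (simp add: n_def)
    ultimately have "cis \<theta> = \<i> * (-w) / n \<or> cis \<theta> = \<i> * w / n" by auto
    then have "cis \<theta> = \<i> * (-w) / of_real (norm (-w)) \<or> cis \<theta> = \<i> * w / of_real (norm w)"
      by (simp add: n_def)
    then show "cis \<theta> \<in> ?U" using w int_lattice_uminus by blast
  qed
  then have "countable (cis ` ?T)" using countable_int_lattice by (meson countable_image countable_subset)
  moreover have "inj_on cis ?T"
  proof (rule inj_onI)
    fix x y assume "x \<in> ?T" "y \<in> ?T" "cis x = cis y"
    then show "x = y" using Arg2pi_cis_mult[of 1 x] Arg2pi_cis_mult[of 1 y] by auto
  qed
  ultimately show ?thesis by (rule countable_image_inj_on)
qed

text \<open>Dirichlet approximation supplies a lattice vector with small, nonzero radial coordinate;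
  its integer multiples have radial coordinates spaced by less than \<eta>.\<close>

lemma irrational_dir_dense:
  assumes "irrational_dir \<theta>" "\<eta> > 0"
  obtains w where "w \<in> int_lattice" "\<bar>radial \<theta> w - \<tau>\<bar> < \<eta>"
proof -
  define c s where "c = cos \<theta>" and "s = sin \<theta>"
  have radial: "radial \<theta> w = Re w * c + Im w * s" for w by (simp add: radial_def c_def s_def)
  have "\<i> \<in> int_lattice" by (simp add: int_lattice_def)
  then have s0: "s \<noteq> 0" using assms(1) by (force simp: irrational_dir_def radial)
  obtain N :: nat where N: "N > 0" "1 / real N < \<eta>"
    using assms(2) by (metis nat_approx_posE zero_less_Suc)
  obtain h k where hk: "0 < k" "\<bar>of_int k * (c / s) - of_int h\<bar> < 1 / N"
    using Dirichlet_approx[OF N(1), of "c / s"] by metis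
  define w0 where "w0 = Complex (of_int k) (- of_int h)"
  define d where "d = radial \<theta> w0"
  have w0: "w0 \<in> int_lattice" "w0 \<noteq> 0" using hk by (auto simp: w0_def int_lattice_def complex_eq_iff)
  have d0: "d \<noteq> 0" using assms(1) w0 by (auto simp: irrational_dir_def d_def)
  have "d = s * (of_int k * (c / s) - of_int h)" using s0 by (simp add: d_def radial w0_def field_simps)
  then have "\<bar>d\<bar> = \<bar>s\<bar> * \<bar>of_int k * (c / s) - of_int h\<bar>" by (simp add: abs_mult)
  also have "\<dots> \<le> 1 * \<bar>of_int k * (c / s) - of_int h\<bar>"
    by (intro mult_right_mono) (auto simp: s_def)
  also have "\<dots> < \<eta>" using hk N by simp
  finally have d: "\<bar>d\<bar> < \<eta>" .
  define m where "m = \<lfloor>\<tau> / d\<rfloor>"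
  define w where "w = of_int m * w0"
  have "w \<in> int_lattice" using w0 by (auto simp: w_def int_lattice_def)
  moreover have "radial \<theta> w = of_int m * d" by (simp add: w_def d_def radial algebra_simps)
  moreover have "\<bar>of_int m * d - \<tau>\<bar> < \<eta>"
  proof -
    have "\<bar>of_int m - \<tau> / d\<bar> \<le> 1" unfolding m_def by linarith
    then have "\<bar>of_int m - \<tau> / d\<bar> * \<bar>d\<bar> \<le> 1 * \<bar>d\<bar>" by (rule mult_right_mono) simp
    then have "\<bar>(of_int m - \<tau> / d) * d\<bar> \<le> \<bar>d\<bar>" by (simp add: abs_mult)
    then show ?thesis using d d0 by (simp add: left_diff_distrib)
  qed
  ultimately show ?thesis using that by simp
qed

section \<open>Effect of a translation on modulus and argument\<close>

lemma norm_cis_diff_le: "norm (cis a - cis b) \<le> \<bar>a - b\<bar>"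
proof -
  have "cis a - cis b = cis b * (exp (\<i> * of_real (a - b)) - 1)"
    unfolding cis_conv_exp[symmetric] right_diff_distrib cis_mult by simp
  then have "norm (cis a - cis b) = 2 * \<bar>sin ((a - b) / 2)\<bar>"
    by (simp add: norm_mult dist_exp_i_1 del: of_real_diff)
  also have "\<dots> \<le> 2 * \<bar>(a - b) / 2\<bar>" by (intro mult_left_mono abs_sin_x_le_abs_x) auto
  finally show ?thesis by simp
qed

text \<open>Along the direction of \<open>z\<close> the modulus changes by the component of
  \<open>w\<close> up to a second-order term; replacing that direction by \<theta> costs
  \<open>norm w\<close> times the angle between them.\<close>

lemma norm_shift:
  assumes z: "z \<noteq> 0" and w: "norm w \<le> norm z / 2"
  shows "\<bar>norm (z + w) - norm z - radial \<theta> w\<bar> \<le> (norm w)\<^sup>2 / norm z + norm w * \<bar>Arg2pi z - \<theta>\<bar>"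
proof -
  define r \<phi> where "r = norm z" and "\<phi> = Arg2pi z"
  have r: "r > 0" using z by (simp add: r_def)
  have zp: "z = of_real r * cis \<phi>" unfolding r_def \<phi>_def by (rule polar_Arg2pi)
  define x y where "x = Re (w * cnj (cis \<phi>))" and "y = Im (w * cnj (cis \<phi>))"
  have xy: "x\<^sup>2 + y\<^sup>2 = (norm w)\<^sup>2"
    unfolding x_def y_def cmod_power2[symmetric] by (simp add: norm_mult)
  have "norm (z + w) = norm ((z + w) * cnj (cis \<phi>))" by (simp add: norm_mult)
  also have "(z + w) * cnj (cis \<phi>) = Complex (r + x) y"
    by (simp add: zp x_def y_def complex_eq_iff algebra_simps cis_cnj) 
       (metis (no_types) distrib_left mult.right_neutral power2_eq_square sin_cos_squared_add3 add.commute)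
  finally have n: "norm (z + w) = norm (Complex (r + x) y)" .
  have lo: "r + x \<le> norm (z + w)" unfolding n using complex_Re_le_cmod[of "Complex (r + x) y"] by simp
  have "x\<^sup>2 \<le> (norm w)\<^sup>2" using xy by (metis zero_le_power2 le_add_same_cancel1)
  then have "\<bar>x\<bar> \<le> norm w" by (metis abs_le_square_iff abs_norm_cancel)
  then have xr: "x \<ge> - r / 2" using w by (simp add: r_def)
  \<comment> \<open>Since \<open>x\<close> is at least \<open>- r / 2\<close>, the cross term in the
    square of \<open>r + x + y\<^sup>2 / r\<close> already dominates
    \<open>y\<^sup>2\<close>.\<close>
  have "y\<^sup>2 \<le> 2 * (r + x) * (y\<^sup>2 / r)"
  proof -
    have "2 * (r + x) * (y\<^sup>2 / r) = (2 * (r + x) / r) * y\<^sup>2" by simp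
    moreover have "2 * (r + x) / r \<ge> 1" using xr r by (simp add: field_simps)
    ultimately show ?thesis using mult_right_mono[of 1 "2 * (r + x) / r" "y\<^sup>2"] by simp
  qed
  then have "(r + x)\<^sup>2 + y\<^sup>2 \<le> (r + x + y\<^sup>2 / r)\<^sup>2"
    using power2_sum[of "r + x" "y\<^sup>2 / r"] zero_le_power2[of "y\<^sup>2 / r"] by linarith
  then have "norm (z + w) \<le> r + x + y\<^sup>2 / r"
    unfolding n complex_norm using xr r by (intro real_le_lsqrt) auto
  also have "y\<^sup>2 / r \<le> (norm w)\<^sup>2 / r" using xy r zero_le_power2[of x] by (intro divide_right_mono) linarith+
  finally have hi: "norm (z + w) \<le> r + x + (norm w)\<^sup>2 / r" by simp
  have a: "\<bar>norm (z + w) - norm z - x\<bar> \<le> (norm w)\<^sup>2 / norm z"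
    using lo hi by (simp add: r_def)
  have "x - radial \<theta> w = Re (w * cnj (cis \<phi> - cis \<theta>))" by (simp add: x_def radial_def algebra_simps)
  then have "\<bar>x - radial \<theta> w\<bar> \<le> norm (w * cnj (cis \<phi> - cis \<theta>))" using abs_Re_le_cmod by metis
  also have "\<dots> \<le> norm w * \<bar>\<phi> - \<theta>\<bar>"
    unfolding norm_mult complex_mod_cnj by (intro mult_left_mono norm_cis_diff_le) auto
  finally show ?thesis using a unfolding \<phi>_def by linarith
qed

text \<open>\<open>perturb_polar\<close> applies, and the hypotheses \<open>lo\<close> and
  \<open>hi\<close> prevent the argument from crossing the cut. The sign part decides later which of
  two nearby points comes first.\<close>

lemma Arg2pi_shift:
  assumes z: "z \<noteq> 0" and w: "norm w < norm z / 2"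
    and lo: "2 * norm w / norm z \<le> Arg2pi z" and hi: "Arg2pi z + 2 * norm w / norm z < 2 * pi"
  shows "\<bar>Arg2pi (z + w) - Arg2pi z\<bar> \<le> 2 * norm w / norm z"
    and "sgn (Arg2pi (z + w) - Arg2pi z) = sgn (tangential (Arg2pi z) w)"
proof -
  obtain \<beta> where b: "\<bar>\<beta>\<bar> \<le> 2 * norm w / norm z" "z + w = of_real (norm (z + w)) * cis (Arg2pi z + \<beta>)"
    "sgn \<beta> = sgn (Im (w * cnj (cis (Arg2pi z))))" "z + w \<noteq> 0"
    using perturb_polar[OF z polar_Arg2pi w] by metis
  have "Arg2pi (z + w) = Arg2pi z + \<beta>"
    by (subst b(2), rule Arg2pi_cis_mult) (use b lo hi in auto)
  then show "\<bar>Arg2pi (z + w) - Arg2pi z\<bar> \<le> 2 * norm w / norm z"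
    and "sgn (Arg2pi (z + w) - Arg2pi z) = sgn (tangential (Arg2pi z) w)"
    using b by (auto simp: tangential_def)
qed

text \<open>Both arcs of fixed small angle and arcs of fixed large length tend along this filter; the former give
  the limit in \<open>R\<close>, the latter control blocks of \<open>L\<close> consecutive points uniformly in \<open>R\<close>.\<close>

definition arc_filter :: "real \<Rightarrow> (real \<times> real \<times> real) filter" where
  "arc_filter \<theta> = inf (filtercomap fst at_top) (inf (filtercomap (\<lambda>(R,a,b). a) (nhds \<theta>))
     (inf (filtercomap (\<lambda>(R,a,b). b) (nhds \<theta>)) (filtercomap (\<lambda>(R,a,b). (b - a) * R) at_top)))"

lemma arc_filter_R: "filterlim (\<lambda>(R,a,b). R) at_top (arc_filter \<theta>)"
  and arc_filter_a: "filterlim (\<lambda>(R,a,b). a) (nhds \<theta>) (arc_filter \<theta>)"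
  and arc_filter_b: "filterlim (\<lambda>(R,a,b). b) (nhds \<theta>) (arc_filter \<theta>)"
  and arc_filter_l: "filterlim (\<lambda>(R,a,b). (b - a) * R) at_top (arc_filter \<theta>)"
proof -
  have "(\<lambda>(R,a,b). R) = (fst :: real \<times> real \<times> real \<Rightarrow> real)" by auto
  then show "filterlim (\<lambda>(R,a,b). R) at_top (arc_filter \<theta>)"
    "filterlim (\<lambda>(R,a,b). a) (nhds \<theta>) (arc_filter \<theta>)"
    "filterlim (\<lambda>(R,a,b). b) (nhds \<theta>) (arc_filter \<theta>)"
    "filterlim (\<lambda>(R,a,b). (b - a) * R) at_top (arc_filter \<theta>)"
    unfolding filterlim_iff_le_filtercomap arc_filter_def by (auto intro: inf.coboundedI1 inf.coboundedI2)
qed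

lemma eventually_arc_filter_elim:
  assumes "eventually P (arc_filter \<theta>)"
  obtains d N where "d > 0" "N > 0" "\<And>R a b. \<lbrakk>R > N; \<bar>a - \<theta>\<bar> < d; \<bar>b - \<theta>\<bar> < d; (b - a) * R > N\<rbrakk> \<Longrightarrow> P (R, a, b)"
proof -
  obtain P1 P2 P3 P4 where P: "eventually P1 (filtercomap fst at_top)"
    "eventually P2 (filtercomap (\<lambda>(R,a,b). a) (nhds \<theta>))"
    "eventually P3 (filtercomap (\<lambda>(R,a,b). b) (nhds \<theta>))"
    "eventually P4 (filtercomap (\<lambda>(R,a,b). (b - a) * R) at_top)"
    "\<And>x. P1 x \<Longrightarrow> P2 x \<Longrightarrow> P3 x \<Longrightarrow> P4 x \<Longrightarrow> P x"
    using assms unfolding arc_filter_def eventually_inf by metis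
  obtain N1 where N1: "\<And>R a b. R \<ge> N1 \<Longrightarrow> P1 (R, a, b)"
    using P(1) unfolding eventually_filtercomap_at_top_linorder by auto
  obtain N4 where N4: "\<And>R a b. (b - a) * R \<ge> N4 \<Longrightarrow> P4 (R, a, b)"
    using P(4) unfolding eventually_filtercomap_at_top_linorder by auto
  obtain d2 where d2: "d2 > 0" "\<And>R a b. \<bar>a - \<theta>\<bar> < d2 \<Longrightarrow> P2 (R, a, b)"
    using P(2) unfolding eventually_filtercomap eventually_nhds_metric by (force simp: dist_real_def)
  obtain d3 where d3: "d3 > 0" "\<And>R a b. \<bar>b - \<theta>\<bar> < d3 \<Longrightarrow> P3 (R, a, b)"
    using P(3) unfolding eventually_filtercomap eventually_nhds_metric by (force simp: dist_real_def)
  show ?thesis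
    by (rule that[of "min d2 d3" "max 1 (max N1 N4)"]) (use N1 N4 d2 d3 P(5) in auto)
qed

subsection \<open>Equidistribution of the radial coordinate\<close>

definition sector_density :: "real \<Rightarrow> real \<Rightarrow> real \<times> real \<times> real \<Rightarrow> real" where
  "sector_density s t = (\<lambda>(R,a,b). real (card (lattice_sector R a b s t)) / ((b - a) * R))"

definition arc_len :: "real \<times> real \<times> real \<Rightarrow> real" where "arc_len = (\<lambda>(R,a,b). (b - a) * R)"

lemma sector_density_arc_len: "sector_density s t (R,a,b) = real (card (lattice_sector R a b s t)) / arc_len (R,a,b)"
  by (simp add: sector_density_def arc_len_def)

lemma arc_filter_basic:
  assumes "0 < \<theta>" "\<theta> < 2 * pi"
  shows "\<forall>\<^sub>F (R,a,b) in arc_filter \<theta>. R > N \<and> 0 < a \<and> b < 2 * pi \<and> a < b \<and> (b - a) * R > M"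
proof -
  have "\<forall>\<^sub>F x in arc_filter \<theta>. (case x of (R,a,b) \<Rightarrow> R) > max N 0"
    by (rule eventually_compose_filterlim[OF eventually_gt_at_top arc_filter_R])
  moreover have "\<forall>\<^sub>F x in arc_filter \<theta>. (case x of (R,a,b) \<Rightarrow> (b - a) * R) > max M 0"
    by (rule eventually_compose_filterlim[OF eventually_gt_at_top arc_filter_l])
  moreover have "\<forall>\<^sub>F x in arc_filter \<theta>. (case x of (R,a,b) \<Rightarrow> a) > 0"
    by (rule order_tendstoD(1)[OF arc_filter_a assms(1)])
  moreover have "\<forall>\<^sub>F x in arc_filter \<theta>. (case x of (R,a,b) \<Rightarrow> b) < 2 * pi"
    by (rule order_tendstoD(2)[OF arc_filter_b assms(2)])
  ultimately show ?thesis
    by eventually_elim (auto simp: zero_less_mult_iff)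
qed

text \<open>Area comparison misjudges the width by at most 2, one unit at each radius; the third
  unit absorbs factors that tend to 1. What matters is that the error does not grow with
  \<open>t - s\<close>.\<close>

lemma sector_density_crude:
  assumes th: "0 < \<theta>" "\<theta> < 2 * pi" and st: "s \<le> t"
  shows "\<forall>\<^sub>F x in arc_filter \<theta>. sector_density s t x \<le> (t - s) + 3" "\<forall>\<^sub>F x in arc_filter \<theta>. sector_density s t x \<ge> (t - s) - 3"
proof -
  let ?n = "\<lambda>(R,a,b). real (card (lattice_sector R a b s t))"
  \<comment> \<open>\<open>?p\<close> is the mean radius divided by \<open>R\<close>, and
    \<open>?q\<close> is the angular margin of the area comparison relative to the angle of the
    arc.\<close>
  let ?p = "\<lambda>(R,a,b). 1 + (s + t) / (2 * R)" and ?q = "\<lambda>(R,a,b). 4 * R / ((R + s) * ((b - a) * R))"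
  have lp: "(?p \<longlongrightarrow> 1) (arc_filter \<theta>)"
  proof -
    have "((\<lambda>R. 1 + (s + t) / (2 * R)) \<longlongrightarrow> 1 + 0) at_top"
      by (intro tendsto_add tendsto_const real_tendsto_divide_at_top[OF tendsto_const]
          filterlim_tendsto_pos_mult_at_top[OF tendsto_const _ filterlim_ident]) simp
    from filterlim_compose[OF this arc_filter_R] show ?thesis by (simp add: case_prod_unfold)
  qed
  have lq: "(?q \<longlongrightarrow> 0) (arc_filter \<theta>)"
  proof -
    have "((\<lambda>R. 4 - 4 * s / (s + R)) \<longlongrightarrow> 4 - 0) at_top"
      by (intro tendsto_diff tendsto_const real_tendsto_divide_at_top[OF tendsto_const]
          filterlim_tendsto_add_at_top[OF tendsto_const] filterlim_ident)
    moreover have "\<forall>\<^sub>F R in at_top. 4 - 4 * s / (s + R) = 4 * R / (R + s)"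
      using eventually_gt_at_top[of "\<bar>s\<bar>"] by eventually_elim (auto simp: field_simps)
    ultimately have "((\<lambda>R. 4 * R / (R + s)) \<longlongrightarrow> 4) at_top"
      using tendsto_cong[THEN iffD1] by force
    from real_tendsto_divide_at_top[OF filterlim_compose[OF this arc_filter_R] arc_filter_l]
    show ?thesis by (simp add: case_prod_unfold)
  qed
  have key: "\<forall>\<^sub>F x in arc_filter \<theta>. arc_len x > 0 \<and> ?q x < 1 \<and>
      ?n x \<le> (1 + ?q x) * (t - s + 2) * ?p x * arc_len x \<and>
      (t - s \<ge> 2 \<longrightarrow> (1 - ?q x) * (t - s - 2) * ?p x * arc_len x \<le> ?n x)"
    using arc_filter_basic[OF th, of "\<bar>s\<bar> + 4" 0] order_tendstoD(2)[OF lq zero_less_one]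
  proof eventually_elim
    case (elim x)
    obtain R a b where x: "x = (R, a, b)" by (cases x)
    have R: "R > \<bar>s\<bar> + 4" "a < b" "0 < a" "b < 2 * pi" using elim x by auto
    have nz: "R + s \<noteq> 0" "R \<noteq> 0" "b - a \<noteq> 0" and arc_len: "arc_len x > 0" using R x by (auto simp: arc_len_def)
    define p q where "p = ?p x" and "q = ?q x"
    have eq1: "4 / (R + s) = q * (b - a)"
      using nz x by (simp add: q_def divide_simps) (simp add: algebra_simps)?
    have eq2: "(2 * R + s + t) / 2 = p * R" using nz x by (simp add: p_def field_simps)
    have q1: "q * (b - a) \<le> 1 * (b - a)" using elim R by (intro mult_right_mono) (auto simp: q_def)
    have scale: "(b - a + y * (b - a)) * u * (2 * R + s + t) / 2 = (1 + y) * u * p * arc_len x" for y u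
    proof -
      have "(b - a + y * (b - a)) * u * (2 * R + s + t) / 2 = (b - a + y * (b - a)) * u * (p * R)"
        by (simp flip: eq2)
      then show ?thesis by (simp add: arc_len_def x algebra_simps)
    qed
    have "real (card (lattice_sector R a b s t)) \<le> (b - a + q * (b - a)) * (t - s + 2) * (2 * R + s + t) / 2"
      unfolding eq1[symmetric] by (rule card_lattice_sector_le) (use R st in auto)
    moreover have "(b - a + - q * (b - a)) * (t - s - 2) * (2 * R + s + t) / 2 \<le> real (card (lattice_sector R a b s t))"
      if "t - s \<ge> 2"
      using card_lattice_sector_ge[of a b R s t] R that q1 eq1 by simp
    ultimately show ?case using arc_len elim(2) unfolding scale p_def q_def by (simp add: x)
  qed
  have "((\<lambda>x. (1 + ?q x) * (t - s + 2) * ?p x) \<longlongrightarrow> (1 + 0) * (t - s + 2) * 1) (arc_filter \<theta>)"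
    by (intro tendsto_intros lp lq)
  from order_tendstoD(2)[OF this, of "t - s + 3"]
  have "\<forall>\<^sub>F x in arc_filter \<theta>. (1 + ?q x) * (t - s + 2) * ?p x < t - s + 3" by simp
  with key show "\<forall>\<^sub>F x in arc_filter \<theta>. sector_density s t x \<le> (t - s) + 3"
  proof eventually_elim
    case (elim x)
    have "?n x \<le> (1 + ?q x) * (t - s + 2) * ?p x * arc_len x" using elim by blast
    also have "\<dots> \<le> (t - s + 3) * arc_len x" using elim by (intro mult_right_mono) auto
    finally show ?case using elim(1) by (cases x) (simp add: sector_density_arc_len divide_le_eq)
  qed
  have "((\<lambda>x. (1 - ?q x) * (t - s - 2) * ?p x) \<longlongrightarrow> (1 - 0) * (t - s - 2) * 1) (arc_filter \<theta>)"
    by (intro tendsto_intros lp lq)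
  from order_tendstoD(1)[OF this, of "t - s - 3"]
  have "\<forall>\<^sub>F x in arc_filter \<theta>. (1 - ?q x) * (t - s - 2) * ?p x > t - s - 3" by simp
  with key show "\<forall>\<^sub>F x in arc_filter \<theta>. sector_density s t x \<ge> (t - s) - 3"
  proof eventually_elim
    case (elim x)
    show ?case
    proof (cases "t - s \<ge> 2")
      case True
      have "(t - s - 3) * arc_len x \<le> (1 - ?q x) * (t - s - 2) * ?p x * arc_len x" using elim by (intro mult_right_mono) auto
      also have "\<dots> \<le> ?n x" using elim True by blast
      finally show ?thesis using elim(1) by (cases x) (simp add: sector_density_arc_len le_divide_eq)
    next
      case False
      have "sector_density s t x \<ge> 0" using elim by (cases x) (simp add: sector_density_arc_len)
      then show ?thesis using False by linarith
    qed
  qed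
qed

text \<open>A bound without any lower bound on the arc: the additive 8 comes from the angular
  margin, as \<open>R + s\<close> is at least \<open>R / 2\<close>. It controls the end pieces of
  arcs.\<close>

lemma card_lattice_sector_thin:
  assumes ab: "a \<le> b" and st: "s \<le> t" and R: "R \<ge> 2 * \<bar>s\<bar> + 2 * \<bar>t\<bar> + 8"
  shows "real (card (lattice_sector R a b s t)) \<le> 2 * ((b - a) * R + 8) * (t - s + 2)"
proof -
  have "R + s \<ge> R / 2" "R > 0" "R + s \<ge> 4" using R by auto
  then have "4 / (R + s) \<le> 4 / (R / 2)" by (intro divide_left_mono mult_pos_pos) auto
  then have 1: "b - a + 4 / (R + s) \<le> b - a + 8 / R" by simp
  have "real (card (lattice_sector R a b s t)) \<le> (b - a + 4 / (R + s)) * (t - s + 2) * (2 * R + s + t) / 2"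
    by (rule card_lattice_sector_le) (use ab st \<open>R + s \<ge> 4\<close> in auto)
  also have "\<dots> = (b - a + 4 / (R + s)) * ((t - s + 2) * ((2 * R + s + t) / 2))" by simp
  also have "\<dots> \<le> (b - a + 8 / R) * ((t - s + 2) * (2 * R))"
    by (rule mult_mono[OF 1]) (use R st ab \<open>R > 0\<close> in \<open>auto intro!: mult_left_mono mult_nonneg_nonneg\<close>)
  also have "\<dots> = 2 * ((b - a) * R + 8) * (t - s + 2)"
    using \<open>R > 0\<close> by (simp add: field_simps)
  finally show ?thesis .
qed

text \<open>Translation by a lattice vector with radial coordinate close to \<tau> injects the
  sector into the shifted one, except for points pushed over the two ends. Their number stays
  bounded while the arc length tends to infinity.\<close>

lemma sector_density_shift:
  assumes irrational_dir: "irrational_dir \<theta>" and st: "s \<le> t" and \<eta>: "\<eta> > 0"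
  shows "\<forall>\<^sub>F x in arc_filter \<theta>. sector_density s t x \<le> sector_density (s + \<tau> - \<eta>) (t + \<tau> + \<eta>) x + \<eta>"
proof -
  have th: "0 < \<theta>" "\<theta> < 2 * pi" using irrational_dir by (auto simp: irrational_dir_def)
  obtain w where w: "w \<in> int_lattice" "\<bar>radial \<theta> w - \<tau>\<bar> < \<eta> / 2" using irrational_dir_dense[OF irrational_dir, of "\<eta>/2"] \<eta> by auto
  define S T where "S = s + \<tau> - \<eta>" and "T = t + \<tau> + \<eta>"
  \<comment> \<open>The translation moves arguments by at most \<open>c / R\<close>, and
    \<open>D\<close> bounds the points in the two end pieces of that angle.\<close>
  define c where "c = 4 * norm w"
  define D where "D = 2 * (2 * (c + 8) * (T - S + 2))"
  \<comment> \<open>The radial error is split as \<eta>/2 from the choice of \<open>w\<close>,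
    \<eta>/4 from curvature and \<eta>/8 from the angular spread; \<open>n1\<close> replaces
    \<open>norm w\<close> so that it can be divided by.\<close>
  define n1 where "n1 = norm w + 1"
  define d where "d = min (\<eta> / (8 * n1)) (min (\<theta> / 2) ((2 * pi - \<theta>) / 2))"
  have n1: "n1 > 0" "norm w \<le> n1" by (auto simp: n1_def add_nonneg_pos)
  have d: "d > 0" using \<eta> n1 th by (auto simp: d_def)
  have ST: "S \<le> T" using st \<eta> by (simp add: S_def T_def)
  have ev1: "\<forall>\<^sub>F x in arc_filter \<theta>. (case x of (R,a,b) \<Rightarrow> a) > \<theta> - d" "\<forall>\<^sub>F x in arc_filter \<theta>. (case x of (R,a,b) \<Rightarrow> b) < \<theta> + d"
    using order_tendstoD(1)[OF arc_filter_a, of "\<theta> - d" \<theta>] order_tendstoD(2)[OF arc_filter_b, of \<theta> "\<theta> + d"] d by auto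
  define N where "N = 2 * \<bar>s\<bar> + 2 * \<bar>t\<bar> + 2 * \<bar>S\<bar> + 2 * \<bar>T\<bar> + 8 + 8 * norm w + 8 * n1\<^sup>2 / \<eta> + c / d"
  have c0: "c \<ge> 0" by (simp add: c_def)
  have Ns: "N \<ge> 2 * \<bar>s\<bar> + 8" "N \<ge> 2 * \<bar>S\<bar> + 2 * \<bar>T\<bar> + 8" "N \<ge> 2 * \<bar>s\<bar> + 8 * norm w" "N \<ge> 8 * n1\<^sup>2 / \<eta>" "N \<ge> c / d"
    using \<eta> d c0 n1 by (auto simp: N_def intro!: add_nonneg_nonneg)
  show ?thesis unfolding S_def[symmetric] T_def[symmetric]
    using ev1 arc_filter_basic[OF th, of N "D / \<eta>"]
  proof eventually_elim
    case (elim x)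
    obtain R a b where x: "x = (R, a, b)" by (cases x)
    have R: "R > N" "a < b" "(b - a) * R > D / \<eta>" "\<theta> - d < a" "b < \<theta> + d" using elim x by auto
    have R0: "R > 0" using R Ns(1) by linarith
    have cR: "c / R < d" using less_le_trans[OF le_less_trans[OF Ns(5) R(1)] order_refl] d R0 by (simp add: field_simps)
    let ?A = "lattice_sector R a b S T" and ?B = "lattice_sector R (a - c / R) a S T" and ?C = "lattice_sector R b (b + c / R) S T"
    have img: "(\<lambda>z. z + w) ` lattice_sector R a b s t \<subseteq> ?A \<union> ?B \<union> ?C"
    proof clarify
      fix z assume z: "z \<in> lattice_sector R a b s t" "z + w \<notin> ?C" "z + w \<notin> ?B"
      have zb: "R + s \<le> norm z" "norm z < R + t" using z(1) by (simp_all add: lattice_sector_def)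
      have nz: "norm z \<ge> R / 2" "norm z \<ge> 4 * norm w" "norm z > 0"
        using zb(1) R(1) Ns(1,3) norm_ge_zero[of w] by linarith+
      have z0: "z \<noteq> 0" using nz by auto
      have arg: "a \<le> Arg2pi z" "Arg2pi z < b" using z(1) by (simp_all add: lattice_sector_def)
      have cz: "2 * norm w / norm z \<le> c / R"
      proof -
        have "2 * norm w / norm z \<le> 2 * norm w / (R / 2)"
          using nz R0 by (intro divide_left_mono mult_pos_pos) auto
        then show ?thesis by (simp add: c_def)
      qed
      have dd: "d \<le> \<theta> / 2" "d \<le> (2 * pi - \<theta>) / 2" "d \<le> \<eta> / (8 * n1)"
        unfolding d_def by linarith+
      have w2: "norm w < norm z / 2" using nz(2,3) norm_ge_zero[of w] by linarith
      have "\<bar>Arg2pi (z + w) - Arg2pi z\<bar> \<le> 2 * norm w / norm z"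
        by (rule Arg2pi_shift(1)[OF z0 w2]) (use arg cz cR R dd in auto)
      then have argw: "a - c / R \<le> Arg2pi (z + w)" "Arg2pi (z + w) < b + c / R" using arg cz by auto
      have "\<bar>norm (z + w) - norm z - radial \<theta> w\<bar> \<le> (norm w)\<^sup>2 / norm z + norm w * \<bar>Arg2pi z - \<theta>\<bar>"
        by (rule norm_shift[OF z0]) (use w2 in simp)
      also have "(norm w)\<^sup>2 / norm z \<le> n1\<^sup>2 / (R / 2)"
        using nz n1 R0 by (intro frac_le power_mono) auto
      also have "n1\<^sup>2 / (R / 2) \<le> \<eta> / 4"
      proof -
        have "8 * n1\<^sup>2 / \<eta> \<le> R" using Ns(4) R by linarith
        then show ?thesis using \<eta> R0 by (simp add: field_simps)
      qed
      also have "norm w * \<bar>Arg2pi z - \<theta>\<bar> \<le> n1 * (\<eta> / (8 * n1))"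
        using n1 arg R dd by (intro mult_mono) auto
      also have "n1 * (\<eta> / (8 * n1)) = \<eta> / 8" using n1 by simp
      finally have "\<bar>norm (z + w) - norm z - radial \<theta> w\<bar> \<le> \<eta> / 4 + \<eta> / 8" by simp
      then have "\<bar>norm (z + w) - norm z - \<tau>\<bar> < \<eta>" using w(2) \<eta> by linarith
      then have nn: "R + S \<le> norm (z + w)" "norm (z + w) < R + T"
        unfolding S_def T_def using zb by linarith+
      have "z + w \<in> int_lattice" using z(1) w(1) by (simp add: lattice_sector_def int_lattice_add)
      then show "z + w \<in> ?A" using z argw nn by (auto simp: lattice_sector_def)
    qed
    have "card (lattice_sector R a b s t) = card ((\<lambda>z. z + w) ` lattice_sector R a b s t)"
      by (rule card_image[symmetric]) (auto simp: inj_on_def)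
    also have "\<dots> \<le> card (?A \<union> ?B \<union> ?C)" by (rule card_mono[OF _ img]) (simp add: finite_lattice_sector)
    also have "\<dots> \<le> card ?A + card ?B + card ?C"
      using card_Un_le[of "?A \<union> ?B" ?C] card_Un_le[of ?A ?B] by linarith
    finally have le: "card (lattice_sector R a b s t) \<le> card ?A + card ?B + card ?C" .
    have "c / R \<ge> 0" using c0 R0 by simp
    then have "real (card ?B) \<le> 2 * ((a - (a - c / R)) * R + 8) * (T - S + 2)"
      using R Ns(2) by (intro card_lattice_sector_thin) (use ST in auto)
    moreover have "real (card ?C) \<le> 2 * ((b + c / R - b) * R + 8) * (T - S + 2)"
      using R Ns(2) \<open>c / R \<ge> 0\<close> by (intro card_lattice_sector_thin) (use ST in auto)
    ultimately have "real (card ?B) + real (card ?C) \<le> D" using R0 by (simp add: D_def)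
    then have "real (card (lattice_sector R a b s t)) \<le> real (card ?A) + D" using le by linarith
    also have "D \<le> \<eta> * ((b - a) * R)" using R(3) \<eta> by (simp add: field_simps)
    finally have "real (card (lattice_sector R a b s t)) \<le> real (card ?A) + \<eta> * ((b - a) * R)" by simp
    moreover have pos: "(b - a) * R > 0" using R R0 by simp
    ultimately have "real (card (lattice_sector R a b s t)) / ((b - a) * R) \<le> (real (card ?A) + \<eta> * ((b - a) * R)) / ((b - a) * R)"
      by (intro divide_right_mono) auto
    also have "\<dots> = real (card ?A) / ((b - a) * R) + \<eta>"
      using pos R(2) R0 by (simp add: add_divide_distrib)
    finally show ?case unfolding x sector_density_def by simp
  qed
qed

lemma card_lattice_sector_sum:
  assumes "d \<ge> 0"
  shows "card (lattice_sector R a b s (s + real m * d)) = (\<Sum>i<m. card (lattice_sector R a b (s + real i * d) (s + real i * d + d)))"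
proof (induction m)
  case 0 show ?case by (auto simp: lattice_sector_def intro: card_eq_0_iff[THEN iffD2])
next
  case (Suc m)
  have "card (lattice_sector R a b s (s + real (Suc m) * d)) =
     card (lattice_sector R a b s (s + real m * d)) + card (lattice_sector R a b (s + real m * d) (s + real (Suc m) * d))"
    using assms by (intro card_lattice_sector_split) (auto simp: algebra_simps)
  then show ?case using Suc by (simp add: algebra_simps)
qed

lemma sector_density_sum:
  assumes "d \<ge> 0"
  shows "sector_density s (s + real m * d) x = (\<Sum>i<m. sector_density (s + real i * d) (s + real i * d + d) x)"
  unfolding sector_density_def by (cases x) (simp add: card_lattice_sector_sum[OF assms] sum_divide_distrib)

text \<open>A long interval is tiled by \<open>m\<close> almost-translates of \<open>[s, t)\<close>; the crude count of the long interval has an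
  error that does not depend on \<open>m\<close>.\<close>

lemma sector_density_tendsto:
  assumes irrational_dir: "irrational_dir \<theta>" and st: "s < t"
  shows "(sector_density s t \<longlongrightarrow> t - s) (arc_filter \<theta>)"
proof (rule tendstoI)
  fix e :: real assume e: "e > 0"
  have th: "0 < \<theta>" "\<theta> < 2 * pi" using irrational_dir by (auto simp: irrational_dir_def)
  define d where "d = t - s"
  have d: "d > 0" using st by (simp add: d_def)
  define \<eta> where "\<eta> = min (e / 8) (d / 4)"
  have \<eta>: "\<eta> > 0" "\<eta> \<le> e / 8" "\<eta> \<le> d / 4" using e d by (auto simp: \<eta>_def)
  \<comment> \<open>The shift lemma loses \<eta> at either edge. So translates of
    \<open>[s, t)\<close> fit into tiles of width \<open>p\<close>, and tiles of width
    \<open>q\<close> fit, once translated, into \<open>[s, t)\<close>.\<close>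
  define p q where "p = d + 2 * \<eta>" and "q = d - 2 * \<eta>"
  have pq: "p \<ge> 0" "q \<ge> 0" using d \<eta> by (auto simp: p_def q_def)
  let ?D = "\<lambda>u i. sector_density (s + real i * u) (s + real i * u + u)"
  obtain m :: nat where m: "m > 0" "3 / real m < e / 4"
  proof -
    obtain m :: nat where "real m > 12 / e" using reals_Archimedean2 by blast
    then show ?thesis using e that[of m] by (cases "m = 0") (auto simp: field_simps)
  qed
  have ev1: "\<forall>\<^sub>F x in arc_filter \<theta>. \<forall>i\<in>{..<m}. sector_density s t x \<le> ?D p i x + \<eta>"
  proof (intro eventually_ball_finite ballI)
    fix i
    from sector_density_shift[OF irrational_dir less_imp_le[OF st] \<eta>(1), of "real i * p + \<eta>"]
    show "\<forall>\<^sub>F x in arc_filter \<theta>. sector_density s t x \<le> ?D p i x + \<eta>"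
      by (simp add: p_def d_def algebra_simps)
  qed simp
  have ev2: "\<forall>\<^sub>F x in arc_filter \<theta>. \<forall>i\<in>{..<m}. ?D q i x \<le> sector_density s t x + \<eta>"
  proof (intro eventually_ball_finite ballI)
    fix i
    from sector_density_shift[OF irrational_dir _ \<eta>(1), of "s + real i * q" "s + real i * q + q" "\<eta> - real i * q"]
    show "\<forall>\<^sub>F x in arc_filter \<theta>. ?D q i x \<le> sector_density s t x + \<eta>"
      using pq(2) by (simp add: q_def d_def algebra_simps)
  qed simp
  have nn: "0 \<le> real m * p" "0 \<le> real m * q" using pq by auto
  have ev3: "\<forall>\<^sub>F x in arc_filter \<theta>. sector_density s (s + real m * p) x \<le> real m * p + 3"
    using sector_density_crude(1)[OF th, of s "s + real m * p"] nn by simp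
  have ev4: "\<forall>\<^sub>F x in arc_filter \<theta>. sector_density s (s + real m * q) x \<ge> real m * q - 3"
    using sector_density_crude(2)[OF th, of s "s + real m * q"] nn by simp
  show "\<forall>\<^sub>F x in arc_filter \<theta>. dist (sector_density s t x) (t - s) < e"
    using ev1 ev2 ev3 ev4
  proof eventually_elim
    case (elim x)
    have "real m * sector_density s t x = (\<Sum>i<m. sector_density s t x)" by simp
    also have "\<dots> \<le> (\<Sum>i<m. ?D p i x + \<eta>)"
      using elim(1) by (intro sum_mono) auto
    also have "\<dots> = sector_density s (s + real m * p) x + real m * \<eta>"
      using pq(1) by (simp add: sector_density_sum sum.distrib)
    also have "\<dots> \<le> real m * p + 3 + real m * \<eta>" using elim(3) by simp
    finally have "real m * sector_density s t x \<le> real m * (d + 3 * \<eta> + 3 / m)" using m by (simp add: p_def algebra_simps)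
    then have up: "sector_density s t x \<le> d + 3 * \<eta> + 3 / m" using m(1) by simp
    have "real m * q - 3 \<le> (\<Sum>i<m. ?D q i x)"
      using elim(4) pq(2) by (simp add: sector_density_sum)
    also have "\<dots> \<le> (\<Sum>i<m. sector_density s t x + \<eta>)"
      using elim(2) by (intro sum_mono) auto
    finally have "real m * (d - 3 * \<eta> - 3 / m) \<le> real m * sector_density s t x" using m by (simp add: q_def algebra_simps)
    then have lo: "d - 3 * \<eta> - 3 / m \<le> sector_density s t x" using m(1) by simp
    show ?case using up lo \<eta> m e by (simp add: dist_real_def d_def abs_less_iff)
  qed
qed

subsection \<open>Area of a square cut by a large disc\<close>

text \<open>A unit square whose centre is farther than this from the circle does not meet
  it.\<close>

definition half_width :: real where "half_width = 1 / sqrt 2"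

lemma half_width_bounds: "0 < half_width" "half_width < 1" by (auto simp: half_width_def)

lemma Gamma_R_int_lattice: "Gamma_R R = {z \<in> int_lattice. R - half_width < norm z \<and> norm z < R + half_width}"
  by (auto simp: Gamma_R_def int_lattice_def half_width_def)

lemma finite_Gamma_R: "finite (Gamma_R R)"
  by (rule finite_subset[OF _ finite_int_lattice_ball[of "R + half_width"]]) (auto simp: Gamma_R_int_lattice)

lemma unit_square_eq: "unit_square = cbox (- half_diag) half_diag"
  by (auto simp: unit_square_def in_cbox_complex_iff)

lemma measure_unit_square: "measure lborel unit_square = 1"
  unfolding unit_square_eq using measure_square_cbox[of 0] by simp

lemma unit_square_fmeasurable: "unit_square \<in> fmeasurable lborel"
  unfolding unit_square_eq by simp

lemma borel_unit_square [measurable]: "unit_square \<in> sets borel"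
  unfolding unit_square_eq by simp

lemma measurable_radial [measurable]: "radial \<theta> \<in> borel_measurable borel"
  unfolding radial_def by measurable

lemma area_R_eq: "area_R R z = measure lborel {q \<in> unit_square. norm (z + q) < R}"
proof -
  have "((+) z ` unit_square) \<inter> ball 0 R = (+) z ` {q \<in> unit_square. norm (z + q) < R}" by auto
  moreover have "{q \<in> unit_square. norm (z + q) < R} \<in> sets borel" by measurable
  moreover have "((+) z ` unit_square) \<inter> ball 0 R \<in> sets borel"
    unfolding unit_square_eq cbox_translation[symmetric] by simp
  ultimately show ?thesis
    unfolding area_R_def using measure_translation[of z "{q \<in> unit_square. norm (z + q) < R}"]
    by (simp add: measure_completion)
qed

lemma area_R_bounds: "0 \<le> area_R R z" "area_R R z \<le> 1"
proof -
  have "area_R R z \<le> measure lborel unit_square"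
    unfolding area_R_eq by (rule measure_mono_fmeasurable) (use unit_square_fmeasurable in auto)
  then show "area_R R z \<le> 1" by (simp add: measure_unit_square)
qed (simp add: area_R_def)

text \<open>Flat limit of \<open>area_R\<close>: the disc becomes a half plane, with the centre of
  the square at signed distance \<open>t\<close> outside its edge.\<close>

definition half_area :: "real \<Rightarrow> real \<Rightarrow> real" where
  "half_area \<theta> t = measure lborel {q \<in> unit_square. t + radial \<theta> q < 0}"

lemma AE_radial_neq: "AE q in lborel. t + radial \<theta> q \<noteq> 0"
proof -
  have eq: "{q. t + radial \<theta> q = 0} = {q. cis \<theta> \<bullet> q = - t}"
    by (auto simp: radial_def inner_complex_def algebra_simps)
  have "negligible {q. cis \<theta> \<bullet> q = - t}" by (rule negligible_hyperplane) simp
  then have "{q. t + radial \<theta> q = 0} \<in> null_sets lebesgue" unfolding eq by (simp add: negligible_iff_null_sets)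
  moreover have "{q. t + radial \<theta> q = 0} \<in> sets borel" by measurable
  ultimately have "{q. t + radial \<theta> q = 0} \<in> null_sets lborel" by (simp add: null_sets_def)
  then show ?thesis by (rule AE_I') auto
qed

text \<open>The reflection \<open>q \<mapsto> -q\<close> preserves the square and exchanges the two
  sides of the line, which itself is a null set. This is where the mean value \<open>1/2\<close>
  comes from.\<close>

lemma half_area_add: "half_area \<theta> t + half_area \<theta> (- t) = 1"
proof -
  let ?A = "{q \<in> unit_square. t + radial \<theta> q < 0}" and ?B = "{q \<in> unit_square. - t + radial \<theta> q < 0}"
  let ?B' = "{q \<in> unit_square. t + radial \<theta> q > 0}"
  have Bb: "?B \<in> sets borel" by measurable
  have fin: "X \<in> fmeasurable lborel" if "X \<subseteq> unit_square" "X \<in> sets borel" for X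
    by (rule fmeasurableI2[OF unit_square_fmeasurable that(1)]) (use that in auto)
  have "?B' = (*) (-1) ` ?B"
  proof (intro set_eqI iffI)
    fix q assume q: "q \<in> ?B'"
    show "q \<in> (*) (-1) ` ?B"
      by (rule image_eqI[of _ _ "-q"]) (use q in \<open>auto simp: unit_square_def radial_def\<close>)
  qed (auto simp: unit_square_def radial_def)
  then have B: "measure lborel ?B' = half_area \<theta> (- t)"
    unfolding half_area_def using fin[of ?B] Bb
    by (simp only:, intro measure_rotate) (auto simp: fmeasurable_def)
  have "half_area \<theta> t + half_area \<theta> (- t) = measure lborel (?A \<union> ?B')"
    unfolding half_area_def B[symmetric, unfolded half_area_def]
    by (rule measure_Union[symmetric])
       (use fin[of ?A] fin[of ?B'] in \<open>auto simp: fmeasurable_def\<close>)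
  also have "\<dots> = measure lborel unit_square"
  proof (rule measure_eq_AE)
    show "AE x in lborel. (x \<in> ?A \<union> ?B') = (x \<in> unit_square)"
      using AE_radial_neq[of t \<theta>] by eventually_elim auto
  qed measurable
  finally show ?thesis by (simp add: measure_unit_square)
qed

text \<open>\<open>g\<close> is the limit of \<open>G R z\<close> as \<open>R\<close> grows, the
  argument tends to \<theta> and \<open>norm z - R\<close> tends to \<open>t\<close>. The limit is
  joint, hence uniform over the points of a thin sector.\<close>

definition near :: "(real \<Rightarrow> complex \<Rightarrow> real) \<Rightarrow> real \<Rightarrow> real \<Rightarrow> real \<Rightarrow> bool" where
  "near G \<theta> t g \<longleftrightarrow> (\<forall>e>0. \<exists>d>0. \<exists>N. \<forall>R z. R > N \<and> z \<in> Gamma_R R \<and> \<bar>Arg2pi z - \<theta>\<bar> < d \<and> \<bar>norm z - R - t\<bar> < d \<longrightarrow> \<bar>G R z - g\<bar> \<le> e)"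

text \<open>Along a sequence of counterexamples, \<open>norm (z + q) - R\<close> converges to
  \<open>t + radial \<theta> q\<close> for each \<open>q\<close>. So the indicators converge off a
  line, and dominated convergence contradicts the choice of the sequence.\<close>

lemma area_R_near: "near area_R \<theta> t (half_area \<theta> t)"
  unfolding near_def
proof (intro allI impI, rule ccontr)
  fix e :: real assume e: "e > 0"
  assume neg: "\<not> (\<exists>d>0. \<exists>N. \<forall>R z. R > N \<and> z \<in> Gamma_R R \<and> \<bar>Arg2pi z - \<theta>\<bar> < d \<and> \<bar>norm z - R - t\<bar> < d \<longrightarrow> \<bar>area_R R z - half_area \<theta> t\<bar> \<le> e)"
  have "\<exists>R z. R > real n \<and> \<bar>Arg2pi z - \<theta>\<bar> < 1 / real (Suc n) \<and> \<bar>norm z - R - t\<bar> < 1 / real (Suc n) \<and> \<bar>area_R R z - half_area \<theta> t\<bar> > e" for n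
    using neg by (metis not_le of_nat_0_less_iff zero_less_Suc zero_less_divide_1_iff)
  then obtain R z where Rz: "\<And>n. R n > real n" "\<And>n. \<bar>Arg2pi (z n) - \<theta>\<bar> < 1 / real (Suc n)"
     "\<And>n. \<bar>norm (z n) - R n - t\<bar> < 1 / real (Suc n)" "\<And>n. \<bar>area_R (R n) (z n) - half_area \<theta> t\<bar> > e"
    by metis
  have inv0: "(\<lambda>n. 1 / real (Suc n)) \<longlonglongrightarrow> 0" using LIMSEQ_inverse_real_of_nat by (simp add: inverse_eq_divide)
  have la: "(\<lambda>n. \<bar>Arg2pi (z n) - \<theta>\<bar>) \<longlonglongrightarrow> 0"
    by (rule tendsto_sandwich[OF _ _ tendsto_const inv0]) (use Rz(2) in \<open>auto intro!: always_eventually less_imp_le\<close>)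
  have lt: "(\<lambda>n. norm (z n) - R n - t) \<longlonglongrightarrow> 0"
    by (rule tendsto_rabs_zero_cancel, rule tendsto_sandwich[OF _ _ tendsto_const inv0])
       (use Rz(3) in \<open>auto intro!: always_eventually less_imp_le\<close>)
  have lR: "filterlim R at_top sequentially"
    by (rule filterlim_at_top_mono[OF filterlim_real_sequentially]) (use Rz(1) in \<open>auto intro!: always_eventually less_imp_le\<close>)
  have ln: "filterlim (\<lambda>n. norm (z n)) at_top sequentially"
  proof -
    have "filterlim (\<lambda>n. (norm (z n) - R n - t + t) + R n) at_top sequentially"
      by (rule filterlim_tendsto_add_at_top[OF tendsto_add[OF lt tendsto_const] lR])
    then show ?thesis by simp
  qed
  have lim: "(\<lambda>n. norm (z n + q) - R n) \<longlonglongrightarrow> t + radial \<theta> q" for q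
  proof -
    have b0: "(\<lambda>n. (norm q)\<^sup>2 / norm (z n) + norm q * \<bar>Arg2pi (z n) - \<theta>\<bar>) \<longlonglongrightarrow> 0 + norm q * 0"
      by (intro tendsto_add tendsto_mult tendsto_const la real_tendsto_divide_at_top[OF tendsto_const ln])
    have ev: "\<forall>\<^sub>F n in sequentially. \<bar>norm (z n + q) - norm (z n) - radial \<theta> q\<bar> \<le> (norm q)\<^sup>2 / norm (z n) + norm q * \<bar>Arg2pi (z n) - \<theta>\<bar>"
      using filterlim_at_top_dense[THEN iffD1, OF ln, rule_format, of "2 * norm q"]
    proof eventually_elim
      case (elim n)
      show ?case by (rule norm_shift) (use elim norm_ge_zero[of q] in \<open>auto\<close>)
    qed
    have "(\<lambda>n. norm (z n + q) - norm (z n) - radial \<theta> q) \<longlonglongrightarrow> 0"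
      by (rule tendsto_rabs_zero_cancel, rule tendsto_sandwich[OF _ ev tendsto_const]) (use b0 in auto)
    from tendsto_add[OF this tendsto_add[OF lt tendsto_const[of "t + radial \<theta> q"]]]
    show ?thesis by (simp add: algebra_simps)
  qed
  have "(\<lambda>n. \<integral>q. indicator {q \<in> unit_square. norm (z n + q) < R n} q \<partial>lborel) \<longlonglongrightarrow> (\<integral>q. indicator {q \<in> unit_square. t + radial \<theta> q < 0} q \<partial>lborel :: real)"
  proof (rule integral_dominated_convergence[where w = "indicator unit_square"])
    show "integrable lborel (indicator unit_square :: complex \<Rightarrow> real)"
      using unit_square_fmeasurable by (auto simp: fmeasurable_def integrable_indicator_iff)
    show "AE q in lborel. (\<lambda>n. indicator {q \<in> unit_square. norm (z n + q) < R n} q :: real) \<longlonglongrightarrow> indicator {q \<in> unit_square. t + radial \<theta> q < 0} q"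
      using AE_radial_neq[of t \<theta>]
    proof eventually_elim
      case (elim q)
      have "\<forall>\<^sub>F n in sequentially. norm (z n + q) < R n \<longleftrightarrow> t + radial \<theta> q < 0"
      proof (cases "t + radial \<theta> q < 0")
        case True
        show ?thesis using order_tendstoD(2)[OF lim True] by eventually_elim (use True in auto)
      next
        case False
        then have pos: "t + radial \<theta> q > 0" using elim by simp
        show ?thesis using order_tendstoD(1)[OF lim pos] by eventually_elim (use False in auto)
      qed
      then have "\<forall>\<^sub>F n in sequentially. (indicator {q \<in> unit_square. norm (z n + q) < R n} q :: real) = indicator {q \<in> unit_square. t + radial \<theta> q < 0} q"
        by eventually_elim (auto simp: indicator_def)
      then show ?case by (rule tendsto_eventually)
    qed
  qed (measurable, auto intro!: AE_I2 simp: indicator_def)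
  then have "(\<lambda>n. area_R (R n) (z n)) \<longlonglongrightarrow> half_area \<theta> t"
    by (simp add: area_R_eq half_area_def)
  then have "\<forall>\<^sub>F n in sequentially. dist (area_R (R n) (z n)) (half_area \<theta> t) < e"
    by (rule tendstoD[OF _ e])
  then obtain n where "dist (area_R (R n) (z n)) (half_area \<theta> t) < e" by (auto simp: eventually_sequentially)
  then show False using Rz(4)[of n] by (simp add: dist_real_def)
qed

subsection \<open>Sums over thin arcs\<close>

definition approx_mult :: "'a filter \<Rightarrow> ('a \<Rightarrow> real) \<Rightarrow> ('a \<Rightarrow> real) \<Rightarrow> real \<Rightarrow> real \<Rightarrow> bool" where
  "approx_mult F l f m c \<longleftrightarrow> (\<forall>\<^sub>F x in F. l x > 0 \<and> \<bar>f x - m * l x\<bar> \<le> c * l x)"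

lemma approx_mult_add:
  assumes "approx_mult F l f m x" "approx_mult F l g n y"
  shows "approx_mult F l (\<lambda>z. f z + g z) (m + n) (x + y)"
  using assms unfolding approx_mult_def
proof eventually_elim
  case (elim z)
  then show ?case unfolding distrib_right by linarith
qed

lemma approx_mult_mono:
  assumes "approx_mult F l f m x" "x \<le> y"
  shows "approx_mult F l f m y"
  using assms(1) unfolding approx_mult_def
proof eventually_elim
  case (elim z)
  then have "x * l z \<le> y * l z" using assms(2) by (intro mult_right_mono) auto
  then show ?case using elim by linarith
qed

lemma approx_mult_ratio:
  "approx_mult F l f m c \<longleftrightarrow> (\<forall>\<^sub>F x in F. l x > 0 \<and> \<bar>f x / l x - m\<bar> \<le> c)"
proof -
  have "\<bar>f x - m * l x\<bar> \<le> c * l x \<longleftrightarrow> \<bar>f x / l x - m\<bar> \<le> c" if "l x > 0" for x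
  proof -
    have "f x / l x - m = (f x - m * l x) / l x" using that by (simp add: diff_divide_distrib)
    then have "\<bar>f x / l x - m\<bar> = \<bar>f x - m * l x\<bar> / l x" using that by simp
    then show ?thesis using that by (simp add: divide_le_eq)
  qed
  then show ?thesis unfolding approx_mult_def by (intro arg_cong2[where f = eventually]) auto
qed

abbreviation "arc_approx \<theta> \<equiv> approx_mult (arc_filter \<theta>) arc_len"

text \<open>Sectors are half open so that they tile, whereas \<open>Gamma_R\<close> omits its inner
  circle; the intersection reconciles the two.\<close>

definition sector_sum :: "(real \<Rightarrow> complex \<Rightarrow> real) \<Rightarrow> real \<Rightarrow> real \<Rightarrow> real \<times> real \<times> real \<Rightarrow> real" where
  "sector_sum G s t = (\<lambda>(R,a,b). \<Sum>z\<in>lattice_sector R a b s t \<inter> Gamma_R R. G R z)"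

lemma eventually_arc_len_gt:
  assumes "irrational_dir \<theta>" shows "\<forall>\<^sub>F x in arc_filter \<theta>. arc_len x > 0"
  using arc_filter_basic[of \<theta> 0 0] assms by (auto simp: irrational_dir_def arc_len_def case_prod_unfold elim: eventually_mono)

lemma card_lattice_sector_approx_mult:
  assumes irrational_dir: "irrational_dir \<theta>" and st: "s < t" and e: "e > 0"
  shows "arc_approx \<theta> (\<lambda>(R,a,b). real (card (lattice_sector R a b s t))) (t - s) e"
  unfolding approx_mult_ratio using eventually_arc_len_gt[OF irrational_dir] tendstoD[OF sector_density_tendsto[OF irrational_dir st] e]
  by eventually_elim (auto simp: sector_density_arc_len dist_real_def)

lemma sector_sum_split:
  assumes "s \<le> m" "m \<le> t"
  shows "sector_sum G s t = (\<lambda>x. sector_sum G s m x + sector_sum G m t x)"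
proof
  fix x :: "real \<times> real \<times> real"
  obtain R a b where x: "x = (R, a, b)" by (cases x)
  show "sector_sum G s t x = sector_sum G s m x + sector_sum G m t x"
    unfolding x sector_sum_def lattice_sector_split(1)[OF assms] Int_Un_distrib2 split
    by (rule sum.union_disjoint) (use lattice_sector_split(2)[OF assms] finite_lattice_sector in auto)
qed

text \<open>The trivial bound required by the principle: the density \<open>t - s\<close>, doubled
  to leave room for the error in the count.\<close>

lemma sector_sum_bound:
  assumes irrational_dir: "irrational_dir \<theta>" and st: "s < t" and G: "\<And>R z. \<bar>G R z\<bar> \<le> 1"
  shows "arc_approx \<theta> (sector_sum G s t) 0 (2 * (t - s))"
proof -
  have ts: "t - s > 0" using st by simp
  show ?thesis using card_lattice_sector_approx_mult[OF irrational_dir st ts] unfolding approx_mult_def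
  proof eventually_elim
    case (elim x)
    obtain R a b where x: "x = (R, a, b)" by (cases x)
    have "\<bar>sector_sum G s t x\<bar> \<le> (\<Sum>z\<in>lattice_sector R a b s t \<inter> Gamma_R R. 1)"
      unfolding sector_sum_def x split by (rule order_trans[OF sum_abs]) (intro sum_mono G)
    also have "\<dots> \<le> real (card (lattice_sector R a b s t))" by (simp add: card_mono finite_lattice_sector)
    finally have "\<bar>sector_sum G s t x\<bar> \<le> real (card (lattice_sector R a b s t))" .
    moreover have "2 * (t - s) * arc_len x = (t - s) * arc_len x + (t - s) * arc_len x" by (simp add: algebra_simps)
    ultimately show ?case using elim unfolding x split by linarith
  qed
qed

text \<open>Near \<open>t0\<close> the summands are almost \<open>g\<close> and the number of points
  is about \<open>t - s\<close> times the arc length. The error is proportional to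
  \<open>t - s\<close>, as the principle demands.\<close>

lemma sector_sum_local:
  assumes irrational_dir: "irrational_dir \<theta>" and near: "near G \<theta> t0 g" and t0: "- half_width < t0" "t0 < half_width" and e: "e > 0"
  obtains d where "d > 0" "\<And>s t. \<lbrakk>t0 - d < s; s < t; t < t0 + d\<rbrakk> \<Longrightarrow>
     arc_approx \<theta> (sector_sum G s t) (g * (t - s)) (e * (t - s))"
proof -
  \<comment> \<open>The count is at most twice its expected value, so the variation of
    \<open>G\<close> costs \<open>2 * \<kappa>\<close>; the error in the count costs
    \<open>\<bar>g\<bar> * \<kappa>\<close>.\<close>
  define \<kappa> where "\<kappa> = min 1 (e / (2 + \<bar>g\<bar>))"
  have \<kappa>: "\<kappa> > 0" "\<kappa> \<le> 1" "\<kappa> * (2 + \<bar>g\<bar>) \<le> e"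
  proof -
    have "\<kappa> * (2 + \<bar>g\<bar>) \<le> e / (2 + \<bar>g\<bar>) * (2 + \<bar>g\<bar>)" by (intro mult_right_mono) (auto simp: \<kappa>_def)
    then show "\<kappa> * (2 + \<bar>g\<bar>) \<le> e" by simp
  qed (use e in \<open>auto simp: \<kappa>_def\<close>)
  obtain d0 N where d0: "d0 > 0" "\<And>R z. \<lbrakk>R > N; z \<in> Gamma_R R; \<bar>Arg2pi z - \<theta>\<bar> < d0; \<bar>norm z - R - t0\<bar> < d0\<rbrakk> \<Longrightarrow> \<bar>G R z - g\<bar> \<le> \<kappa>"
    using near \<kappa>(1) unfolding near_def by metis
  define d where "d = min d0 (min (t0 + half_width) (half_width - t0))"
  have d: "d > 0" "d \<le> d0" "d \<le> t0 + half_width" "d \<le> half_width - t0" unfolding d_def using d0(1) t0 by linarith+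
  have th: "0 < \<theta>" "\<theta> < 2 * pi" using irrational_dir by (auto simp: irrational_dir_def)
  have "arc_approx \<theta> (sector_sum G s t) (g * (t - s)) (e * (t - s))"
    if st: "t0 - d < s" "s < t" "t < t0 + d" for s t
  proof -
    have ev1: "\<forall>\<^sub>F x in arc_filter \<theta>. (case x of (R,a,b) \<Rightarrow> a) > \<theta> - d0" "\<forall>\<^sub>F x in arc_filter \<theta>. (case x of (R,a,b) \<Rightarrow> b) < \<theta> + d0"
      using order_tendstoD(1)[OF arc_filter_a, of "\<theta> - d0" \<theta>] order_tendstoD(2)[OF arc_filter_b, of \<theta> "\<theta> + d0"] d0 by auto
    have ev2: "arc_approx \<theta> (\<lambda>(R,a,b). real (card (lattice_sector R a b s t))) (t - s) (\<kappa> * (t - s))"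
      by (rule card_lattice_sector_approx_mult[OF irrational_dir]) (use st \<kappa> in auto)
    show ?thesis using ev1 ev2 arc_filter_basic[OF th, of N 0] unfolding approx_mult_def
    proof eventually_elim
      case (elim x)
      obtain R a b where x: "x = (R, a, b)" by (cases x)
      have R: "R > N" "\<theta> - d0 < a" "b < \<theta> + d0" "arc_len x > 0" using elim x by auto
      let ?L = "lattice_sector R a b s t"
      define n y where "n = real (card ?L)" and "y = (t - s) * arc_len x"
      have y: "y > 0" using st R by (simp add: y_def)
      have sub: "?L \<subseteq> Gamma_R R" using st d by (auto simp: lattice_sector_def Gamma_R_int_lattice)
      then have w: "sector_sum G s t x = (\<Sum>z\<in>?L. G R z)" by (simp add: sector_sum_def x Int_absorb2)
      have near': "\<bar>G R z - g\<bar> \<le> \<kappa>" if "z \<in> ?L" for z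
        by (rule d0(2)) (use that sub R st d in \<open>auto simp: lattice_sector_def\<close>)
      have "\<bar>sector_sum G s t x - g * n\<bar> = \<bar>\<Sum>z\<in>?L. (G R z - g)\<bar>" by (simp add: w n_def sum_subtractf mult.commute)
      also have "\<dots> \<le> (\<Sum>z\<in>?L. \<kappa>)" by (rule order_trans[OF sum_abs]) (intro sum_mono near')
      also have "\<dots> = \<kappa> * n" by (simp add: n_def)
      finally have 1: "\<bar>sector_sum G s t x - g * n\<bar> \<le> \<kappa> * n" .
      have 2: "\<bar>n - y\<bar> \<le> \<kappa> * y" using elim(3) by (simp add: x n_def y_def mult.assoc)
      moreover have "\<kappa> * y \<le> 1 * y" by (intro mult_right_mono) (use \<kappa> y in auto)
      ultimately have n2: "n \<le> 2 * y" by linarith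
      have "\<bar>sector_sum G s t x - g * y\<bar> \<le> \<bar>sector_sum G s t x - g * n\<bar> + \<bar>g * (n - y)\<bar>" by (simp add: right_diff_distrib)
      also have "\<bar>g * (n - y)\<bar> \<le> \<bar>g\<bar> * (\<kappa> * y)" unfolding abs_mult using 2 by (intro mult_left_mono) auto
      also have "\<bar>sector_sum G s t x - g * n\<bar> \<le> \<kappa> * (2 * y)" using 1 mult_left_mono[OF n2, of \<kappa>] \<kappa> by linarith
      also have "\<kappa> * (2 * y) + \<bar>g\<bar> * (\<kappa> * y) = (\<kappa> * (2 + \<bar>g\<bar>)) * y" by (simp add: algebra_simps)
      also have "\<dots> \<le> e * y" using \<kappa>(3) y by (intro mult_right_mono) auto
      finally show ?case using R by (simp add: y_def mult.assoc)
    qed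
  qed
  then show ?thesis using that d by blast
qed

text \<open>The principle in the radial coordinate, with the mean left existential because only its
  approximate existence is wanted. The edges of the strip join the exceptional set, as nothing is
  assumed there.\<close>

lemma sector_sum_average:
  assumes irrational_dir: "irrational_dir \<theta>" and G: "\<And>R z. \<bar>G R z\<bar> \<le> 1" and T: "countable T" and e: "e > 0"
    and near: "\<And>t. \<lbrakk>- half_width < t; t < half_width; t \<notin> T\<rbrakk> \<Longrightarrow> \<exists>g. near G \<theta> t g"
  shows "\<exists>m. arc_approx \<theta> (sector_sum G (- half_width) half_width) m e"
proof (rule null_defect_principle[where S = "T \<union> {-half_width, half_width}" and C = 2 and P = "\<lambda>s t c. \<exists>m. arc_approx \<theta> (sector_sum G s t) m c"])
  fix a b c x y assume ab: "a < b" "b < c" and P: "\<exists>m. arc_approx \<theta> (sector_sum G a b) m x" "\<exists>m. arc_approx \<theta> (sector_sum G b c) m y"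
  show "\<exists>m. arc_approx \<theta> (sector_sum G a c) m (x + y)"
    using P approx_mult_add unfolding sector_sum_split[OF less_imp_le[OF ab(1)] less_imp_le[OF ab(2)]] by blast
next
  fix a b :: real assume "a < b"
  from sector_sum_bound[of \<theta> a b G, OF irrational_dir this G] show "\<exists>m. arc_approx \<theta> (sector_sum G a b) m (2 * (b - a))" by blast
next
  fix t e assume t: "- half_width \<le> t" "t \<le> half_width" "t \<notin> T \<union> {-half_width, half_width}" "(e::real) > 0"
  then have t': "- half_width < t" "t < half_width" by auto
  obtain g where g: "near G \<theta> t g" using near t t' by blast
  obtain d where d: "d > 0" "\<And>a b. \<lbrakk>t - d < a; a < b; b < t + d\<rbrakk> \<Longrightarrow> arc_approx \<theta> (sector_sum G a b) (g * (b - a)) (e * (b - a))"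
    by (rule sector_sum_local[OF irrational_dir g t' t(4)]) (rule that)
  have "\<exists>m. arc_approx \<theta> (sector_sum G a b) m (e * (b - a))" if "a < b" "a \<le> t" "t \<le> b" "b - a < d" for a b
    using d(2)[of a b] that by auto
  then show "\<exists>d>0. \<forall>a b. a < b \<and> a \<le> t \<and> t \<le> b \<and> b - a < d \<longrightarrow> (\<exists>m. arc_approx \<theta> (sector_sum G a b) m (e * (b - a)))"
    using d(1) by blast
qed (use half_width_bounds T e in \<open>auto intro: approx_mult_mono\<close>)

text \<open>The strip is folded along the boundary line: sectors at \<open>t\<close> and
  \<open>-t\<close> are summed together, and by \<open>half_area_add\<close> their limits add up to
  1. No integral of \<open>half_area\<close> is needed.\<close>

lemma sector_sum_area:
  assumes irrational_dir: "irrational_dir \<theta>" and e: "e > 0"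
  shows "arc_approx \<theta> (sector_sum area_R (- half_width) half_width) half_width e"
proof -
  define A where "A s t = (\<lambda>x. sector_sum area_R s t x + sector_sum area_R (-t) (-s) x)" for s t
  have G: "\<bar>area_R R z\<bar> \<le> 1" for R z using area_R_bounds[of R z] by simp
  have "arc_approx \<theta> (A 0 half_width) (half_width - 0) e"
  proof (rule null_defect_principle[where S = "{0, half_width}" and C = 5 and P = "\<lambda>s t c. arc_approx \<theta> (A s t) (t - s) c"])
    fix a b c x y assume ab: "a < b" "b < c" and P: "arc_approx \<theta> (A a b) (b - a) x" "arc_approx \<theta> (A b c) (c - b) y"
    have "A a c = (\<lambda>x. A a b x + A b c x)"
      using ab sector_sum_split[of a b c area_R] sector_sum_split[of "-c" "-b" "-a" area_R] by (auto simp: A_def)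
    then show "arc_approx \<theta> (A a c) (c - a) (x + y)" using approx_mult_add[OF P] by simp
  next
    fix a b :: real assume ab: "a < b"
    then have "-b < -a" by simp
    from approx_mult_add[OF sector_sum_bound[of _ _ _ area_R, OF irrational_dir ab G] sector_sum_bound[of _ _ _ area_R, OF irrational_dir this G]]
    have "arc_approx \<theta> (A a b) 0 (4 * (b - a))" by (simp add: A_def algebra_simps)
    \<comment> \<open>Two sectors contribute 4; moving the centre from 0 to \<open>b - a\<close>
      costs one more.\<close>
    then show "arc_approx \<theta> (A a b) (b - a) (5 * (b - a))" unfolding approx_mult_def
    proof eventually_elim
      case (elim z)
      define y where "y = (b - a) * arc_len z"
      have "y \<ge> 0" "4 * (b - a) * arc_len z = 4 * y" "5 * (b - a) * arc_len z = 5 * y" using elim ab by (auto simp: y_def)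
      then show ?case using elim unfolding y_def[symmetric] by (simp add: y_def[symmetric] abs_le_iff)
    qed
  next
    fix t e assume t: "0 \<le> t" "t \<le> half_width" "t \<notin> {0, half_width}" "(e::real) > 0"
    have t': "- half_width < t" "t < half_width" "- half_width < -t" "-t < half_width" using t half_width_bounds by auto
    have e2: "e / 2 > 0" using t by simp
    obtain d where d: "d > 0" "\<And>a b. \<lbrakk>t - d < a; a < b; b < t + d\<rbrakk> \<Longrightarrow>
        arc_approx \<theta> (sector_sum area_R a b) (half_area \<theta> t * (b - a)) (e / 2 * (b - a))"
      by (rule sector_sum_local[OF irrational_dir area_R_near t'(1,2) e2]) (rule that)
    obtain d' where d': "d' > 0" "\<And>a b. \<lbrakk>-t - d' < a; a < b; b < -t + d'\<rbrakk> \<Longrightarrow>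
        arc_approx \<theta> (sector_sum area_R a b) (half_area \<theta> (-t) * (b - a)) (e / 2 * (b - a))"
      by (rule sector_sum_local[OF irrational_dir area_R_near t'(3,4) e2]) (rule that)
    have "arc_approx \<theta> (A a b) (b - a) (e * (b - a))" if ab: "a < b" "a \<le> t" "t \<le> b" "b - a < min d d'" for a b
    proof -
      have "half_area \<theta> t * (b - a) + half_area \<theta> (-t) * (-a - -b) = (half_area \<theta> t + half_area \<theta> (-t)) * (b - a)"
        by (simp add: algebra_simps)
      then show ?thesis using approx_mult_add[OF d(2)[of a b] d'(2)[of "-b" "-a"]] ab
        by (simp add: A_def half_area_add)
    qed
    then show "\<exists>d>0. \<forall>a b. a < b \<and> a \<le> t \<and> t \<le> b \<and> b - a < d \<longrightarrow> arc_approx \<theta> (A a b) (b - a) (e * (b - a))"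
      using d(1) d'(1) by (intro exI[of _ "min d d'"]) auto
  qed (use half_width_bounds e in \<open>auto intro: approx_mult_mono\<close>)
  moreover have "sector_sum area_R (- half_width) half_width = A 0 half_width"
    using sector_sum_split[of "-half_width" 0 half_width area_R] half_width_bounds by (auto simp: A_def)
  ultimately show ?thesis by simp
qed

text \<open>The count is squeezed between that of the whole sector and that of a slightly narrower
  one lying inside the open annulus.\<close>

lemma sector_sum_count:
  assumes irrational_dir: "irrational_dir \<theta>" and e: "e > 0"
  shows "arc_approx \<theta> (sector_sum (\<lambda>R z. 1) (- half_width) half_width) (2 * half_width) e"
proof -
  define \<kappa> where "\<kappa> = min (e / 4) (half_width / 2)"
  have \<kappa>: "\<kappa> > 0" "\<kappa> \<le> e / 4" "\<kappa> \<le> half_width / 2" using e half_width_bounds by (auto simp: \<kappa>_def)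
  have e4: "e / 4 > 0" using e by simp
  have lt: "- half_width < half_width" "- half_width + \<kappa> < half_width" using \<kappa> half_width_bounds by auto
  show ?thesis unfolding approx_mult_ratio
    using eventually_arc_len_gt[OF irrational_dir] tendstoD[OF sector_density_tendsto[OF irrational_dir lt(1)] e4] tendstoD[OF sector_density_tendsto[OF irrational_dir lt(2)] e4]
  proof eventually_elim
    case (elim x)
    obtain R a b where x: "x = (R, a, b)" by (cases x)
    let ?w = "sector_sum (\<lambda>R z. 1) (- half_width) half_width x" and ?G = "lattice_sector R a b (-half_width) half_width \<inter> Gamma_R R"
    have "card ?G \<le> card (lattice_sector R a b (-half_width) half_width)"
      by (rule card_mono) (auto simp: finite_lattice_sector)
    moreover have "card (lattice_sector R a b (-half_width + \<kappa>) half_width) \<le> card ?G"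
      by (rule card_mono[OF finite_Int[OF disjI1[OF finite_lattice_sector]]]) (use \<kappa> in \<open>auto simp: lattice_sector_def Gamma_R_int_lattice\<close>)
    moreover have "?w = real (card ?G)" by (simp add: sector_sum_def x)
    ultimately have "?w / arc_len x \<le> sector_density (- half_width) half_width x" "sector_density (- half_width + \<kappa>) half_width x \<le> ?w / arc_len x"
      using elim(1) unfolding x sector_density_arc_len by (auto intro!: divide_right_mono)
    then show ?case using elim \<kappa> e unfolding dist_real_def by linarith
  qed
qed

subsection \<open>The strip of lattice points seen from a boundary point\<close>

text \<open>The mode of convergence in \<open>near\<close>, as a filter, so that statements about
  finitely many translates of \<open>z\<close> can be combined.\<close>

definition point_filter :: "real \<Rightarrow> real \<Rightarrow> (real \<times> complex) filter" where
  "point_filter \<theta> t = inf (filtercomap fst at_top) (inf (filtercomap (\<lambda>(R,z). Arg2pi z) (nhds \<theta>))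
     (filtercomap (\<lambda>(R,z). norm z - R) (nhds t)))"

lemma point_filter_R: "filterlim (\<lambda>(R,z). R) at_top (point_filter \<theta> t)"
  and point_filter_arg: "filterlim (\<lambda>(R,z). Arg2pi z) (nhds \<theta>) (point_filter \<theta> t)"
  and point_filter_norm: "filterlim (\<lambda>(R,z). norm z - R) (nhds t) (point_filter \<theta> t)"
proof -
  have "(\<lambda>(R,z). R) = (fst :: real \<times> complex \<Rightarrow> real)" by auto
  then show "filterlim (\<lambda>(R,z). R) at_top (point_filter \<theta> t)"
    "filterlim (\<lambda>(R,z). Arg2pi z) (nhds \<theta>) (point_filter \<theta> t)"
    "filterlim (\<lambda>(R,z). norm z - R) (nhds t) (point_filter \<theta> t)"
    unfolding filterlim_iff_le_filtercomap point_filter_def by (auto intro: inf.coboundedI1 inf.coboundedI2)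
qed

lemma eventually_point_filter_elim:
  assumes "eventually P (point_filter \<theta> t)"
  obtains d N where "d > 0" "\<And>R z. \<lbrakk>R > N; \<bar>Arg2pi z - \<theta>\<bar> < d; \<bar>norm z - R - t\<bar> < d\<rbrakk> \<Longrightarrow> P (R, z)"
proof -
  obtain P1 P2 P3 where P: "eventually P1 (filtercomap fst at_top)"
    "eventually P2 (filtercomap (\<lambda>(R,z). Arg2pi z) (nhds \<theta>))"
    "eventually P3 (filtercomap (\<lambda>(R,z). norm z - R) (nhds t))"
    "\<And>x. P1 x \<Longrightarrow> P2 x \<Longrightarrow> P3 x \<Longrightarrow> P x"
    using assms unfolding point_filter_def eventually_inf by metis
  obtain N1 where N1: "\<And>R z. R \<ge> N1 \<Longrightarrow> P1 (R, z)"
    using P(1) unfolding eventually_filtercomap_at_top_linorder by auto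
  obtain d2 where d2: "d2 > 0" "\<And>R z. \<bar>Arg2pi z - \<theta>\<bar> < d2 \<Longrightarrow> P2 (R, z)"
    using P(2) unfolding eventually_filtercomap eventually_nhds_metric by (force simp: dist_real_def)
  obtain d3 where d3: "d3 > 0" "\<And>R z. \<bar>norm z - R - t\<bar> < d3 \<Longrightarrow> P3 (R, z)"
    using P(3) unfolding eventually_filtercomap eventually_nhds_metric by (force simp: dist_real_def)
  show ?thesis
    by (rule that[of "min d2 d3" N1]) (use N1 d2 d3 P(4) in auto)
qed

lemma nearI:
  assumes "\<And>e. e > 0 \<Longrightarrow> \<forall>\<^sub>F (R,z) in point_filter \<theta> t. z \<in> Gamma_R R \<longrightarrow> \<bar>G R z - g\<bar> \<le> e"
  shows "near G \<theta> t g"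
  unfolding near_def
proof (intro allI impI)
  fix e :: real assume "e > 0"
  obtain d N where "d > 0" "\<And>R z. \<lbrakk>R > N; \<bar>Arg2pi z - \<theta>\<bar> < d; \<bar>norm z - R - t\<bar> < d\<rbrakk> \<Longrightarrow> (case (R,z) of (R,z) \<Rightarrow> z \<in> Gamma_R R \<longrightarrow> \<bar>G R z - g\<bar> \<le> e)"
    by (rule eventually_point_filter_elim[OF assms[OF \<open>e > 0\<close>]]) (rule that)
  then show "\<exists>d>0. \<exists>N. \<forall>R z. R > N \<and> z \<in> Gamma_R R \<and> \<bar>Arg2pi z - \<theta>\<bar> < d \<and> \<bar>norm z - R - t\<bar> < d \<longrightarrow> \<bar>G R z - g\<bar> \<le> e"
    by (intro exI[of _ d] conjI exI[of _ N]) auto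
qed

lemma nearD:
  assumes "near G \<theta> t g" "e > 0"
  shows "\<forall>\<^sub>F (R,z) in point_filter \<theta> t. z \<in> Gamma_R R \<longrightarrow> \<bar>G R z - g\<bar> \<le> e"
proof -
  obtain d N where d: "d > 0" "\<And>R z. \<lbrakk>R > N; z \<in> Gamma_R R; \<bar>Arg2pi z - \<theta>\<bar> < d; \<bar>norm z - R - t\<bar> < d\<rbrakk> \<Longrightarrow> \<bar>G R z - g\<bar> \<le> e"
    using assms unfolding near_def by metis
  have "\<forall>\<^sub>F x in point_filter \<theta> t. (case x of (R,z) \<Rightarrow> R) > N"
    by (rule eventually_compose_filterlim[OF eventually_gt_at_top point_filter_R])
  moreover have "\<forall>\<^sub>F x in point_filter \<theta> t. dist (case x of (R,z) \<Rightarrow> Arg2pi z) \<theta> < d"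
    by (rule tendstoD[OF point_filter_arg d(1)])
  moreover have "\<forall>\<^sub>F x in point_filter \<theta> t. dist (case x of (R,z) \<Rightarrow> norm z - R) t < d"
    by (rule tendstoD[OF point_filter_norm d(1)])
  ultimately show ?thesis
    by eventually_elim (use d(2) in \<open>auto simp: dist_real_def\<close>)
qed

lemma point_filter_norm_at_top: "filterlim (\<lambda>(R,z). norm z) at_top (point_filter \<theta> t)"
proof -
  have "filterlim (\<lambda>x. (case x of (R,z) \<Rightarrow> norm z - R) + (case x of (R,z) \<Rightarrow> R)) at_top (point_filter \<theta> t)"
    by (rule filterlim_tendsto_add_at_top[OF point_filter_norm point_filter_R])
  then show ?thesis by (simp add: case_prod_unfold)
qed

lemma point_filter_ev_norm: "\<forall>\<^sub>F (R,z) in point_filter \<theta> t. norm z > M"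
  using filterlim_at_top_dense[THEN iffD1, OF point_filter_norm_at_top, rule_format, of M \<theta> t]
  by (simp add: case_prod_unfold)

lemma point_filter_ratio: "((\<lambda>(R,z). c / norm z) \<longlongrightarrow> 0) (point_filter \<theta> t)"
  using real_tendsto_divide_at_top[OF tendsto_const point_filter_norm_at_top, of c \<theta> t]
  by (simp add: case_prod_unfold)

lemma point_filter_shift_cond:
  assumes th: "0 < \<theta>" "\<theta> < 2 * pi"
  shows "\<forall>\<^sub>F (R,z) in point_filter \<theta> t. z \<noteq> 0 \<and> norm w < norm z / 2 \<and> 2 * norm w / norm z \<le> Arg2pi z \<and> Arg2pi z + 2 * norm w / norm z < 2 * pi"
proof -
  have "((\<lambda>x. (case x of (R,z) \<Rightarrow> Arg2pi z) - (case x of (R,z) \<Rightarrow> 2 * norm w / norm z)) \<longlongrightarrow> \<theta> - 0) (point_filter \<theta> t)"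
    by (intro tendsto_diff point_filter_arg point_filter_ratio)
  from order_tendstoD(1)[OF this, of 0] th have 1: "\<forall>\<^sub>F x in point_filter \<theta> t. (case x of (R,z) \<Rightarrow> Arg2pi z) - (case x of (R,z) \<Rightarrow> 2 * norm w / norm z) > 0"
    by simp
  have "((\<lambda>x. (case x of (R,z) \<Rightarrow> Arg2pi z) + (case x of (R,z) \<Rightarrow> 2 * norm w / norm z)) \<longlongrightarrow> \<theta> + 0) (point_filter \<theta> t)"
    by (intro tendsto_add point_filter_arg point_filter_ratio)
  from order_tendstoD(2)[OF this, of "2 * pi"] th have 2: "\<forall>\<^sub>F x in point_filter \<theta> t. (case x of (R,z) \<Rightarrow> Arg2pi z) + (case x of (R,z) \<Rightarrow> 2 * norm w / norm z) < 2 * pi"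
    by simp
  show ?thesis using 1 2 point_filter_ev_norm[of "2 * norm w" \<theta> t]
    by eventually_elim (auto simp: case_prod_unfold)
qed

text \<open>A fixed translation changes the argument by a vanishing amount and the distance to the
  circle by \<open>radial \<theta> w\<close> in the limit. Facts about \<open>z\<close> thereby
  transfer to its neighbours.\<close>

lemma point_filter_translate:
  assumes th: "0 < \<theta>" "\<theta> < 2 * pi"
  shows "filterlim (\<lambda>(R,z). (R, z + w)) (point_filter \<theta> (t + radial \<theta> w)) (point_filter \<theta> t)"
proof -
  note ev = point_filter_shift_cond[OF th, of w t]
  have a: "((\<lambda>(R,z). Arg2pi (z + w) - Arg2pi z) \<longlongrightarrow> 0) (point_filter \<theta> t)"
  proof (rule tendsto_rabs_zero_cancel, rule tendsto_sandwich[OF _ _ tendsto_const point_filter_ratio[of "2 * norm w"]])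
    show "\<forall>\<^sub>F x in point_filter \<theta> t. \<bar>case x of (R,z) \<Rightarrow> Arg2pi (z + w) - Arg2pi z\<bar> \<le> (case x of (R,z) \<Rightarrow> 2 * norm w / norm z)"
      using ev by eventually_elim (auto intro: Arg2pi_shift(1))
  qed auto
  have n: "((\<lambda>(R,z). norm (z + w) - norm z - radial \<theta> w) \<longlongrightarrow> 0) (point_filter \<theta> t)"
  proof (rule tendsto_rabs_zero_cancel, rule tendsto_sandwich[OF _ _ tendsto_const])
    show "\<forall>\<^sub>F x in point_filter \<theta> t. \<bar>case x of (R,z) \<Rightarrow> norm (z + w) - norm z - radial \<theta> w\<bar> \<le>
       (case x of (R,z) \<Rightarrow> (norm w)\<^sup>2 / norm z) + norm w * \<bar>(case x of (R,z) \<Rightarrow> Arg2pi z) - \<theta>\<bar>"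
      using ev
    proof eventually_elim
      case (elim x)
      obtain R z where x: "x = (R, z)" by (cases x)
      show ?case using norm_shift[of z w \<theta>] elim by (simp add: x)
    qed
    have "((\<lambda>x. (case x of (R,z) \<Rightarrow> (norm w)\<^sup>2 / norm z) + norm w * \<bar>(case x of (R,z) \<Rightarrow> Arg2pi z) - \<theta>\<bar>) \<longlongrightarrow> 0 + norm w * \<bar>\<theta> - \<theta>\<bar>) (point_filter \<theta> t)"
      by (intro tendsto_intros point_filter_ratio point_filter_arg)
    then show "((\<lambda>x. (case x of (R,z) \<Rightarrow> (norm w)\<^sup>2 / norm z) + norm w * \<bar>(case x of (R,z) \<Rightarrow> Arg2pi z) - \<theta>\<bar>) \<longlongrightarrow> 0) (point_filter \<theta> t)"
      by simp
  qed auto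
  have a': "((\<lambda>(R,z). Arg2pi (z + w)) \<longlongrightarrow> \<theta>) (point_filter \<theta> t)"
    using tendsto_add[OF a point_filter_arg] by (simp add: case_prod_unfold)
  have n': "((\<lambda>(R,z). norm (z + w) - R) \<longlongrightarrow> t + radial \<theta> w) (point_filter \<theta> t)"
    using tendsto_add[OF tendsto_add[OF n point_filter_norm] tendsto_const[of "radial \<theta> w"]] by (simp add: case_prod_unfold)
  show ?thesis
    unfolding point_filter_def[of \<theta> "t + radial \<theta> w"]
    by (intro filterlim_inf[THEN iffD2] conjI)
       (use point_filter_R[of \<theta> t] a' n' in \<open>simp_all add: filterlim_filtercomap_iff comp_def case_prod_unfold\<close>)
qed

lemma tendsto_tangential_arg: "((\<lambda>(R,z). tangential (Arg2pi z) w) \<longlongrightarrow> tangential \<theta> w) (point_filter \<theta> t)"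
proof -
  have eq: "tangential \<phi> w = Im w * cos \<phi> - Re w * sin \<phi>" for \<phi> by (simp add: tangential_def)
  have "((\<lambda>x. Im w * cos (case x of (R,z) \<Rightarrow> Arg2pi z) - Re w * sin (case x of (R,z) \<Rightarrow> Arg2pi z)) \<longlongrightarrow> Im w * cos \<theta> - Re w * sin \<theta>) (point_filter \<theta> t)"
    by (intro tendsto_intros point_filter_arg)
  then show ?thesis by (simp add: eq case_prod_unfold)
qed

text \<open>The sign of the change of argument is that of the tangential coordinate in direction
  \<open>Arg2pi z\<close>, which converges to a nonzero limit.\<close>

lemma eventually_arg_order:
  assumes th: "0 < \<theta>" "\<theta> < 2 * pi" and w: "tangential \<theta> w \<noteq> 0"
  shows "\<forall>\<^sub>F (R,z) in point_filter \<theta> t. sgn (Arg2pi (z + w) - Arg2pi z) = sgn (tangential \<theta> w)"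
proof -
  have "\<forall>\<^sub>F x in point_filter \<theta> t. sgn (case x of (R,z) \<Rightarrow> tangential (Arg2pi z) w) = sgn (tangential \<theta> w)"
  proof (cases "tangential \<theta> w > 0")
    case True
    show ?thesis using order_tendstoD(1)[OF tendsto_tangential_arg True] by eventually_elim (use True in auto)
  next
    case False
    then have neg: "tangential \<theta> w < 0" using w by simp
    show ?thesis using order_tendstoD(2)[OF tendsto_tangential_arg neg] by eventually_elim (use neg in auto)
  qed
  then show ?thesis using point_filter_shift_cond[OF th, of w t]
    by eventually_elim (auto simp: Arg2pi_shift(2))
qed

lemma eventually_arg_order2:
  assumes th: "0 < \<theta>" "\<theta> < 2 * pi" and w: "tangential \<theta> (v - w) \<noteq> 0"
  shows "\<forall>\<^sub>F (R,z) in point_filter \<theta> t. sgn (Arg2pi (z + v) - Arg2pi (z + w)) = sgn (tangential \<theta> (v - w))"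
  using eventually_compose_filterlim[OF eventually_arg_order[OF th w] point_filter_translate[OF th, of w t]]
  by (simp add: case_prod_unfold)

text \<open>Once the limiting distance avoids both edges of the strip, strict inequalities persist
  and membership is stable.\<close>

lemma eventually_Gamma_R:
  assumes th: "0 < \<theta>" "\<theta> < 2 * pi" and w: "t + radial \<theta> w \<noteq> half_width" "t + radial \<theta> w \<noteq> - half_width" "w \<in> int_lattice"
  shows "\<forall>\<^sub>F (R,z) in point_filter \<theta> t. z \<in> int_lattice \<longrightarrow> (z + w \<in> Gamma_R R \<longleftrightarrow> \<bar>t + radial \<theta> w\<bar> < half_width)"
proof -
  have lim: "((\<lambda>x. \<bar>case x of (R,z) \<Rightarrow> norm (z + w) - R\<bar>) \<longlongrightarrow> \<bar>t + radial \<theta> w\<bar>) (point_filter \<theta> t)"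
    using filterlim_compose[OF point_filter_norm point_filter_translate[OF th, of w t]]
    by (intro tendsto_rabs) (simp add: case_prod_unfold)
  have "\<forall>\<^sub>F x in point_filter \<theta> t. \<bar>case x of (R,z) \<Rightarrow> norm (z + w) - R\<bar> < half_width \<longleftrightarrow> \<bar>t + radial \<theta> w\<bar> < half_width"
  proof (cases "\<bar>t + radial \<theta> w\<bar> < half_width")
    case True
    show ?thesis using order_tendstoD(2)[OF lim True] by eventually_elim (use True in auto)
  next
    case False
    then have gt: "\<bar>t + radial \<theta> w\<bar> > half_width" using w by (auto simp: abs_if split: if_splits)
    show ?thesis using order_tendstoD(1)[OF lim gt] by eventually_elim (use False in auto)
  qed
  then show ?thesis
    by eventually_elim (use w(3) int_lattice_add in \<open>auto simp: Gamma_R_int_lattice abs_less_iff\<close>)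
qed

lemma norm_le_radial_tangential: "norm w \<le> \<bar>radial \<theta> w\<bar> + \<bar>tangential \<theta> w\<bar>"
proof -
  have "norm w = norm (w * cnj (cis \<theta>))" by (simp add: norm_mult)
  also have "\<dots> \<le> \<bar>radial \<theta> w\<bar> + \<bar>tangential \<theta> w\<bar>" unfolding radial_def tangential_def by (rule cmod_le)
  finally show ?thesis .
qed

lemma abs_radial_le: "\<bar>radial \<theta> w\<bar> \<le> norm w" and abs_tangential_le: "\<bar>tangential \<theta> w\<bar> \<le> norm w"
  unfolding radial_def tangential_def
  using abs_Re_le_cmod[of "w * cnj (cis \<theta>)"] abs_Im_le_cmod[of "w * cnj (cis \<theta>)"] by (simp_all add: norm_mult)

text \<open>Limit of the set of displacements from a point at distance \<open>t\<close> to the other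
  points of \<open>Gamma_R\<close>.\<close>

definition strip :: "real \<Rightarrow> real \<Rightarrow> complex set" where
  "strip \<theta> t = {w \<in> int_lattice. \<bar>t + radial \<theta> w\<bar> < half_width}"

lemma finite_strip_segment: "finite {w \<in> strip \<theta> t. 0 < tangential \<theta> w \<and> tangential \<theta> w \<le> B}"
proof (rule finite_subset[OF _ finite_int_lattice_ball[of "half_width + \<bar>t\<bar> + B"]], clarify)
  fix w assume "w \<in> strip \<theta> t" "0 < tangential \<theta> w" "tangential \<theta> w \<le> B"
  then show "w \<in> int_lattice \<and> norm w \<le> half_width + \<bar>t\<bar> + B"
    using norm_le_radial_tangential[of w \<theta>] by (auto simp: strip_def)
qed

text \<open>Every point of the plane is within \<open>half_width\<close> of the lattice. Apply this
  to a point \<open>p\<close> on the central line of the strip, with tangential coordinate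
  \<open>y + 2\<close> to allow for the rounding; the assumption on the edges makes the inequality
  strict.\<close>

lemma strip_unbounded:
  assumes gen: "\<And>w. w \<in> int_lattice \<Longrightarrow> t + radial \<theta> w \<noteq> half_width \<and> t + radial \<theta> w \<noteq> - half_width"
  obtains w where "w \<in> strip \<theta> t" "tangential \<theta> w > y"
proof -
  define p where "p = Complex (- t) (y + 2) * cis \<theta>"
  have pp: "radial \<theta> p = - t" "tangential \<theta> p = y + 2"
    by (simp_all add: p_def radial_def tangential_def mult.assoc cis_cnj cis_mult)
  define w where "w = Complex (of_int (round (Re p))) (of_int (round (Im p)))"
  have wl: "w \<in> int_lattice" by (simp add: w_def int_lattice_def)
  have "\<bar>Re (w - p)\<bar> \<le> 1/2" "\<bar>Im (w - p)\<bar> \<le> 1/2"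
    using of_int_round_abs_le[of "Re p"] of_int_round_abs_le[of "Im p"] by (auto simp: w_def)
  then have "(Re (w - p))\<^sup>2 \<le> (1/2)\<^sup>2" "(Im (w - p))\<^sup>2 \<le> (1/2)\<^sup>2"
    using abs_le_square_iff[of "Re (w - p)" "1/2"] abs_le_square_iff[of "Im (w - p)" "1/2"] by auto
  then have "(norm (w - p))\<^sup>2 \<le> half_width\<^sup>2" unfolding cmod_power2 half_width_def by (simp add: power_divide)
  then have n: "norm (w - p) \<le> half_width" by (rule power2_le_imp_le) (use half_width_bounds in simp)
  have "\<bar>t + radial \<theta> w\<bar> \<le> half_width" using abs_radial_le[of \<theta> "w - p"] n pp by (simp add: radial_diff)
  then have "w \<in> strip \<theta> t" using gen[OF wl] wl by (auto simp: strip_def abs_le_iff less_le)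
  moreover have "tangential \<theta> w > y" using abs_tangential_le[of \<theta> "w - p"] n pp half_width_bounds by (simp add: tangential_diff)
  ultimately show ?thesis using that by blast
qed

text \<open>Tangential coordinates are distinct on the lattice and bounded pieces of the strip are
  finite, so the positive part of the strip is listed in increasing order without end.\<close>

lemma strip_successor:
  assumes irrational_dir: "irrational_dir \<theta>" and gen: "\<And>w. w \<in> int_lattice \<Longrightarrow> t + radial \<theta> w \<noteq> half_width \<and> t + radial \<theta> w \<noteq> - half_width"
  shows "\<exists>v\<in>strip \<theta> t. tangential \<theta> v > 0 \<and> card {w \<in> strip \<theta> t. 0 < tangential \<theta> w \<and> tangential \<theta> w < tangential \<theta> v} = n"
proof -
  let ?S = "strip \<theta> t"
  let ?le = "\<lambda>y. {w \<in> ?S. 0 < tangential \<theta> w \<and> tangential \<theta> w \<le> y}"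
  have nxt: "\<exists>v\<in>?S. tangential \<theta> v > y \<and> {w \<in> ?S. 0 < tangential \<theta> w \<and> tangential \<theta> w < tangential \<theta> v} = ?le y" if y: "y \<ge> 0" for y
  proof -
    obtain w0 where w0: "w0 \<in> ?S" "tangential \<theta> w0 > y" by (rule strip_unbounded[of t \<theta> y]) (use gen that in auto)
    define X where "X = {w \<in> ?S. y < tangential \<theta> w \<and> tangential \<theta> w \<le> tangential \<theta> w0}"
    have fin: "finite X" by (rule finite_subset[OF _ finite_strip_segment[of \<theta> t "tangential \<theta> w0"]]) (use y in \<open>auto simp: X_def\<close>)
    have ne: "X \<noteq> {}" using w0 by (auto simp: X_def)
    obtain v where v: "v \<in> X" "\<And>w. w \<in> X \<Longrightarrow> tangential \<theta> v \<le> tangential \<theta> w"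
      using arg_min_if_finite[OF fin ne, of "tangential \<theta>"] by (metis not_less)
    have "{w \<in> ?S. 0 < tangential \<theta> w \<and> tangential \<theta> w < tangential \<theta> v} = ?le y"
    proof (intro set_eqI iffI)
      fix w assume w: "w \<in> {w \<in> ?S. 0 < tangential \<theta> w \<and> tangential \<theta> w < tangential \<theta> v}"
      have "\<not> tangential \<theta> w > y"
      proof
        assume "tangential \<theta> w > y"
        then have "w \<in> X" using w v(1) by (auto simp: X_def)
        from v(2)[OF this] show False using w by auto
      qed
      then show "w \<in> ?le y" using w by auto
    qed (use v(1) in \<open>auto simp: X_def\<close>)
    then show ?thesis using v(1) unfolding X_def by blast
  qed
  have "\<exists>y\<ge>0. card (?le y) = n" for n
  proof (induction n)
    case 0
    have e: "?le 0 = {}" by auto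
    have "card (?le 0) = 0" unfolding e by (rule card.empty)
    then show ?case by blast
  next
    case (Suc n)
    then obtain y where y: "y \<ge> 0" "card (?le y) = n" by auto
    obtain v where v: "v \<in> ?S" "tangential \<theta> v > y" "{w \<in> ?S. 0 < tangential \<theta> w \<and> tangential \<theta> w < tangential \<theta> v} = ?le y" using nxt[OF y(1)] by blast
    have "?le (tangential \<theta> v) = insert v (?le y)"
    proof (intro set_eqI iffI)
      fix w assume w: "w \<in> ?le (tangential \<theta> v)"
      show "w \<in> insert v (?le y)"
      proof (cases "tangential \<theta> w = tangential \<theta> v")
        case True
        have "w - v \<in> int_lattice" using w v int_lattice_diff by (auto simp: strip_def)
        then have "w = v" using irrational_dir_tangential_nonzero[OF irrational_dir, of "w - v"] True by (auto simp: tangential_diff)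
        then show ?thesis by simp
      next
        case False then show ?thesis unfolding v(3)[symmetric] using w by auto
      qed
    next
      fix w assume "w \<in> insert v (?le y)"
      then show "w \<in> ?le (tangential \<theta> v)" using v(1,2) y(1) by auto
    qed
    moreover have "v \<notin> ?le y" using v(2) by auto
    ultimately have "card (?le (tangential \<theta> v)) = Suc n" using y(2) finite_strip_segment[of \<theta> t y] by simp
    then show ?case using v(2) y(1) by (intro exI[of _ "tangential \<theta> v"]) auto
  qed
  then obtain y where y: "y \<ge> 0" "card (?le y) = n" by auto
  obtain v where "v \<in> ?S" "tangential \<theta> v > y" "{w \<in> ?S. 0 < tangential \<theta> w \<and> tangential \<theta> w < tangential \<theta> v} = ?le y" using nxt[OF y(1)] by blast
  then show ?thesis using y(1) unfolding y(2)[symmetric] by (intro bexI[of _ v]) (simp_all only:, linarith)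
qed

subsection \<open>Successors in the angular enumeration\<close>

locale enumerated =
  fixes lam :: "real \<Rightarrow> nat \<Rightarrow> complex"
  assumes enum: "R > 0 \<Longrightarrow> angular_enumeration R (lam R)"
begin

definition idx :: "real \<Rightarrow> complex \<Rightarrow> nat" where "idx R z = inv_into {1..K_R R} (lam R) z"

definition successor :: "nat \<Rightarrow> real \<Rightarrow> complex \<Rightarrow> complex" where "successor k R z = lam R (idx R z + k)"

lemma bij_lam: "R > 0 \<Longrightarrow> bij_betw (lam R) {1..K_R R} (Gamma_R R)"
  and lam_mono: "R > 0 \<Longrightarrow> i \<in> {1..K_R R} \<Longrightarrow> j \<in> {1..K_R R} \<Longrightarrow> i \<le> j \<Longrightarrow> Arg2pi (lam R i) \<le> Arg2pi (lam R j)"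
  using enum[of R] by (auto simp: angular_enumeration_def mono_on_def)

lemma idx_props:
  assumes "R > 0" "z \<in> Gamma_R R"
  shows "idx R z \<in> {1..K_R R}" "lam R (idx R z) = z"
proof -
  have "z \<in> lam R ` {1..K_R R}" using bij_lam[OF assms(1)] assms(2) by (auto simp: bij_betw_def)
  then show "idx R z \<in> {1..K_R R}" "lam R (idx R z) = z"
    unfolding idx_def by (rule inv_into_into, rule f_inv_into_f)
qed

lemma idx_lam:
  assumes "R > 0" "j \<in> {1..K_R R}"
  shows "idx R (lam R j) = j"
  unfolding idx_def using bij_lam[OF assms(1)] assms(2) by (auto simp: bij_betw_def intro: inv_into_f_f)

lemma lam_in: "R > 0 \<Longrightarrow> j \<in> {1..K_R R} \<Longrightarrow> lam R j \<in> Gamma_R R"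
  using bij_lam[of R] by (auto simp: bij_betw_def)

text \<open>Ties are broken arbitrarily, so only a strict inequality of arguments fixes the order of
  indices.\<close>

lemma idx_less:
  assumes "R > 0" "z \<in> Gamma_R R" "z' \<in> Gamma_R R" "Arg2pi z < Arg2pi z'"
  shows "idx R z < idx R z'"
proof (rule ccontr)
  assume "\<not> idx R z < idx R z'"
  then have "Arg2pi (lam R (idx R z')) \<le> Arg2pi (lam R (idx R z))"
    using idx_props[OF assms(1,2)] idx_props[OF assms(1,3)] by (intro lam_mono assms) auto
  then show False using idx_props[OF assms(1,2)] idx_props[OF assms(1,3)] assms(4) by simp
qed

text \<open>Choose \<open>v\<close> with exactly \<open>k - 1\<close> points of the strip before it.
  Close to the limit, the points listed between \<open>z\<close> and \<open>z + v\<close> are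
  precisely the translates of those, so \<open>z + v\<close> comes \<open>k\<close> places after
  \<open>z\<close>.\<close>

lemma successor_local:
  assumes irrational_dir: "irrational_dir \<theta>" and t: "- half_width < t" "t < half_width"
    and gen: "\<And>w. w \<in> int_lattice \<Longrightarrow> t + radial \<theta> w \<noteq> half_width \<and> t + radial \<theta> w \<noteq> - half_width" and k: "k \<ge> 1"
  shows "\<exists>v. \<forall>\<^sub>F (R,z) in point_filter \<theta> t. z \<in> Gamma_R R \<longrightarrow> successor k R z = z + v \<and> z + v \<in> Gamma_R R"
proof -
  have th: "0 < \<theta>" "\<theta> < 2 * pi" using irrational_dir by (auto simp: irrational_dir_def)
  obtain v where v: "v \<in> strip \<theta> t" "tangential \<theta> v > 0" "card {w \<in> strip \<theta> t. 0 < tangential \<theta> w \<and> tangential \<theta> w < tangential \<theta> v} = k - 1"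
    using strip_successor[OF irrational_dir gen, of "k - 1"] by blast
  have vl: "v \<in> int_lattice" "\<bar>t + radial \<theta> v\<bar> < half_width" using v by (auto simp: strip_def)
  have v0: "v \<noteq> 0" using v(2) by auto
  \<comment> \<open>A finite set containing every relevant displacement: a point with argument
    between those of \<open>z\<close> and \<open>z + v\<close> differs from \<open>z\<close> by at
    most 2 in modulus and about \<open>2 * norm v\<close> along the circle. Finiteness lets the
    eventual statements be combined.\<close>
  define W where "W = {w \<in> int_lattice. norm w \<le> 2 + 2 * norm v}"
  have fW: "finite W" unfolding W_def by (rule finite_int_lattice_ball)
  have vW: "v \<in> W" using vl norm_ge_zero[of v] by (auto simp: W_def)
  have e1: "\<forall>\<^sub>F x in point_filter \<theta> t. \<forall>w\<in>W. (case x of (R,z) \<Rightarrow> z \<in> int_lattice \<longrightarrow> (z + w \<in> Gamma_R R \<longleftrightarrow> \<bar>t + radial \<theta> w\<bar> < half_width))"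
    using fW by (intro eventually_ball_finite ballI eventually_Gamma_R[OF th]) (use gen in \<open>auto simp: W_def\<close>)
  have e2: "\<forall>\<^sub>F x in point_filter \<theta> t. \<forall>w\<in>W - {0}. (case x of (R,z) \<Rightarrow> sgn (Arg2pi (z + w) - Arg2pi z) = sgn (tangential \<theta> w))"
    using fW by (intro eventually_ball_finite ballI eventually_arg_order[OF th] irrational_dir_tangential_nonzero[OF irrational_dir]) (auto simp: W_def)
  have e3: "\<forall>\<^sub>F x in point_filter \<theta> t. \<forall>w\<in>W - {v}. (case x of (R,z) \<Rightarrow> sgn (Arg2pi (z + v) - Arg2pi (z + w)) = sgn (tangential \<theta> (v - w)))"
    using fW by (intro eventually_ball_finite ballI eventually_arg_order2[OF th] irrational_dir_tangential_nonzero[OF irrational_dir]) (auto simp: W_def vl int_lattice_diff)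
  have e4: "\<forall>\<^sub>F x in point_filter \<theta> t. (case x of (R,z) \<Rightarrow> R) > 0"
    by (rule eventually_compose_filterlim[OF eventually_gt_at_top point_filter_R])
  have "\<forall>\<^sub>F (R,z) in point_filter \<theta> t. z \<in> Gamma_R R \<longrightarrow> successor k R z = z + v \<and> z + v \<in> Gamma_R R"
    using e1 e2 e3 e4 point_filter_shift_cond[OF th, of v t]
  proof eventually_elim
    case (elim x)
    obtain R z where x: "x = (R, z)" by (cases x)
    have R: "R > 0" using elim(4) x by simp
    have "successor k R z = z + v \<and> z + v \<in> Gamma_R R" if z: "z \<in> Gamma_R R"
    proof
      have zl: "z \<in> int_lattice" using z by (simp add: Gamma_R_int_lattice)
      have i: "z + w \<in> Gamma_R R \<longleftrightarrow> \<bar>t + radial \<theta> w\<bar> < half_width" if "w \<in> W" for w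
        using elim(1) zl that x by auto
      have ii: "sgn (Arg2pi (z + w) - Arg2pi z) = sgn (tangential \<theta> w)" if "w \<in> W" "w \<noteq> 0" for w
        using elim(2) that x by auto
      have iii: "sgn (Arg2pi (z + v) - Arg2pi (z + w)) = sgn (tangential \<theta> (v - w))" if "w \<in> W" "w \<noteq> v" for w
        using elim(3) that x by auto
      show zv: "z + v \<in> Gamma_R R" using i[OF vW] vl by simp
      have argv: "Arg2pi z < Arg2pi (z + v)" using ii[OF vW v0] v(2) by (simp add: sgn_if split: if_splits)
      have z0: "z \<noteq> 0" and nz: "norm z > 0" using elim(5) x by auto
      have av: "\<bar>Arg2pi (z + v) - Arg2pi z\<bar> \<le> 2 * norm v / norm z"
        using elim(5) x by (intro Arg2pi_shift(1)) auto
      define j j' where "j = idx R z" and "j' = idx R (z + v)"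
      have jj: "j \<in> {1..K_R R}" "lam R j = z" "j' \<in> {1..K_R R}" "lam R j' = z + v"
        using idx_props[OF R z] idx_props[OF R zv] by (auto simp: j_def j'_def)
      have lt: "j < j'" unfolding j_def j'_def by (rule idx_less[OF R z zv argv])
      have img: "lam R ` {j<..<j'} = (+) z ` {w \<in> strip \<theta> t. 0 < tangential \<theta> w \<and> tangential \<theta> w < tangential \<theta> v}"
      proof (intro set_eqI iffI)
        fix y assume "y \<in> lam R ` {j<..<j'}"
        then obtain i0 where i0: "j < i0" "i0 < j'" "y = lam R i0" by auto
        have iK: "i0 \<in> {1..K_R R}" using i0 jj by auto
        have yG: "y \<in> Gamma_R R" using lam_in[OF R iK] i0 by simp
        define w where "w = y - z"
        have yw: "y = z + w" by (simp add: w_def)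
        have wl: "w \<in> int_lattice" using yG zl by (auto simp: w_def Gamma_R_int_lattice int_lattice_diff)
        have arg: "Arg2pi z \<le> Arg2pi y" "Arg2pi y \<le> Arg2pi (z + v)"
          using lam_mono[OF R jj(1) iK] lam_mono[OF R iK jj(3)] i0 jj by auto
        have ne: "y \<noteq> z" "y \<noteq> z + v" using i0 jj iK idx_lam[OF R] by (metis less_irrefl)+
        have "norm w \<le> 2 + 2 * norm v"
        proof -
          have "w = of_real (norm y - norm z) * cis (Arg2pi y) + of_real (norm z) * (cis (Arg2pi y) - cis (Arg2pi z))"
            unfolding w_def by (subst (1) polar_Arg2pi[of y], subst (1) polar_Arg2pi[of z]) (simp add: algebra_simps)
          then have "norm w \<le> norm (of_real (norm y - norm z) * cis (Arg2pi y)) + norm (of_real (norm z) * (cis (Arg2pi y) - cis (Arg2pi z)))"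
            by (metis norm_triangle_ineq)
          also have "\<dots> = \<bar>norm y - norm z\<bar> + norm z * norm (cis (Arg2pi y) - cis (Arg2pi z))"
            unfolding norm_mult norm_of_real norm_cis by simp
          also have "\<bar>norm y - norm z\<bar> \<le> 2" using yG z half_width_bounds by (auto simp: Gamma_R_int_lattice)
          also have "norm z * norm (cis (Arg2pi y) - cis (Arg2pi z)) \<le> norm z * (2 * norm v / norm z)"
            using norm_cis_diff_le[of "Arg2pi y" "Arg2pi z"] arg av by (intro mult_left_mono) auto
          also have "norm z * (2 * norm v / norm z) = 2 * norm v" using nz by simp
          finally show ?thesis by simp
        qed
        then have wW: "w \<in> W" using wl by (simp add: W_def)
        have w0: "w \<noteq> 0" "w \<noteq> v" using ne yw by auto
        have "w \<in> strip \<theta> t" using i[OF wW] yG wl yw by (auto simp: strip_def)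
        moreover have "tangential \<theta> w > 0"
          using ii[OF wW w0(1)] arg(1) irrational_dir_tangential_nonzero[OF irrational_dir wl w0(1)] unfolding yw by (auto simp: sgn_if split: if_splits)
        moreover have "tangential \<theta> (v - w) > 0"
        proof -
          have "tangential \<theta> (v - w) \<noteq> 0" using irrational_dir_tangential_nonzero[OF irrational_dir, of "v - w"] vl wl w0 int_lattice_diff by auto
          then show ?thesis using iii[OF wW w0(2)] arg(2) unfolding yw by (auto simp: sgn_if split: if_splits)
        qed
        ultimately show "y \<in> (+) z ` {w \<in> strip \<theta> t. 0 < tangential \<theta> w \<and> tangential \<theta> w < tangential \<theta> v}"
          using yw by (auto simp: tangential_diff)
      next
        fix y assume "y \<in> (+) z ` {w \<in> strip \<theta> t. 0 < tangential \<theta> w \<and> tangential \<theta> w < tangential \<theta> v}"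
        then obtain w where w: "w \<in> strip \<theta> t" "0 < tangential \<theta> w" "tangential \<theta> w < tangential \<theta> v" "y = z + w" by auto
        have wl: "w \<in> int_lattice" "\<bar>t + radial \<theta> w\<bar> < half_width" using w by (auto simp: strip_def)
        have "norm w \<le> 2 + 2 * norm v"
          using norm_le_radial_tangential[of w \<theta>] wl(2) w(2,3) abs_tangential_le[of \<theta> v] t half_width_bounds norm_ge_zero[of v] by linarith
        then have wW: "w \<in> W" using wl by (simp add: W_def)
        have w0: "w \<noteq> 0" "w \<noteq> v" using w by auto
        have yG: "y \<in> Gamma_R R" using i[OF wW] wl w by simp
        have a1: "Arg2pi z < Arg2pi y" using ii[OF wW w0(1)] w by (simp add: sgn_if split: if_splits)
        have a2: "Arg2pi y < Arg2pi (z + v)" using iii[OF wW w0(2)] w by (simp add: sgn_if tangential_diff split: if_splits)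
        have "j < idx R y" "idx R y < j'" unfolding j_def j'_def
          using idx_less[OF R z yG a1] idx_less[OF R yG zv a2] by auto
        then show "y \<in> lam R ` {j<..<j'}" using idx_props(2)[OF R yG] by (metis greaterThanLessThan_iff image_eqI)
      qed
      have "card {j<..<j'} = card (lam R ` {j<..<j'})"
      proof (rule card_image[symmetric])
        show "inj_on (lam R) {j<..<j'}"
          using bij_lam[OF R] jj by (auto simp: bij_betw_def intro: inj_on_subset)
      qed
      also have "\<dots> = k - 1" unfolding img by (subst card_image) (auto simp: v(3))
      finally have "j' = j + k" using lt k by simp
      then show "successor k R z = z + v" using jj by (simp add: successor_def j_def)
    qed
    then show ?case by (simp add: x)
  qed
  then show ?thesis by blast
qed

definition corr :: "nat \<Rightarrow> real \<Rightarrow> complex \<Rightarrow> real" where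
  "corr k R z = area_R R z * area_R R (successor k R z)"

lemma corr_bound: "\<bar>corr k R z\<bar> \<le> 1"
  using area_R_bounds[of R z] area_R_bounds[of R "successor k R z"] by (simp add: corr_def abs_mult mult_le_one)

text \<open>The successor is a fixed translate, so both factors converge, to
  \<open>half_area\<close> at \<open>t\<close> and at \<open>t + radial \<theta> v\<close>.\<close>

lemma corr_near:
  assumes irrational_dir: "irrational_dir \<theta>" and t: "- half_width < t" "t < half_width"
    and gen: "\<And>w. w \<in> int_lattice \<Longrightarrow> t + radial \<theta> w \<noteq> half_width \<and> t + radial \<theta> w \<noteq> - half_width" and k: "k \<ge> 1"
  shows "\<exists>g. near (corr k) \<theta> t g"
proof -
  have th: "0 < \<theta>" "\<theta> < 2 * pi" using irrational_dir by (auto simp: irrational_dir_def)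
  obtain v where v: "\<forall>\<^sub>F (R,z) in point_filter \<theta> t. z \<in> Gamma_R R \<longrightarrow> successor k R z = z + v \<and> z + v \<in> Gamma_R R"
    using successor_local[OF assms] by blast
  let ?x = "half_area \<theta> t" and ?y = "half_area \<theta> (t + radial \<theta> v)"
  have "near (corr k) \<theta> t (?x * ?y)"
  proof (rule nearI)
    fix e :: real assume e: "e > 0"
    have "\<forall>\<^sub>F (R,z) in point_filter \<theta> t. z \<in> Gamma_R R \<longrightarrow> \<bar>area_R R z - ?x\<bar> \<le> e / 2"
      by (rule nearD[OF area_R_near]) (use e in simp)
    moreover have "\<forall>\<^sub>F (R,z) in point_filter \<theta> t. z + v \<in> Gamma_R R \<longrightarrow> \<bar>area_R R (z + v) - ?y\<bar> \<le> e / 2"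
      using eventually_compose_filterlim[OF nearD[OF area_R_near, of "e / 2"] point_filter_translate[OF th, of v t]] e
      by (simp add: case_prod_unfold)
    ultimately show "\<forall>\<^sub>F (R,z) in point_filter \<theta> t. z \<in> Gamma_R R \<longrightarrow> \<bar>corr k R z - ?x * ?y\<bar> \<le> e"
      using v
    proof eventually_elim
      case (elim p)
      obtain R z where p: "p = (R, z)" by (cases p)
      have "\<bar>corr k R z - ?x * ?y\<bar> \<le> e" if z: "z \<in> Gamma_R R"
      proof -
        have s: "successor k R z = z + v" "z + v \<in> Gamma_R R" using elim(3) z p by auto
        define a b where "a = area_R R z" and "b = area_R R (z + v)"
        have ab: "\<bar>a - ?x\<bar> \<le> e / 2" "\<bar>b - ?y\<bar> \<le> e / 2" using elim z s p by (auto simp: a_def b_def)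
        have b1: "\<bar>b\<bar> \<le> 1" using area_R_bounds by (simp add: b_def)
        have x1: "\<bar>?x\<bar> \<le> 1" using half_area_add[of \<theta> t] by (simp add: half_area_def)
            (metis (mono_tags, lifting) add_increasing2 half_area_def measure_nonneg order_refl half_area_add le_add_same_cancel1)
        have "corr k R z - ?x * ?y = (a - ?x) * b + ?x * (b - ?y)"
          by (simp add: corr_def s a_def b_def algebra_simps)
        then have "\<bar>corr k R z - ?x * ?y\<bar> \<le> \<bar>a - ?x\<bar> * \<bar>b\<bar> + \<bar>?x\<bar> * \<bar>b - ?y\<bar>"
          by (metis abs_mult abs_triangle_ineq)
        also have "\<dots> \<le> e / 2 * 1 + 1 * (e / 2)" by (intro add_mono mult_mono ab b1 x1) (use e in auto)
        finally show ?thesis by simp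
      qed
      then show ?case by (simp add: p)
    qed
  qed
  then show ?thesis by blast
qed

lemma sector_sum_corr:
  assumes irrational_dir: "irrational_dir \<theta>" and k: "k \<ge> 1" and e: "e > 0"
  shows "\<exists>m. arc_approx \<theta> (sector_sum (corr k) (- half_width) half_width) m e"
proof (rule sector_sum_average[OF irrational_dir corr_bound _ e])
  let ?T = "(\<lambda>w. half_width - radial \<theta> w) ` int_lattice \<union> (\<lambda>w. - half_width - radial \<theta> w) ` int_lattice"
  show "countable ?T" using countable_int_lattice by auto
  fix t assume t: "- half_width < t" "t < half_width" "t \<notin> ?T"
  have "t + radial \<theta> w \<noteq> half_width \<and> t + radial \<theta> w \<noteq> - half_width" if "w \<in> int_lattice" for w
    using t(3) that by (auto simp: image_iff algebra_simps)
  then show "\<exists>g. near (corr k) \<theta> t g" by (rule corr_near[OF irrational_dir t(1,2) _ k])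
qed

end

subsection \<open>Averages over the whole circle\<close>

definition arc_sum :: "(real \<Rightarrow> complex \<Rightarrow> real) \<Rightarrow> real \<Rightarrow> real \<Rightarrow> real \<Rightarrow> real" where
  "arc_sum G R a b = (\<Sum>z | z \<in> Gamma_R R \<and> a \<le> Arg2pi z \<and> Arg2pi z < b. G R z)"

lemma finite_arc: "finite {z. z \<in> Gamma_R R \<and> a \<le> Arg2pi z \<and> Arg2pi z < b}"
  by (rule finite_subset[OF _ finite_Gamma_R[of R]]) auto

lemma arc_sum_sector_sum: "arc_sum G R a b = sector_sum G (- half_width) half_width (R, a, b)"
proof -
  have "{z. z \<in> Gamma_R R \<and> a \<le> Arg2pi z \<and> Arg2pi z < b} = lattice_sector R a b (- half_width) half_width \<inter> Gamma_R R"
    by (auto simp: lattice_sector_def Gamma_R_int_lattice)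
  then show ?thesis by (simp add: arc_sum_def sector_sum_def)
qed

lemma arc_sum_split:
  assumes "a \<le> b" "b \<le> c"
  shows "arc_sum G R a c = arc_sum G R a b + arc_sum G R b c"
proof -
  have "{z. z \<in> Gamma_R R \<and> a \<le> Arg2pi z \<and> Arg2pi z < c} =
    {z. z \<in> Gamma_R R \<and> a \<le> Arg2pi z \<and> Arg2pi z < b} \<union> {z. z \<in> Gamma_R R \<and> b \<le> Arg2pi z \<and> Arg2pi z < c}"
    using assms by auto
  then show ?thesis unfolding arc_sum_def
    by (simp only:) (rule sum.union_disjoint[OF finite_arc finite_arc], auto)
qed

lemma arc_sum_full: "arc_sum G R 0 (2 * pi) = (\<Sum>z\<in>Gamma_R R. G R z)"
  by (simp add: arc_sum_def Arg2pi_ge_0 Arg2pi_lt_2pi)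

lemma card_arc_le:
  assumes "a \<le> b" "R \<ge> 12"
  shows "real (card {z. z \<in> Gamma_R R \<and> a \<le> Arg2pi z \<and> Arg2pi z < b}) \<le> 8 * ((b - a) * R + 8)"
proof -
  have "card {z. z \<in> Gamma_R R \<and> a \<le> Arg2pi z \<and> Arg2pi z < b} \<le> card (lattice_sector R a b (- half_width) half_width)"
    by (rule card_mono[OF finite_lattice_sector]) (auto simp: lattice_sector_def Gamma_R_int_lattice)
  also have "real (card (lattice_sector R a b (- half_width) half_width)) \<le> 2 * ((b - a) * R + 8) * (half_width - - half_width + 2)"
    by (rule card_lattice_sector_thin) (use assms half_width_bounds in auto)
  also have "\<dots> \<le> 2 * ((b - a) * R + 8) * 4"
    using assms half_width_bounds by (intro mult_left_mono) auto
  finally show ?thesis by simp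
qed

lemma arc_sum_abs_le:
  assumes "\<And>z. z \<in> Gamma_R R \<Longrightarrow> a \<le> Arg2pi z \<Longrightarrow> Arg2pi z < b \<Longrightarrow> \<bar>G R z\<bar> \<le> B" "B \<ge> 0" "a < b" "R \<ge> 12" "(b - a) * R \<ge> 8"
  shows "\<bar>arc_sum G R a b\<bar> \<le> B * (16 * (b - a) * R)"
proof -
  let ?S = "{z. z \<in> Gamma_R R \<and> a \<le> Arg2pi z \<and> Arg2pi z < b}"
  have "\<bar>arc_sum G R a b\<bar> \<le> (\<Sum>z\<in>?S. \<bar>G R z\<bar>)" unfolding arc_sum_def by (rule sum_abs)
  also have "\<dots> \<le> (\<Sum>z\<in>?S. B)" by (rule sum_mono) (use assms(1) in auto)
  also have "\<dots> = B * real (card ?S)" by simp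
  also have "\<dots> \<le> B * (8 * ((b - a) * R + 8))"
    using assms by (intro mult_left_mono card_arc_le) auto
  also have "\<dots> \<le> B * (16 * ((b - a) * R))"
  proof -
    have "8 * (l + 8) \<le> 16 * l" if "l \<ge> 8" for l :: real using that by simp
    from mult_left_mono[OF this[OF assms(5)] assms(2)] show ?thesis .
  qed
  also have "\<dots> = B * (16 * (b - a) * R)" by simp
  finally show ?thesis .
qed

lemma eventually_arc_large:
  assumes "a < (b::real)"
  shows "\<forall>\<^sub>F R in at_top. R > M \<and> R \<ge> 12 \<and> (b - a) * R \<ge> 8 \<and> (b - a) * R > M"
proof -
  have "\<forall>\<^sub>F R in at_top. R > max M (max 12 (max (8 / (b - a)) (M / (b - a))))" by (rule eventually_gt_at_top)
  then show ?thesis by eventually_elim (use assms in \<open>auto simp: field_simps\<close>)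
qed

lemma countable_bad_angles: "countable ({\<theta>. 0 < \<theta> \<and> \<theta> < 2 * pi \<and> \<not> irrational_dir \<theta>} \<union> {0, 2 * pi})"
  using countable_not_irrational_dir by simp

abbreviation "circle_approx \<equiv> approx_mult at_top (\<lambda>R :: real. R)"

lemma circle_approx_arc:
  assumes "a < b" and "\<And>R. \<lbrakk>R > N; R \<ge> 12; (b - a) * R \<ge> 8; (b - a) * R > N\<rbrakk> \<Longrightarrow> \<bar>f R - m * R\<bar> \<le> c * R"
  shows "circle_approx f m c"
  unfolding approx_mult_def using eventually_arc_large[OF assms(1), of N]
  by eventually_elim (use assms(2) in auto)

text \<open>An arc of small fixed angle containing \<theta> meets the conditions of
  \<open>arc_filter\<close> for all large \<open>R\<close>, which turns the local estimate into one
  in \<open>R\<close> alone.\<close>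

lemma circle_approx_local:
  assumes "arc_approx \<theta> (sector_sum G (- half_width) half_width) m e"
  obtains d where "d > 0" "\<And>a b. \<lbrakk>a < b; a \<le> \<theta>; \<theta> \<le> b; b - a < d\<rbrakk> \<Longrightarrow>
    circle_approx (\<lambda>R. arc_sum G R a b) (m * (b - a)) (e * (b - a))"
proof -
  obtain d N where d: "d > 0" "\<And>R a b. \<lbrakk>R > N; \<bar>a - \<theta>\<bar> < d; \<bar>b - \<theta>\<bar> < d; (b - a) * R > N\<rbrakk> \<Longrightarrow>
      arc_len (R,a,b) > 0 \<and> \<bar>sector_sum G (- half_width) half_width (R,a,b) - m * arc_len (R,a,b)\<bar> \<le> e * arc_len (R,a,b)"
    by (rule eventually_arc_filter_elim[OF assms[unfolded approx_mult_def]]) (rule that)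
  have "circle_approx (\<lambda>R. arc_sum G R a b) (m * (b - a)) (e * (b - a))"
    if ab: "a < b" "a \<le> \<theta>" "\<theta> \<le> b" "b - a < d" for a b
    by (rule circle_approx_arc[OF ab(1), of N]) (use d(2)[of _ a b] ab in \<open>auto simp: arc_sum_sector_sum arc_len_def mult.assoc\<close>)
  then show ?thesis using that d(1) by blast
qed

text \<open>The set \<open>M a b\<close> of admissible values is either everything, when only convergence is at stake, or the
  single value to be established.\<close>

lemma arc_sum_average:
  fixes M :: "real \<Rightarrow> real \<Rightarrow> real set"
  assumes G: "\<And>R z. \<bar>G R z\<bar> \<le> 1" and e: "e > 0"
    and M0: "\<And>a b. mu * (b - a) \<in> M a b"
    and Madd: "\<And>a b c m n. m \<in> M a b \<Longrightarrow> n \<in> M b c \<Longrightarrow> m + n \<in> M a c"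
    and loc: "\<And>\<theta> e. irrational_dir \<theta> \<Longrightarrow> e > 0 \<Longrightarrow>
      \<exists>m. (\<forall>a b. m * (b - a) \<in> M a b) \<and> arc_approx \<theta> (sector_sum G (- half_width) half_width) m e"
  shows "\<exists>m\<in>M 0 (2 * pi). circle_approx (\<lambda>R. \<Sum>z\<in>Gamma_R R. G R z) m e"
proof -
  define P where "P a b c \<longleftrightarrow> (\<exists>m\<in>M a b. circle_approx (\<lambda>R. arc_sum G R a b) m c)" for a b c
  have "P 0 (2 * pi) e"
  proof (rule null_defect_principle[OF _ countable_bad_angles, where C = "16 + \<bar>mu\<bar>"])
    fix a b c x y :: real assume ab: "a < b" "b < c" and P: "P a b x" "P b c y"
    have "arc_sum G R a c = arc_sum G R a b + arc_sum G R b c" for R using ab by (intro arc_sum_split) auto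
    then show "P a c (x + y)" using P approx_mult_add Madd unfolding P_def by (simp only:) blast
  next
    fix a b :: real assume ab: "a < b"
    \<comment> \<open>The sum itself costs 16, and the distance of the prescribed value from 0 costs
      \<open>\<bar>mu\<bar>\<close>.\<close>
    have "circle_approx (\<lambda>R. arc_sum G R a b) (mu * (b - a)) ((16 + \<bar>mu\<bar>) * (b - a))"
    proof (rule circle_approx_arc[OF ab, of 0])
      fix R assume R: "R > 0" "R \<ge> 12" "(b - a) * R \<ge> 8"
      have "\<bar>arc_sum G R a b\<bar> \<le> 1 * (16 * (b - a) * R)" by (rule arc_sum_abs_le) (use R ab G in auto)
      moreover have "\<bar>(mu * (b - a)) * R\<bar> = \<bar>mu\<bar> * (b - a) * R" using R ab by (simp add: abs_mult)
      ultimately show "\<bar>arc_sum G R a b - (mu * (b - a)) * R\<bar> \<le> ((16 + \<bar>mu\<bar>) * (b - a)) * R" by (simp add: algebra_simps)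
    qed
    then show "P a b ((16 + \<bar>mu\<bar>) * (b - a))" unfolding P_def using M0 by blast
  next
    fix \<theta> e :: real assume "0 \<le> \<theta>" "\<theta> \<le> 2 * pi" "\<theta> \<notin> {\<theta>. 0 < \<theta> \<and> \<theta> < 2 * pi \<and> \<not> irrational_dir \<theta>} \<union> {0, 2 * pi}" "e > 0"
    then have "irrational_dir \<theta>" by auto
    then obtain m where m: "\<And>a b. m * (b - a) \<in> M a b" "arc_approx \<theta> (sector_sum G (- half_width) half_width) m e"
      using loc \<open>e > 0\<close> by blast
    show "\<exists>d>0. \<forall>a b. a < b \<and> a \<le> \<theta> \<and> \<theta> \<le> b \<and> b - a < d \<longrightarrow> P a b (e * (b - a))"
      by (rule circle_approx_local[OF m(2)]) (use m(1) in \<open>unfold P_def, blast\<close>)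
  qed (use e in \<open>auto simp: P_def intro: approx_mult_mono\<close>)
  then show ?thesis unfolding P_def arc_sum_full .
qed

lemma arc_sum_average_value:
  assumes G: "\<And>R z. \<bar>G R z\<bar> \<le> 1"
    and loc: "\<And>\<theta> e. irrational_dir \<theta> \<Longrightarrow> e > 0 \<Longrightarrow> arc_approx \<theta> (sector_sum G (- half_width) half_width) \<mu> e"
  shows "((\<lambda>R. (\<Sum>z\<in>Gamma_R R. G R z) / R) \<longlongrightarrow> \<mu> * (2 * pi)) at_top"
proof (rule tendstoI)
  fix e :: real assume e: "e > 0"
  have "\<exists>m\<in>{\<mu> * (2 * pi - 0)}. circle_approx (\<lambda>R. \<Sum>z\<in>Gamma_R R. G R z) m (e / 2)"
    by (rule arc_sum_average[where M = "\<lambda>a b. {\<mu> * (b - a)}" and mu = \<mu>, OF G])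
       (use e in \<open>auto simp: algebra_simps intro!: exI[of _ \<mu>] loc\<close>)
  then have "circle_approx (\<lambda>R. \<Sum>z\<in>Gamma_R R. G R z) (\<mu> * (2 * pi)) (e / 2)" by simp
  then show "\<forall>\<^sub>F R in at_top. dist ((\<Sum>z\<in>Gamma_R R. G R z) / R) (\<mu> * (2 * pi)) < e"
    unfolding approx_mult_ratio by (elim eventually_mono) (use e in \<open>simp add: dist_real_def\<close>)
qed

text \<open>Cauchy's criterion gives a limit along the integers; each approximate value
  \<open>m\<close> is close to it and to \<open>X R\<close> for all large real
  \<open>R\<close>.\<close>

lemma convergent_if_eventually_near:
  fixes X :: "real \<Rightarrow> real"
  assumes "\<And>e. e > 0 \<Longrightarrow> \<exists>m. \<forall>\<^sub>F R in at_top. \<bar>X R - m\<bar> \<le> e"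
  shows "\<exists>c. (X \<longlongrightarrow> c) at_top"
proof -
  have "Cauchy (\<lambda>n. X (real n))"
  proof (rule CauchyI')
    fix e :: real assume e: "e > 0"
    then obtain m where "\<forall>\<^sub>F R in at_top. \<bar>X R - m\<bar> \<le> e / 3" using assms[of "e/3"] by auto
    then obtain N where N: "\<And>R. R \<ge> N \<Longrightarrow> \<bar>X R - m\<bar> \<le> e / 3" by (auto simp: eventually_at_top_linorder)
    have "dist (X (real i)) (X (real j)) < e" if "i \<ge> nat \<lceil>N\<rceil>" "j > i" for i j
    proof -
      have "real i \<ge> N" "real j \<ge> N" using that by linarith+
      then show ?thesis using N[of "real i"] N[of "real j"] e unfolding dist_real_def by linarith
    qed
    then show "\<exists>M. \<forall>m\<ge>M. \<forall>n>m. dist (X (real m)) (X (real n)) < e" by blast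
  qed
  then obtain c where c: "(\<lambda>n. X (real n)) \<longlonglongrightarrow> c" using Cauchy_convergent_iff convergent_def by blast
  have "(X \<longlongrightarrow> c) at_top"
  proof (rule tendstoI)
    fix e :: real assume e: "e > 0"
    then obtain m where m: "\<forall>\<^sub>F R in at_top. \<bar>X R - m\<bar> \<le> e / 3" using assms[of "e/3"] by auto
    have "\<forall>\<^sub>F n in sequentially. \<bar>X (real n) - m\<bar> \<le> e / 3"
      by (rule eventually_compose_filterlim[OF m filterlim_real_sequentially])
    then have "\<bar>c - m\<bar> \<le> e / 3"
      by (intro tendsto_upperbound[OF tendsto_rabs[OF tendsto_diff[OF c tendsto_const]]]) auto
    then show "\<forall>\<^sub>F R in at_top. dist (X R) c < e" using m
    proof (elim eventually_mono)
      fix R assume "\<bar>c - m\<bar> \<le> e / 3" "\<bar>X R - m\<bar> \<le> e / 3"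
      then show "dist (X R) c < e" using e unfolding dist_real_def by linarith
    qed
  qed
  then show ?thesis by blast
qed

lemma arc_sum_average_convergent:
  assumes G: "\<And>R z. \<bar>G R z\<bar> \<le> 1"
    and loc: "\<And>\<theta> e. irrational_dir \<theta> \<Longrightarrow> e > 0 \<Longrightarrow> \<exists>m. arc_approx \<theta> (sector_sum G (- half_width) half_width) m e"
  shows "\<exists>c. ((\<lambda>R. (\<Sum>z\<in>Gamma_R R. G R z) / R) \<longlongrightarrow> c) at_top"
proof (rule convergent_if_eventually_near)
  fix e :: real assume e: "e > 0"
  have "\<exists>m\<in>UNIV. circle_approx (\<lambda>R. \<Sum>z\<in>Gamma_R R. G R z) m e"
    by (rule arc_sum_average[where M = "\<lambda>a b. UNIV", OF G]) (use e loc in auto)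
  then show "\<exists>m. \<forall>\<^sub>F R in at_top. \<bar>(\<Sum>z\<in>Gamma_R R. G R z) / R - m\<bar> \<le> e"
    unfolding approx_mult_ratio by (auto elim: eventually_mono)
qed

section \<open>Averages of the area over \<open>L\<close> consecutive points\<close>

context enumerated begin

definition mean_deviation :: "nat \<Rightarrow> real \<Rightarrow> complex \<Rightarrow> real" where
  "mean_deviation L R z = \<bar>(\<Sum>k=1..L. area_R R (successor k R z) - 1/2) / real L\<bar>"

lemma mean_deviation_bounds: "0 \<le> mean_deviation L R z" "mean_deviation L R z \<le> 1"
proof -
  have "\<bar>\<Sum>k=1..L. area_R R (successor k R z) - 1/2\<bar> \<le> (\<Sum>k=1..L. \<bar>area_R R (successor k R z) - 1/2\<bar>)" by (rule sum_abs)
  also have "\<dots> \<le> (\<Sum>k=1..L. 1)"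
  proof (rule sum_mono)
    fix k show "\<bar>area_R R (successor k R z) - 1/2\<bar> \<le> 1" using area_R_bounds[of R "successor k R z"] by linarith
  qed
  finally show "mean_deviation L R z \<le> 1" by (simp add: mean_deviation_def divide_le_eq)
qed (simp add: mean_deviation_def)

text \<open>The \<open>L\<close> points after \<open>z\<close> fill the arc up to the last of them,
  apart from ties at its ends. For large \<open>L\<close> this arc is long enough for the sector
  estimates, whatever \<open>R\<close> is, so \<open>L0\<close> does not depend on
  \<open>R\<close>.\<close>

lemma mean_deviation_pointwise:
  assumes irrational_dir: "irrational_dir \<theta>" and \<kappa>: "0 < \<kappa>" "\<kappa> \<le> 2/5"
  obtains d L0 where "d > 0" "\<And>b L. \<lbrakk>\<theta> - d < b; b < \<theta> + d; L \<ge> L0\<rbrakk> \<Longrightarrow>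
    \<forall>\<^sub>F R in at_top. \<forall>z\<in>Gamma_R R. \<theta> - d < Arg2pi z \<and> Arg2pi z < b \<longrightarrow> mean_deviation L R z \<le> 3 * \<kappa>"
proof -
  let ?E = "\<lambda>x. \<bar>sector_sum area_R (- half_width) half_width x - half_width * arc_len x\<bar> \<le> \<kappa> * arc_len x \<and>
      \<bar>sector_sum (\<lambda>R z. 1) (- half_width) half_width x - 2 * half_width * arc_len x\<bar> \<le> \<kappa> * arc_len x"
  have "eventually ?E (arc_filter \<theta>)"
    using sector_sum_area[OF irrational_dir \<kappa>(1)] sector_sum_count[OF irrational_dir \<kappa>(1)] unfolding approx_mult_def by eventually_elim blast
  then obtain d N where d: "d > 0" "N > 0"
      "\<And>R a b. \<lbrakk>R > N; \<bar>a - \<theta>\<bar> < d; \<bar>b - \<theta>\<bar> < d; (b - a) * R > N\<rbrakk> \<Longrightarrow> ?E (R,a,b)"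
    by (rule eventually_arc_filter_elim) (rule that)
  \<comment> \<open>Since \<kappa> is at most \<open>2/5\<close>, long arcs then carry at least one
    point per unit length.\<close>
  have hw2: "2 * half_width \<ge> 7/5"
  proof -
    have "sqrt 2 \<le> 10/7" by (rule real_le_lsqrt) (auto simp: power2_eq_square)
    then have "1 / (10/7) \<le> 1 / sqrt 2" by (intro divide_left_mono) auto
    then show ?thesis by (simp add: half_width_def)
  qed
  let ?arc = "\<lambda>R a b. {z. z \<in> Gamma_R R \<and> a \<le> Arg2pi z \<and> Arg2pi z < b}"
  have cnt: "real (card (?arc R a b)) \<ge> (b - a) * R"
    and dv: "\<bar>\<Sum>z\<in>?arc R a b. area_R R z - 1/2\<bar> \<le> 2 * \<kappa> * ((b - a) * R)"
    if R: "R > N" "\<bar>a - \<theta>\<bar> < d" "\<bar>b - \<theta>\<bar> < d" "(b - a) * R > N" for R a b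
  proof -
    define l where "l = (b - a) * R"
    have l: "l > 0" using R d by (simp add: l_def)
    have one: "arc_sum (\<lambda>R z. 1) R a b = real (card (?arc R a b))" by (simp add: arc_sum_def)
    have *: "\<bar>arc_sum area_R R a b - half_width * l\<bar> \<le> \<kappa> * l" "\<bar>real (card (?arc R a b)) - 2 * half_width * l\<bar> \<le> \<kappa> * l"
      using d(3)[OF R] by (simp_all add: arc_sum_sector_sum[symmetric] one arc_len_def l_def)
    have "1 * l \<le> (2 * half_width - \<kappa>) * l" using l \<kappa> hw2 by (intro mult_right_mono) auto
    then show "real (card (?arc R a b)) \<ge> (b - a) * R" using *(2) unfolding l_def[symmetric] by (simp add: left_diff_distrib)
    have "(\<Sum>z\<in>?arc R a b. area_R R z - 1/2) = arc_sum area_R R a b - real (card (?arc R a b)) / 2"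
      by (simp add: arc_sum_def sum_subtractf)
    then show "\<bar>\<Sum>z\<in>?arc R a b. area_R R z - 1/2\<bar> \<le> 2 * \<kappa> * ((b - a) * R)"
      using * \<kappa> l mult_pos_pos[OF \<kappa>(1) l] unfolding l_def[symmetric] by (simp add: abs_le_iff)
  qed
  \<comment> \<open>The first term forces an arc holding \<open>L\<close> points to be longer than
    \<open>N\<close>; the second makes the accumulated end errors, at most 288, smaller than
    \<open>\<kappa> * L\<close>.\<close>
  define L0 where "L0 = nat \<lceil>8 * (N + 9) + 288 / \<kappa>\<rceil> + 1"
  have ev: "\<forall>\<^sub>F R in at_top. \<forall>z\<in>Gamma_R R. \<theta> - d < Arg2pi z \<and> Arg2pi z < b \<longrightarrow> mean_deviation L R z \<le> 3 * \<kappa>"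
    if b: "\<theta> - d < b" "b < \<theta> + d" and L: "L \<ge> L0" for b L
  proof -
    have Lr: "real L > 8 * (N + 9)" "real L > 288 / \<kappa>" 
    proof -
      have "real L > 8 * (N + 9) + 288 / \<kappa>" using L unfolding L0_def by linarith
      moreover have "288 / \<kappa> > 0" "8 * (N + 9) > 0" using \<kappa> d by auto
      ultimately show "real L > 8 * (N + 9)" "real L > 288 / \<kappa>" by linarith+
    qed
    have "0 < 8 * (N + 9)" using d(2) by simp
    then have L1: "real L > 0" using Lr(1) by (rule less_trans)
    \<comment> \<open>The spare arc from \<open>b\<close> to \<open>b1\<close> will hold more than
      \<open>L\<close> points, so the \<open>L\<close> successors of \<open>z\<close> stay close to
      \<theta> and their indices do not wrap round.\<close>
    define b1 where "b1 = (b + \<theta> + d) / 2"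
    have b1: "b < b1" "b1 < \<theta> + d" using b by (auto simp: b1_def)
    show ?thesis using eventually_arc_large[OF b1(1), of "max N (real L + 1)"]
    proof eventually_elim
      case (elim R)
      have R: "R > N" "R \<ge> 12" "(b1 - b) * R > N" "(b1 - b) * R > real L + 1" "R > 0" using elim d by auto
      show ?case
      proof (intro ballI impI)
        fix z assume z: "z \<in> Gamma_R R" and az: "\<theta> - d < Arg2pi z \<and> Arg2pi z < b"
        define j where "j = idx R z"
        have j: "j \<in> {1..K_R R}" "lam R j = z" using idx_props[OF R(5) z] by (auto simp: j_def)
        have "real (card (?arc R b b1)) \<ge> (b1 - b) * R" by (rule cnt) (use R b b1 in auto)
        then have c: "card (?arc R b b1) > L" using R(4) by linarith
        have "\<exists>y\<in>?arc R b b1. idx R y > j + L"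
        proof (rule ccontr)
          assume "\<not> ?thesis"
          then have le: "\<And>y. y \<in> ?arc R b b1 \<Longrightarrow> idx R y \<le> j + L" by force
          have "inj_on (idx R) (?arc R b b1)"
            by (rule inj_onI) (use idx_props(2)[OF R(5)] in \<open>metis (mono_tags, lifting) mem_Collect_eq\<close>)
          moreover have "idx R ` ?arc R b b1 \<subseteq> {j<..j + L}"
          proof
            fix i assume "i \<in> idx R ` ?arc R b b1"
            then obtain y where y: "y \<in> ?arc R b b1" "i = idx R y" by auto
            have "j < idx R y" unfolding j_def by (rule idx_less[OF R(5) z]) (use y az in auto)
            then show "i \<in> {j<..j + L}" using y le by auto
          qed
          ultimately have "card (?arc R b b1) \<le> card {j<..j + L}"
            by (rule card_inj_on_le) simp
          then show False using c by simp
        qed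
        then obtain y where y: "y \<in> ?arc R b b1" "idx R y > j + L" by blast
        have yi: "idx R y \<in> {1..K_R R}" "lam R (idx R y) = y" using idx_props[OF R(5), of y] y by auto
        have jL: "j + L \<in> {1..K_R R}" using yi y(2) j by auto
        define \<alpha> \<gamma> where "\<alpha> = Arg2pi z" and "\<gamma> = Arg2pi (lam R (j + L))"
        have "\<gamma> \<le> Arg2pi y" unfolding \<gamma>_def using lam_mono[OF R(5) jL yi(1)] y(2) yi(2) by simp
        then have \<gamma>1: "\<gamma> < b1" using y by auto
        have \<alpha>\<gamma>: "\<alpha> \<le> \<gamma>" unfolding \<alpha>_def \<gamma>_def using lam_mono[OF R(5) j(1) jL] j(2) by simp
        \<comment> \<open>The successors \<open>?B\<close> and the arc \<open>?M\<close> differ only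
          in points whose argument is exactly \<alpha> or \<gamma>. Each of these two groups lies in
          an arc of length 1, hence has at most 72 points.\<close>
        let ?B = "lam R ` {j<..j + L}" and ?M = "?arc R \<alpha> \<gamma>"
        have Bin: "{j<..j + L} \<subseteq> {1..K_R R}" using jL j by auto
        have injB: "inj_on (lam R) {j<..j + L}" using bij_lam[OF R(5)] Bin by (auto simp: bij_betw_def intro: inj_on_subset)
        have cardB: "card ?B = L" using card_image[OF injB] by simp
        have BG: "?B \<subseteq> Gamma_R R" using lam_in[OF R(5)] Bin by auto
        have Barg: "\<alpha> \<le> Arg2pi x \<and> Arg2pi x \<le> \<gamma>" if xB: "x \<in> ?B" for x
        proof -
          obtain i where i: "i \<in> {j<..j + L}" "x = lam R i" using xB by auto
          then have "i \<in> {1..K_R R}" using Bin by auto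
          then show ?thesis using lam_mono[OF R(5) j(1), of i] lam_mono[OF R(5) _ jL, of i] i j
            unfolding \<alpha>_def \<gamma>_def by auto
        qed
        have fin: "finite ?M" "finite ?B" using finite_arc by auto
        have tie: "real (card (?arc R x (x + 1 / R))) \<le> 72" for x
          using card_arc_le[of x "x + 1 / R" R] R by simp
        have lt1: "x < x + 1 / R" for x using R by simp
        have "card (?B - ?M) \<le> card (?arc R \<gamma> (\<gamma> + 1 / R))"
        proof (rule card_mono[OF finite_arc], rule subsetI)
          fix x assume "x \<in> ?B - ?M"
          then show "x \<in> ?arc R \<gamma> (\<gamma> + 1 / R)" using Barg[of x] BG lt1[of \<gamma>] by auto
        qed
        then have cBM: "real (card (?B - ?M)) \<le> 72" using tie[of \<gamma>] by linarith
        have "card (?M - ?B) \<le> card (?arc R \<alpha> (\<alpha> + 1 / R))"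
        proof (rule card_mono[OF finite_arc], rule subsetI)
          fix x assume x: "x \<in> ?M - ?B"
          then have xG: "x \<in> Gamma_R R" by auto
          have xi: "idx R x \<in> {1..K_R R}" "lam R (idx R x) = x" using idx_props[OF R(5) xG] by auto
          have "idx R x < j + L"
          proof (rule ccontr)
            assume "\<not> idx R x < j + L"
            then have "\<gamma> \<le> Arg2pi x" unfolding \<gamma>_def using lam_mono[OF R(5) jL xi(1)] xi(2) by simp
            then show False using x by auto
          qed
          moreover have "idx R x \<notin> {j<..j + L}"
          proof
            assume "idx R x \<in> {j<..j + L}"
            then have "lam R (idx R x) \<in> ?B" by (rule imageI)
            then show False using x unfolding xi(2) by blast
          qed
          ultimately have "idx R x \<le> j" by auto
          then have "Arg2pi x \<le> \<alpha>" unfolding \<alpha>_def using lam_mono[OF R(5) xi(1) j(1)] xi(2) j(2) by simp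
          then show "x \<in> ?arc R \<alpha> (\<alpha> + 1 / R)" using x xG lt1[of \<alpha>] by auto
        qed
        then have cMB: "real (card (?M - ?B)) \<le> 72" using tie[of \<alpha>] by linarith
        let ?f = "\<lambda>x. area_R R x - 1/2"
        have fb: "\<bar>sum ?f S\<bar> \<le> real (card S)" for S
        proof -
          have "\<bar>sum ?f S\<bar> \<le> (\<Sum>x\<in>S. \<bar>?f x\<bar>)" by (rule sum_abs)
          also have "\<dots> \<le> (\<Sum>x\<in>S. 1)"
          proof (rule sum_mono)
            fix x show "\<bar>?f x\<bar> \<le> 1" using area_R_bounds[of R x] by linarith
          qed
          finally show ?thesis by simp
        qed
        have "sum ?f ?B = sum ?f (?B \<inter> ?M) + sum ?f (?B - ?M)" by (rule sum.Int_Diff[OF fin(2)])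
        moreover have "sum ?f ?M = sum ?f (?B \<inter> ?M) + sum ?f (?M - ?B)"
          by (subst Int_commute) (rule sum.Int_Diff[OF fin(1)])
        ultimately have diff: "sum ?f ?B - sum ?f ?M = sum ?f (?B - ?M) - sum ?f (?M - ?B)" by linarith
        have diff': "\<bar>sum ?f ?B - sum ?f ?M\<bar> \<le> 144"
          unfolding diff using fb[of "?B - ?M"] fb[of "?M - ?B"] cBM cMB by linarith
        have big: "(\<gamma> - \<alpha>) * R > N"
        proof (rule ccontr)
          assume small: "\<not> (\<gamma> - \<alpha>) * R > N"
          have "card ?B \<le> card (?arc R \<alpha> (\<gamma> + 1 / R))"
          proof (rule card_mono[OF finite_arc], rule subsetI)
            fix x assume xB: "x \<in> ?B"
            have "Arg2pi x < \<gamma> + 1 / R" using Barg[OF xB] lt1[of \<gamma>] by linarith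
            then show "x \<in> ?arc R \<alpha> (\<gamma> + 1 / R)" using Barg[OF xB] BG xB by blast
          qed
          then have "real L \<le> real (card (?arc R \<alpha> (\<gamma> + 1 / R)))" unfolding cardB by simp
          moreover have "real (card (?arc R \<alpha> (\<gamma> + 1 / R))) \<le> 8 * ((\<gamma> + 1 / R - \<alpha>) * R + 8)"
            using \<alpha>\<gamma> lt1[of \<gamma>] R(2) by (intro card_arc_le) linarith+
          moreover have eq: "(\<gamma> + 1 / R - \<alpha>) * R = (\<gamma> - \<alpha>) * R + 1" using R by (simp add: algebra_simps)
          ultimately have "real L \<le> 8 * ((\<gamma> - \<alpha>) * R + 1 + 8)" unfolding eq by (blast intro: order_trans)
          also have "\<dots> \<le> 8 * (N + 1 + 8)" using small by (intro mult_left_mono add_right_mono) simp_all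
          finally show False using Lr(1) by simp
        qed
        have near: "\<bar>\<alpha> - \<theta>\<bar> < d" "\<bar>\<gamma> - \<theta>\<bar> < d" using az b b1 \<gamma>1 \<alpha>\<gamma> by (auto simp: \<alpha>_def abs_less_iff)
        have "(\<gamma> - \<alpha>) * R \<le> real (card ?M)" by (rule cnt[OF R(1) near big])
        also have "real (card ?M) \<le> real (card ?B) + 72"
        proof -
          have "card ?M = card (?M \<inter> ?B) + card (?M - ?B)" by (rule card_Int_Diff[OF fin(1)])
          moreover have "card (?M \<inter> ?B) \<le> card ?B" by (rule card_mono[OF fin(2) Int_lower2])
          ultimately show ?thesis using cMB by linarith
        qed
        finally have l: "(\<gamma> - \<alpha>) * R \<le> real L + 72" unfolding cardB .
        have "\<bar>sum ?f ?M\<bar> \<le> 2 * \<kappa> * ((\<gamma> - \<alpha>) * R)" by (rule dv[OF R(1) near big])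
        also have "\<dots> \<le> 2 * \<kappa> * (real L + 72)" using l \<kappa> by (intro mult_left_mono) auto
        finally have "\<bar>sum ?f ?B\<bar> \<le> 2 * \<kappa> * (real L + 72) + 144" using diff' by linarith
        also have "\<dots> \<le> 2 * \<kappa> * real L + 288" using \<kappa> by (simp add: algebra_simps)
        also have "288 \<le> \<kappa> * real L" using Lr(2) \<kappa> by (simp add: field_simps)
        finally have "\<bar>sum ?f ?B\<bar> \<le> 3 * \<kappa> * real L" by (simp add: algebra_simps)
        moreover have "(\<Sum>k=1..L. area_R R (successor k R z) - 1/2) = sum ?f ?B"
        proof -
          have "sum ?f ?B = (\<Sum>i\<in>{j<..j + L}. ?f (lam R i))" by (rule sum.reindex_cong[OF injB refl refl])
          also have "\<dots> = (\<Sum>k\<in>{1..L}. ?f (lam R (j + k)))"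
            by (rule sum.reindex_bij_witness[of _ "\<lambda>k. j + k" "\<lambda>i. i - j"]) auto
          finally show ?thesis by (simp add: successor_def j_def)
        qed
        ultimately show "mean_deviation L R z \<le> 3 * \<kappa>" unfolding mean_deviation_def using L1 by (simp only: abs_divide abs_of_nat divide_le_eq if_True)
      qed
    qed
  qed
  show ?thesis using that[OF d(1) ev] by blast
qed

text \<open>The principle in the angle, with the quantifier over large \<open>L\<close> inside the
  predicate: joining two arcs takes the larger threshold, and every threshold is fixed before
  \<open>R\<close> grows.\<close>

lemma mean_deviation_average:
  assumes e: "e > 0"
  shows "\<exists>L0. \<forall>L\<ge>L0. circle_approx (\<lambda>R. \<Sum>z\<in>Gamma_R R. mean_deviation L R z) 0 e"
proof -
  define P where "P a b c \<longleftrightarrow> (\<exists>L0. \<forall>L\<ge>L0. circle_approx (\<lambda>R. arc_sum (mean_deviation L) R a b) 0 c)" for a b c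
  have "P 0 (2 * pi) e"
  proof (rule null_defect_principle[OF _ countable_bad_angles, where C = 16])
    fix a b c x y :: real assume ab: "a < b" "b < c" and P: "P a b x" "P b c y"
    obtain L1 L2 where L: "\<And>L. L \<ge> L1 \<Longrightarrow> circle_approx (\<lambda>R. arc_sum (mean_deviation L) R a b) 0 x"
      "\<And>L. L \<ge> L2 \<Longrightarrow> circle_approx (\<lambda>R. arc_sum (mean_deviation L) R b c) 0 y"
      using P unfolding P_def by blast
    have "arc_sum (mean_deviation L) R a c = arc_sum (mean_deviation L) R a b + arc_sum (mean_deviation L) R b c" for L R using ab by (intro arc_sum_split) auto
    then have "circle_approx (\<lambda>R. arc_sum (mean_deviation L) R a c) 0 (x + y)" if "L \<ge> max L1 L2" for L
      using approx_mult_add[OF L(1)[of L] L(2)[of L]] that by simp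
    then show "P a c (x + y)" unfolding P_def by blast
  next
    fix a b x y :: real assume "P a b x" "x \<le> y"
    then show "P a b y" unfolding P_def using approx_mult_mono by blast
  next
    fix a b :: real assume ab: "a < b"
    have "circle_approx (\<lambda>R. arc_sum (mean_deviation L) R a b) 0 (16 * (b - a))" for L
    proof (rule circle_approx_arc[OF ab, of 0])
      fix R assume R: "R \<ge> 12" "(b - a) * R \<ge> 8"
      have "\<bar>arc_sum (mean_deviation L) R a b\<bar> \<le> 1 * (16 * (b - a) * R)"
        by (rule arc_sum_abs_le) (use R ab mean_deviation_bounds in auto)
      then show "\<bar>arc_sum (mean_deviation L) R a b - 0 * R\<bar> \<le> 16 * (b - a) * R" by simp
    qed
    then show "P a b (16 * (b - a))" unfolding P_def by blast
  next
    fix \<theta> e :: real assume t: "0 \<le> \<theta>" "\<theta> \<le> 2 * pi" "\<theta> \<notin> {\<theta>. 0 < \<theta> \<and> \<theta> < 2 * pi \<and> \<not> irrational_dir \<theta>} \<union> {0, 2 * pi}" "e > 0"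
    then have irrational_dir: "irrational_dir \<theta>" by auto
    \<comment> \<open>48 is the pointwise factor 3 times the factor 16 of
      \<open>arc_sum_abs_le\<close>.\<close>
    define \<kappa> where "\<kappa> = min (2/5) (e / 48)"
    have \<kappa>: "0 < \<kappa>" "\<kappa> \<le> 2/5" "\<kappa> \<le> e / 48" using t by (auto simp: \<kappa>_def)
    obtain d L0 where d: "d > 0" "\<And>b L. \<lbrakk>\<theta> - d < b; b < \<theta> + d; L \<ge> L0\<rbrakk> \<Longrightarrow>
      \<forall>\<^sub>F R in at_top. \<forall>z\<in>Gamma_R R. \<theta> - d < Arg2pi z \<and> Arg2pi z < b \<longrightarrow> mean_deviation L R z \<le> 3 * \<kappa>"
      by (rule mean_deviation_pointwise[OF irrational_dir \<kappa>(1,2)]) (rule that)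
    have "circle_approx (\<lambda>R. arc_sum (mean_deviation L) R a b) 0 (e * (b - a))"
      if ab: "a < b" "a \<le> \<theta>" "\<theta> \<le> b" "b - a < d" and L: "L \<ge> L0" for a b L
    proof -
      have b: "\<theta> - d < b" "b < \<theta> + d" using ab by auto
      from d(2)[OF b L] eventually_arc_large[OF ab(1), of 0] show ?thesis unfolding approx_mult_def
      proof eventually_elim
        case (elim R)
        have "\<bar>arc_sum (mean_deviation L) R a b\<bar> \<le> (3 * \<kappa>) * (16 * (b - a) * R)"
          by (rule arc_sum_abs_le) (use elim ab mean_deviation_bounds \<kappa> in auto)
        also have "\<dots> = (48 * \<kappa>) * ((b - a) * R)" by simp
        also have "\<dots> \<le> e * ((b - a) * R)" using \<kappa> elim ab by (intro mult_right_mono) auto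
        finally show ?case using elim by (simp add: mult.assoc)
      qed
    qed
    then show "\<exists>d>0. \<forall>a b. a < b \<and> a \<le> \<theta> \<and> \<theta> \<le> b \<and> b - a < d \<longrightarrow> P a b (e * (b - a))"
      unfolding P_def using d(1) by blast
  qed (use e in auto)
  then show ?thesis unfolding P_def arc_sum_full .
qed

lemma corr_avg_eq:
  assumes R: "R > 0" and K: "K_R R > 0"
  shows "corr_avg lam k R = (\<Sum>z\<in>Gamma_R R. corr k R z) / real (K_R R) - 1/4"
proof -
  have "(\<Sum>z\<in>Gamma_R R. corr k R z) = (\<Sum>j=1..K_R R. corr k R (lam R j))"
    by (rule sum.reindex_bij_betw[OF bij_lam[OF R], symmetric])
  also have "\<dots> = (\<Sum>j=1..K_R R. area_R R (lam R j) * area_R R (lam R (j + k)))"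
    by (rule sum.cong) (auto simp: corr_def successor_def idx_lam[OF R])
  finally show ?thesis using K by (simp add: corr_avg_def sum_subtractf diff_divide_distrib)
qed

text \<open>After the sums are swapped, \<open>area_R R z\<close> factors out of the average over
  \<open>k\<close>, and it is at most 1.\<close>

lemma sum_corr_mean_deviation:
  assumes "L > 0"
  shows "\<bar>(\<Sum>k=1..L. \<Sum>z\<in>Gamma_R R. corr k R z) / real L - (\<Sum>z\<in>Gamma_R R. area_R R z) / 2\<bar> \<le> (\<Sum>z\<in>Gamma_R R. mean_deviation L R z)"
proof -
  let ?D = "\<lambda>z. (\<Sum>k=1..L. area_R R (successor k R z) - 1/2) / real L"
  have D: "area_R R z * ?D z = (\<Sum>k=1..L. corr k R z) / real L - area_R R z / 2" for z
    using assms by (simp add: corr_def sum_subtractf sum_distrib_left[symmetric] right_diff_distrib diff_divide_distrib)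
  have eq: "(\<Sum>k=1..L. \<Sum>z\<in>Gamma_R R. corr k R z) / real L - (\<Sum>z\<in>Gamma_R R. area_R R z) / 2
     = (\<Sum>z\<in>Gamma_R R. area_R R z * ?D z)"
    unfolding D by (subst sum.swap) (simp add: sum_subtractf sum_divide_distrib)
  show ?thesis unfolding eq
  proof (rule order_trans[OF sum_abs], rule sum_mono)
    fix z
    have "\<bar>area_R R z\<bar> * \<bar>?D z\<bar> \<le> 1 * \<bar>?D z\<bar>" using area_R_bounds[of R z] by (intro mult_right_mono) auto
    then show "\<bar>area_R R z * ?D z\<bar> \<le> mean_deviation L R z" unfolding abs_mult mean_deviation_def by simp
  qed
qed

end

section \<open>Passage to the limit in \<open>R\<close>, then in \<open>L\<close>\<close>

theorem theorem1p4:
  fixes lam :: "real \<Rightarrow> nat \<Rightarrow> complex"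
  assumes "\<And>R. R > 0 \<Longrightarrow> angular_enumeration R (lam R)"
  shows "(\<forall>k\<ge>1. \<exists>c. (corr_avg lam k \<longlongrightarrow> c) at_top) \<and>
    (\<lambda>L. 1 / real L * (\<Sum>k = 1..L. corr_limit lam k)) \<longlonglongrightarrow> 0"
proof -
  interpret enumerated lam by unfold_locales (rule assms)
  let ?S = "\<lambda>G R. \<Sum>z\<in>Gamma_R R. G R z"
  \<comment> \<open>Width of the strip times circumference of the unit circle: the limit of
    \<open>K_R R / R\<close>.\<close>
  define \<kappa> where "\<kappa> = 2 * half_width * (2 * pi)"
  have \<kappa>: "\<kappa> > 0" using half_width_bounds by (simp add: \<kappa>_def)
  have "((\<lambda>R. (\<Sum>z\<in>Gamma_R R. 1) / R) \<longlongrightarrow> \<kappa>) at_top"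
    unfolding \<kappa>_def by (rule arc_sum_average_value) (auto intro: sector_sum_count)
  then have K: "((\<lambda>R. real (K_R R) / R) \<longlongrightarrow> \<kappa>) at_top" by (simp add: K_R_def)
  have A: "((\<lambda>R. ?S area_R R / R) \<longlongrightarrow> half_width * (2 * pi)) at_top"
  proof (rule arc_sum_average_value[OF _ sector_sum_area])
    show "\<bar>area_R R z\<bar> \<le> 1" for R z using area_R_bounds[of R z] by simp
  qed
  have "\<exists>c. ((\<lambda>R. ?S (corr k) R / R) \<longlongrightarrow> c) at_top" if "k \<ge> 1" for k
    by (rule arc_sum_average_convergent[OF corr_bound]) (use sector_sum_corr that in blast)
  then obtain c where c: "\<And>k. k \<ge> 1 \<Longrightarrow> ((\<lambda>R. ?S (corr k) R / R) \<longlongrightarrow> c k) at_top"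
    by metis
  have evK: "\<forall>\<^sub>F R in at_top. R > 0 \<and> K_R R > 0"
    using order_tendstoD(1)[OF K \<kappa>] eventually_gt_at_top[of 0]
    by eventually_elim (auto simp: zero_less_divide_iff)
  have lim: "(corr_avg lam k \<longlongrightarrow> c k / \<kappa> - 1/4) at_top" if k: "k \<ge> 1" for k
  proof -
    have "((\<lambda>R. (?S (corr k) R / R) / (real (K_R R) / R) - 1/4) \<longlongrightarrow> c k / \<kappa> - 1/4) at_top"
      by (intro tendsto_intros c K k) (use \<kappa> in simp)
    moreover have "\<forall>\<^sub>F R in at_top. (?S (corr k) R / R) / (real (K_R R) / R) - 1/4 = corr_avg lam k R"
      using evK by eventually_elim (simp add: corr_avg_eq)
    ultimately show ?thesis by (rule Lim_transform_eventually)
  qed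
  have cl: "corr_limit lam k = c k / \<kappa> - 1/4" if "k \<ge> 1" for k
    unfolding corr_limit_def by (rule tendsto_Lim[OF _ lim[OF that]]) simp
  have "(\<lambda>L. 1 / real L * (\<Sum>k = 1..L. corr_limit lam k)) \<longlonglongrightarrow> 0"
  proof (rule LIMSEQ_I)
    fix r :: real assume r: "r > 0"
    define e where "e = r * \<kappa> / 2"
    have e: "e > 0" using r \<kappa> by (simp add: e_def)
    obtain L0 where L0: "\<And>L. L \<ge> L0 \<Longrightarrow> circle_approx (?S (mean_deviation L)) 0 e"
      using mean_deviation_average[OF e] by blast
    have "norm (1 / real L * (\<Sum>k = 1..L. corr_limit lam k) - 0) < r" if L: "L \<ge> max 1 L0" for L
    proof -
      have L1: "L > 0" "L \<ge> L0" using L by auto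
      \<comment> \<open>\<open>L\<close> is fixed while \<open>R\<close> tends to infinity. The
        subtracted term tends to \<open>\<kappa> / 4\<close>, which after division by \<kappa> is
        the \<open>1/4\<close> of the statement.\<close>
      let ?X = "\<lambda>R. (\<Sum>k=1..L. ?S (corr k) R / R) / real L - ?S area_R R / R / 2"
      have "((\<lambda>R. \<bar>?X R\<bar>) \<longlongrightarrow> \<bar>(\<Sum>k=1..L. c k) / real L - half_width * (2 * pi) / 2\<bar>) at_top"
        by (intro tendsto_intros A c) (use L1 in auto)
      moreover have "\<forall>\<^sub>F R in at_top. \<bar>?X R\<bar> \<le> e"
        using L0[OF L1(2)] unfolding approx_mult_def
      proof eventually_elim
        case (elim R)
        define Y where "Y = (\<Sum>k=1..L. ?S (corr k) R) / real L - ?S area_R R / 2"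
        have "\<bar>Y\<bar> \<le> e * R" unfolding Y_def using sum_corr_mean_deviation[OF L1(1), of R] elim by linarith
        moreover have "?X R = Y / R"
          by (simp add: Y_def diff_divide_distrib sum_divide_distrib[symmetric] mult.commute)
        ultimately show ?case using elim by (simp add: divide_le_eq)
      qed
      ultimately have le: "\<bar>(\<Sum>k=1..L. c k) / real L - (half_width * (2 * pi)) / 2\<bar> \<le> e"
        by (rule tendsto_upperbound) simp
      have "1 / real L * (\<Sum>k = 1..L. corr_limit lam k) = 1 / real L * (\<Sum>k = 1..L. c k / \<kappa> - 1/4)"
        using cl by (intro arg_cong2[where f = "(*)"] sum.cong) auto
      also have "\<dots> = ((\<Sum>k=1..L. c k) / real L - \<kappa> / 4) / \<kappa>"
        using L1 \<kappa> by (simp add: sum_subtractf sum_divide_distrib[symmetric] diff_divide_distrib right_diff_distrib)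
      finally have "\<bar>1 / real L * (\<Sum>k = 1..L. corr_limit lam k)\<bar> = \<bar>(\<Sum>k=1..L. c k) / real L - \<kappa> / 4\<bar> / \<kappa>"
        using \<kappa> by simp
      also have "\<dots> \<le> e / \<kappa>" using le \<kappa> by (intro divide_right_mono) (auto simp: \<kappa>_def)
      also have "\<dots> < r" using r \<kappa> by (simp add: e_def)
      finally show ?thesis by simp
    qed
    then show "\<exists>no. \<forall>n\<ge>no. norm (1 / real n * (\<Sum>k = 1..n. corr_limit lam k) - 0) < r" by blast
  qed
  then show ?thesis using lim by blast
qed

end
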